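(* Let $A=\{A_\alpha\}_{\alpha\in\pi}$ be a Hopf $\pi$-coalgebra and let $R$ be a right ideal of $A_1$ contained in $\ker\varepsilon$. For each $\alpha\in\pi$ put $N_\alpha=r_\alpha^{-1}(A_\alpha\otimes R)$. Then $N=\{N_\alpha\}_{\alpha\in\pi}$ is a sub-bimodule of $A^2=\{A^2_\alpha\}_{\alpha\in\pi}$ (each $N_\alpha$ is an $A_\alpha$-sub-bimodule of $A_\alpha^2$). Moreover, let $\Gamma_\alpha=A_\alpha^2/N_\alpha$, let $\Pi_\alpha:A_\alpha^2\to\Gamma_\alpha$ be the canonical epimorphism and $d_\alpha=\Pi_\alpha\circ D_\alpha$. Then the $\pi$-graded first order differential calculus $\Gamma=(\{\Gamma_\alpha\}_{\alpha\in\pi},\{d_\alpha\}_{\alpha\in\pi})$ is left covariant. Conversely, any left covariant $\pi$-graded first order differential calculus over $A$ can be obtained in this way, i.e. is isomorphic to one of this form for some right ideal $R$ of $A_1$ contained in $\ker\varepsilon$.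
   Context: Let $k$ be a field and $\pi$ a group with identity $1$; $\otimes=\otimes_k$. A Hopf $\pi$-coalgebra (Hopf group coalgebra) is a family $A=\{A_\alpha\}_{\alpha\in\pi}$ of unital associative $k$-algebras (multiplication $m_\alpha$, unit $1_\alpha$) with algebra maps $\Delta_{\alpha,\beta}:A_{\alpha\beta}\to A_\alpha\otimes A_\beta$, $\varepsilon:A_1\to k$ and linear maps $S_\alpha:A_\alpha\to A_{\alpha^{-1}}$ such that $(\Delta_{\alpha,\beta}\otimes id)\Delta_{\alpha\beta,\gamma}=(id\otimes\Delta_{\beta,\gamma})\Delta_{\alpha,\beta\gamma}$, $(id\otimes\varepsilon)\Delta_{\alpha,1}=id=(\varepsilon\otimes id)\Delta_{1,\alpha}$, and $m_\alpha(S_{\alpha^{-1}}\otimes id)\Delta_{\alpha^{-1},\alpha}=\varepsilon(\cdot)1_\alpha=m_\alpha(id\otimes S_{\alpha^{-1}})\Delta_{\alpha,\alpha^{-1}}$. A $\pi$-graded bimodule over $A$ is a family $\Gamma=\{\Gamma_\alpha\}$ with $\Gamma_\alpha$ a (unital) $A_\alpha$-bimodule. A $\pi$-graded first order differential calculus over $A$ is a $\pi$-graded bimodule $\Gamma$ with linear maps $d_\alpha:A_\alpha\to\Gamma_\alpha$ such that $d_\alpha(ab)=d_\alpha(a)b+a\,d_\alpha(b)$ and every element of $\Gamma_\alpha$ is a finite sum $\sum_k a_k d_\alpha b_k$ with $a_k,b_k\in A_\alpha$. Two calculi $(\Gamma,d)$, $(\Gamma',d')$ are isomorphic if there are bimodule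 isomorphisms $i_\alpha:\Gamma_\alpha\to\Gamma'_\alpha$ with $i_\alpha(d_\alpha a)=d'_\alpha a$ for all $a\in A_\alpha$, $\alpha\in\pi$. The calculus is left covariant if for all $\alpha,\beta\in\pi$ and $a_k,b_k\in A_{\alpha\beta}$, $\sum_k a_k d_{\alpha\beta}b_k=0$ implies $\sum_k\Delta_{\alpha,\beta}(a_k)(id\otimes d_\beta)\Delta_{\alpha,\beta}(b_k)=0$ in $A_\alpha\otimes\Gamma_\beta$. $A^2_\alpha=\{q\in A_\alpha\otimes A_\alpha: m_\alpha(q)=0\}$ is an $A_\alpha$-bimodule via $c(a\otimes b)=ca\otimes b$, $(a\otimes b)c=a\otimes bc$, and $D_\alpha:A_\alpha\to A_\alpha^2$ is $D_\alpha(b)=1_\alpha\otimes b-b\otimes 1_\alpha$. The map $r_\alpha:A_\alpha\otimes A_\alpha\to A_\alpha\otimes A_1$, $r_\alpha(a\otimes b)=(a\otimes 1_1)\Delta_{\alpha,1}(b)$, is a bijection with inverse $r_\alpha^{-1}(a\otimes b)=(a\otimes1_\alpha)(S_{\alpha^{-1}}\otimes id)\Delta_{\alpha^{-1},\alpha}(b)$, and $r_\alpha(A_\alpha^2)=A_\alpha\otimes\ker\varepsilon$. *)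

theory Defs
  imports "HOL-Algebra.Module" "HOL-Algebra.AbelCoset" "HOL-Algebra.Free_Abelian_Groups"
begin

section \<open>Tensor products over a field\<close>

text \<open>
  The tensor product of two \<open>k\<close>-modules is the free abelian group on \<open>V \<times> W\<close> modulo the
  bilinearity relations. A tensor is a coset, i.e. a set of formal integral sums of pairs.
\<close>

type_synonym ('v, 'w) tensor = "('v \<times> 'w \<Rightarrow>\<^sub>0 int) set"

definition tensor_relators ::
    "('k, 'r) ring_scheme \<Rightarrow> ('k, 'v, 'p) module_scheme \<Rightarrow> ('k, 'w, 'q) module_scheme
      \<Rightarrow> ('v \<times> 'w \<Rightarrow>\<^sub>0 int) set" where
  "tensor_relators k V W =
     {frag_of (v \<oplus>\<^bsub>V\<^esub> v', w) - frag_of (v, w) - frag_of (v', w) | v v' w.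
        v \<in> carrier V \<and> v' \<in> carrier V \<and> w \<in> carrier W} \<union>
     {frag_of (v, w \<oplus>\<^bsub>W\<^esub> w') - frag_of (v, w) - frag_of (v, w') | v w w'.
        v \<in> carrier V \<and> w \<in> carrier W \<and> w' \<in> carrier W} \<union>
     {frag_of (c \<odot>\<^bsub>V\<^esub> v, w) - frag_of (v, c \<odot>\<^bsub>W\<^esub> w) | c v w.
        c \<in> carrier k \<and> v \<in> carrier V \<and> w \<in> carrier W}"

definition tensor_free ::
    "('k, 'v, 'p) module_scheme \<Rightarrow> ('k, 'w, 'q) module_scheme \<Rightarrow> ('v \<times> 'w \<Rightarrow>\<^sub>0 int) monoid" where
  "tensor_free V W = free_Abelian_group (carrier V \<times> carrier W)"

definition tensor_null ::
    "('k, 'r) ring_scheme \<Rightarrow> ('k, 'v, 'p) module_scheme \<Rightarrow> ('k, 'w, 'q) module_scheme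
      \<Rightarrow> ('v, 'w) tensor" where
  "tensor_null k V W = generate (tensor_free V W) (tensor_relators k V W)"

text \<open>
  The scalar \<open>c\<close> acts by \<open>v \<otimes> w \<mapsto> (c v) \<otimes> w\<close> on representatives; the union is over a single
  coset. As usual for module records that are not algebras, the ring multiplication and the ring
  unit are irrelevant.
\<close>

definition tensor_module ::
    "('k, 'r) ring_scheme \<Rightarrow> ('k, 'v, 'p) module_scheme \<Rightarrow> ('k, 'w, 'q) module_scheme
      \<Rightarrow> ('k, ('v, 'w) tensor) module" where
  "tensor_module k V W =
     \<lparr>carrier = carrier (tensor_free V W Mod tensor_null k V W),
      monoid.mult = undefined,
      one = undefined,
      ring.zero = \<one>\<^bsub>tensor_free V W Mod tensor_null k V W\<^esub>,
      ring.add = monoid.mult (tensor_free V W Mod tensor_null k V W),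
      module.smult = (\<lambda>c T. \<Union>f\<in>T. tensor_null k V W #>\<^bsub>tensor_free V W\<^esub>
                       frag_extend (\<lambda>(v, w). frag_of (c \<odot>\<^bsub>V\<^esub> v, w)) f)\<rparr>"

definition pure_tensor ::
    "('k, 'r) ring_scheme \<Rightarrow> ('k, 'v, 'p) module_scheme \<Rightarrow> ('k, 'w, 'q) module_scheme
      \<Rightarrow> 'v \<Rightarrow> 'w \<Rightarrow> ('v, 'w) tensor" where
  "pure_tensor k V W v w = tensor_null k V W #>\<^bsub>tensor_free V W\<^esub> frag_of (v, w)"

text \<open>
  \<open>tensor_lift M \<phi>\<close> is the additive map with \<open>v \<otimes> w \<mapsto> \<phi> v w\<close>. It is only meaningful for a balanced
  biadditive \<open>\<phi>\<close> with values in \<open>M\<close>, for which the evaluation is constant on each coset.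
\<close>

definition frag_eval ::
    "('m, 's) ring_scheme \<Rightarrow> ('v \<Rightarrow> 'w \<Rightarrow> 'm) \<Rightarrow> ('v \<times> 'w \<Rightarrow>\<^sub>0 int) \<Rightarrow> 'm" where
  "frag_eval M \<phi> f =
     (\<Oplus>\<^bsub>M\<^esub>p\<in>Poly_Mapping.keys f. add_pow M (Poly_Mapping.lookup f p) (\<phi> (fst p) (snd p)))"

definition tensor_lift ::
    "('m, 's) ring_scheme \<Rightarrow> ('v \<Rightarrow> 'w \<Rightarrow> 'm) \<Rightarrow> ('v, 'w) tensor \<Rightarrow> 'm" where
  "tensor_lift M \<phi> T = the_elem (frag_eval M \<phi> ` T)"

text \<open>In \<open>tensor_map k V' W' f g\<close>, i.e. \<open>f \<otimes> g\<close>, the modules are those of the codomain.\<close>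

definition tensor_map ::
    "('k, 'r) ring_scheme \<Rightarrow> ('k, 'v2, 'p) module_scheme \<Rightarrow> ('k, 'w2, 'q) module_scheme
      \<Rightarrow> ('v \<Rightarrow> 'v2) \<Rightarrow> ('w \<Rightarrow> 'w2) \<Rightarrow> ('v, 'w) tensor \<Rightarrow> ('v2, 'w2) tensor" where
  "tensor_map k V' W' f g =
     tensor_lift (tensor_module k V' W') (\<lambda>v w. pure_tensor k V' W' (f v) (g w))"

text \<open>\<open>tensor_bimap k V W f g\<close> is the biadditive map \<open>(a \<otimes> b, v \<otimes> w) \<mapsto> f a v \<otimes> g b w\<close> into \<open>V \<otimes> W\<close>.\<close>

definition tensor_bimap ::
    "('k, 'r) ring_scheme \<Rightarrow> ('k, 'v2, 'p) module_scheme \<Rightarrow> ('k, 'w2, 'q) module_scheme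
      \<Rightarrow> ('a \<Rightarrow> 'v \<Rightarrow> 'v2) \<Rightarrow> ('b \<Rightarrow> 'w \<Rightarrow> 'w2)
      \<Rightarrow> ('a, 'b) tensor \<Rightarrow> ('v, 'w) tensor \<Rightarrow> ('v2, 'w2) tensor" where
  "tensor_bimap k V W f g s t =
     tensor_lift (tensor_module k V W) (\<lambda>a b. tensor_map k V W (f a) (g b) t) s"

text \<open>The canonical map \<open>(U \<otimes> V) \<otimes> W \<rightarrow> U \<otimes> (V \<otimes> W)\<close>.\<close>

definition tensor_assoc ::
    "('k, 'r) ring_scheme \<Rightarrow> ('k, 'u, 'p) module_scheme \<Rightarrow> ('k, 'v, 'q) module_scheme
      \<Rightarrow> ('k, 'w, 's) module_scheme
      \<Rightarrow> (('u, 'v) tensor, 'w) tensor \<Rightarrow> ('u, ('v, 'w) tensor) tensor" where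
  "tensor_assoc k U V W =
     tensor_lift (tensor_module k U (tensor_module k V W))
       (\<lambda>t w. tensor_lift (tensor_module k U (tensor_module k V W))
          (\<lambda>u v. pure_tensor k U (tensor_module k V W) u (pure_tensor k V W v w)) t)"

definition tensor_algebra ::
    "('k, 'r) ring_scheme \<Rightarrow> ('k, 'v, 'p) module_scheme \<Rightarrow> ('k, 'w, 'q) module_scheme
      \<Rightarrow> ('k, ('v, 'w) tensor) module" where
  "tensor_algebra k A B = (tensor_module k A B)
     \<lparr>monoid.mult := tensor_bimap k A B (monoid.mult A) (monoid.mult B),
      one := pure_tensor k A B \<one>\<^bsub>A\<^esub> \<one>\<^bsub>B\<^esub>\<rparr>"


section \<open>Algebras, bimodules and Hopf group coalgebras\<close>

definition linear_maps ::
    "('k, 'r) ring_scheme \<Rightarrow> ('k, 'v, 'p) module_scheme \<Rightarrow> ('k, 'w, 'q) module_scheme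
      \<Rightarrow> ('v \<Rightarrow> 'w) set" where
  "linear_maps k V W =
     {f \<in> carrier V \<rightarrow> carrier W.
        (\<forall>x\<in>carrier V. \<forall>y\<in>carrier V. f (x \<oplus>\<^bsub>V\<^esub> y) = f x \<oplus>\<^bsub>W\<^esub> f y) \<and>
        (\<forall>c\<in>carrier k. \<forall>x\<in>carrier V. f (c \<odot>\<^bsub>V\<^esub> x) = c \<odot>\<^bsub>W\<^esub> f x)}"

text \<open>The locale \<open>algebra\<close> of the library is restricted to commutative algebras.\<close>

locale assoc_algebra = field k + Vec: module k A + Alg: ring A for k (structure) and A (structure) +
  assumes smult_mult_left:
      "\<lbrakk>c \<in> carrier k; x \<in> carrier A; y \<in> carrier A\<rbrakk>
        \<Longrightarrow> (c \<odot>\<^bsub>A\<^esub> x) \<otimes>\<^bsub>A\<^esub> y = c \<odot>\<^bsub>A\<^esub> (x \<otimes>\<^bsub>A\<^esub> y)"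
    and smult_mult_right:
      "\<lbrakk>c \<in> carrier k; x \<in> carrier A; y \<in> carrier A\<rbrakk>
        \<Longrightarrow> x \<otimes>\<^bsub>A\<^esub> (c \<odot>\<^bsub>A\<^esub> y) = c \<odot>\<^bsub>A\<^esub> (x \<otimes>\<^bsub>A\<^esub> y)"

definition mult_map :: "('k, 'a, 'p) module_scheme \<Rightarrow> ('a, 'a) tensor \<Rightarrow> 'a" where
  "mult_map A = tensor_lift A (monoid.mult A)"

text \<open>
  The members \<open>A \<alpha>\<close> of a family of algebras are carriers in a common type, which can always be
  arranged (e.g. in the disjoint union). In the counit axioms, \<open>V \<otimes> k\<close> and \<open>k \<otimes> V\<close> are identified
  with \<open>V\<close>, so that \<open>id \<otimes> \<epsilon>\<close> becomes \<open>a \<otimes> b \<mapsto> \<epsilon>(b) a\<close>.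
\<close>

locale hopf_group_coalgebra = field k + group \<pi>
  for k :: "'k ring" and \<pi> :: "'g monoid" (structure) +
  fixes A :: "'g \<Rightarrow> ('k, 'a) module"
    and \<Delta> :: "'g \<Rightarrow> 'g \<Rightarrow> 'a \<Rightarrow> ('a, 'a) tensor"
    and \<epsilon> :: "'a \<Rightarrow> 'k"
    and S :: "'g \<Rightarrow> 'a \<Rightarrow> 'a"
  assumes algebras: "\<alpha> \<in> carrier \<pi> \<Longrightarrow> assoc_algebra k (A \<alpha>)"
    and comult_ring_hom:
      "\<lbrakk>\<alpha> \<in> carrier \<pi>; \<beta> \<in> carrier \<pi>\<rbrakk>
        \<Longrightarrow> \<Delta> \<alpha> \<beta> \<in> ring_hom (A (\<alpha> \<otimes> \<beta>)) (tensor_algebra k (A \<alpha>) (A \<beta>))"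
    and comult_linear:
      "\<lbrakk>\<alpha> \<in> carrier \<pi>; \<beta> \<in> carrier \<pi>\<rbrakk>
        \<Longrightarrow> \<Delta> \<alpha> \<beta> \<in> linear_maps k (A (\<alpha> \<otimes> \<beta>)) (tensor_algebra k (A \<alpha>) (A \<beta>))"
    and counit_ring_hom: "\<epsilon> \<in> ring_hom (A \<one>) k"
    and counit_linear:
      "\<lbrakk>c \<in> carrier k; x \<in> carrier (A \<one>)\<rbrakk> \<Longrightarrow> \<epsilon> (c \<odot>\<^bsub>A \<one>\<^esub> x) = c \<otimes>\<^bsub>k\<^esub> \<epsilon> x"
    and antipode_linear: "\<alpha> \<in> carrier \<pi> \<Longrightarrow> S \<alpha> \<in> linear_maps k (A \<alpha>) (A (inv \<alpha>))"
    and coassoc: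
      "\<lbrakk>\<alpha> \<in> carrier \<pi>; \<beta> \<in> carrier \<pi>; \<gamma> \<in> carrier \<pi>; x \<in> carrier (A (\<alpha> \<otimes> \<beta> \<otimes> \<gamma>))\<rbrakk>
        \<Longrightarrow> tensor_assoc k (A \<alpha>) (A \<beta>) (A \<gamma>)
              (tensor_map k (tensor_module k (A \<alpha>) (A \<beta>)) (A \<gamma>) (\<Delta> \<alpha> \<beta>) id
                (\<Delta> (\<alpha> \<otimes> \<beta>) \<gamma> x))
          = tensor_map k (A \<alpha>) (tensor_module k (A \<beta>) (A \<gamma>)) id (\<Delta> \<beta> \<gamma>)
              (\<Delta> \<alpha> (\<beta> \<otimes> \<gamma>) x)"
    and counit_right:
      "\<lbrakk>\<alpha> \<in> carrier \<pi>; x \<in> carrier (A \<alpha>)\<rbrakk>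
        \<Longrightarrow> tensor_lift (A \<alpha>) (\<lambda>a b. \<epsilon> b \<odot>\<^bsub>A \<alpha>\<^esub> a) (\<Delta> \<alpha> \<one> x) = x"
    and counit_left:
      "\<lbrakk>\<alpha> \<in> carrier \<pi>; x \<in> carrier (A \<alpha>)\<rbrakk>
        \<Longrightarrow> tensor_lift (A \<alpha>) (\<lambda>a b. \<epsilon> a \<odot>\<^bsub>A \<alpha>\<^esub> b) (\<Delta> \<one> \<alpha> x) = x"
    and antipode_left:
      "\<lbrakk>\<alpha> \<in> carrier \<pi>; x \<in> carrier (A \<one>)\<rbrakk>
        \<Longrightarrow> mult_map (A \<alpha>) (tensor_map k (A \<alpha>) (A \<alpha>) (S (inv \<alpha>)) id (\<Delta> (inv \<alpha>) \<alpha> x))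
          = \<epsilon> x \<odot>\<^bsub>A \<alpha>\<^esub> \<one>\<^bsub>A \<alpha>\<^esub>"
    and antipode_right:
      "\<lbrakk>\<alpha> \<in> carrier \<pi>; x \<in> carrier (A \<one>)\<rbrakk>
        \<Longrightarrow> mult_map (A \<alpha>) (tensor_map k (A \<alpha>) (A \<alpha>) id (S (inv \<alpha>)) (\<Delta> \<alpha> (inv \<alpha>) x))
          = \<epsilon> x \<odot>\<^bsub>A \<alpha>\<^esub> \<one>\<^bsub>A \<alpha>\<^esub>"

record ('k, 'a, 'm) bimod = "('k, 'm) module" +
  lact :: "'a \<Rightarrow> 'm \<Rightarrow> 'm"
  ract :: "'m \<Rightarrow> 'a \<Rightarrow> 'm"

text \<open>
  A unital bimodule over the \<open>k\<close>-algebra \<open>A\<close>; the vector space structure is the one induced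
  through either action.
\<close>

locale bimodule = assoc_algebra k A + Bim: module k M
  for k (structure) and A (structure) and M :: "('k, 'a, 'm, 's) bimod_scheme" (structure) +
  assumes lact_closed: "\<lbrakk>a \<in> carrier A; x \<in> carrier M\<rbrakk> \<Longrightarrow> lact M a x \<in> carrier M"
    and ract_closed: "\<lbrakk>a \<in> carrier A; x \<in> carrier M\<rbrakk> \<Longrightarrow> ract M x a \<in> carrier M"
    and lact_add_left:
      "\<lbrakk>a \<in> carrier A; b \<in> carrier A; x \<in> carrier M\<rbrakk>
        \<Longrightarrow> lact M (a \<oplus>\<^bsub>A\<^esub> b) x = lact M a x \<oplus>\<^bsub>M\<^esub> lact M b x"
    and lact_add_right:
      "\<lbrakk>a \<in> carrier A; x \<in> carrier M; y \<in> carrier M\<rbrakk>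
        \<Longrightarrow> lact M a (x \<oplus>\<^bsub>M\<^esub> y) = lact M a x \<oplus>\<^bsub>M\<^esub> lact M a y"
    and ract_add_left:
      "\<lbrakk>a \<in> carrier A; x \<in> carrier M; y \<in> carrier M\<rbrakk>
        \<Longrightarrow> ract M (x \<oplus>\<^bsub>M\<^esub> y) a = ract M x a \<oplus>\<^bsub>M\<^esub> ract M y a"
    and ract_add_right:
      "\<lbrakk>a \<in> carrier A; b \<in> carrier A; x \<in> carrier M\<rbrakk>
        \<Longrightarrow> ract M x (a \<oplus>\<^bsub>A\<^esub> b) = ract M x a \<oplus>\<^bsub>M\<^esub> ract M x b"
    and lact_assoc:
      "\<lbrakk>a \<in> carrier A; b \<in> carrier A; x \<in> carrier M\<rbrakk>
        \<Longrightarrow> lact M (a \<otimes>\<^bsub>A\<^esub> b) x = lact M a (lact M b x)"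
    and ract_assoc:
      "\<lbrakk>a \<in> carrier A; b \<in> carrier A; x \<in> carrier M\<rbrakk>
        \<Longrightarrow> ract M x (a \<otimes>\<^bsub>A\<^esub> b) = ract M (ract M x a) b"
    and lact_ract:
      "\<lbrakk>a \<in> carrier A; b \<in> carrier A; x \<in> carrier M\<rbrakk>
        \<Longrightarrow> ract M (lact M a x) b = lact M a (ract M x b)"
    and lact_one: "x \<in> carrier M \<Longrightarrow> lact M \<one>\<^bsub>A\<^esub> x = x"
    and ract_one: "x \<in> carrier M \<Longrightarrow> ract M x \<one>\<^bsub>A\<^esub> = x"
    and lact_smult:
      "\<lbrakk>c \<in> carrier k; a \<in> carrier A; x \<in> carrier M\<rbrakk>
        \<Longrightarrow> lact M (c \<odot>\<^bsub>A\<^esub> a) x = c \<odot>\<^bsub>M\<^esub> lact M a x"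
    and ract_smult:
      "\<lbrakk>c \<in> carrier k; a \<in> carrier A; x \<in> carrier M\<rbrakk>
        \<Longrightarrow> ract M x (c \<odot>\<^bsub>A\<^esub> a) = c \<odot>\<^bsub>M\<^esub> ract M x a"

locale sub_bimodule = bimodule k A M + Sub: additive_subgroup N M
  for k (structure) and A (structure) and M (structure) and N +
  assumes sub_lact: "\<lbrakk>a \<in> carrier A; x \<in> N\<rbrakk> \<Longrightarrow> lact M a x \<in> N"
    and sub_ract: "\<lbrakk>a \<in> carrier A; x \<in> N\<rbrakk> \<Longrightarrow> ract M x a \<in> N"

text \<open>The unions range over a single coset, as for \<open>rcoset_mult\<close> in the library.\<close>

definition quotient_bimod ::
    "('k, 'a, 'm, 's) bimod_scheme \<Rightarrow> 'm set \<Rightarrow> ('k, 'a, 'm set) bimod" where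
  "quotient_bimod M N =
     \<lparr>carrier = a_rcosets\<^bsub>M\<^esub> N,
      monoid.mult = undefined,
      one = undefined,
      ring.zero = N,
      ring.add = set_add M,
      module.smult = (\<lambda>c X. \<Union>x\<in>X. N +>\<^bsub>M\<^esub> (c \<odot>\<^bsub>M\<^esub> x)),
      lact = (\<lambda>a X. \<Union>x\<in>X. N +>\<^bsub>M\<^esub> lact M a x),
      ract = (\<lambda>X a. \<Union>x\<in>X. N +>\<^bsub>M\<^esub> ract M x a)\<rparr>"

definition bimodule_isos ::
    "('k, 'a, 's) module_scheme \<Rightarrow> ('k, 'a, 'm, 'p) bimod_scheme \<Rightarrow> ('k, 'a, 'n, 'q) bimod_scheme
      \<Rightarrow> ('m \<Rightarrow> 'n) set" where
  "bimodule_isos A M M' =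
     {i \<in> iso (add_monoid M) (add_monoid M').
        \<forall>a\<in>carrier A. \<forall>x\<in>carrier M.
          i (lact M a x) = lact M' a (i x) \<and> i (ract M x a) = ract M' (i x) a}"


section \<open>First order differential calculi\<close>

locale fodc = bimodule k A M
  for k (structure) and A (structure) and M (structure) +
  fixes d
  assumes d_linear: "d \<in> linear_maps k A M"
    and leibniz:
      "\<lbrakk>a \<in> carrier A; b \<in> carrier A\<rbrakk>
        \<Longrightarrow> d (a \<otimes>\<^bsub>A\<^esub> b) = ract M (d a) b \<oplus>\<^bsub>M\<^esub> lact M a (d b)"
    and generated:
      "x \<in> carrier M \<Longrightarrow>
         \<exists>(n::nat) a b. a \<in> {..<n} \<rightarrow> carrier A \<and> b \<in> {..<n} \<rightarrow> carrier A \<and>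
           x = (\<Oplus>\<^bsub>M\<^esub>j\<in>{..<n}. lact M (a j) (d (b j)))"

definition graded_fodc ::
    "'k ring \<Rightarrow> 'g monoid \<Rightarrow> ('g \<Rightarrow> ('k, 'a) module)
      \<Rightarrow> ('g \<Rightarrow> ('k, 'a, 'm) bimod) \<Rightarrow> ('g \<Rightarrow> 'a \<Rightarrow> 'm) \<Rightarrow> bool" where
  "graded_fodc k \<pi> A \<Gamma> d \<longleftrightarrow> (\<forall>\<alpha>\<in>carrier \<pi>. fodc k (A \<alpha>) (\<Gamma> \<alpha>) (d \<alpha>))"

definition isomorphic_fodc ::
    "'g monoid \<Rightarrow> ('g \<Rightarrow> ('k, 'a) module)
      \<Rightarrow> ('g \<Rightarrow> ('k, 'a, 'm) bimod) \<Rightarrow> ('g \<Rightarrow> 'a \<Rightarrow> 'm)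
      \<Rightarrow> ('g \<Rightarrow> ('k, 'a, 'n) bimod) \<Rightarrow> ('g \<Rightarrow> 'a \<Rightarrow> 'n) \<Rightarrow> bool" where
  "isomorphic_fodc \<pi> A \<Gamma> d \<Gamma>' d' \<longleftrightarrow>
     (\<exists>i. \<forall>\<alpha>\<in>carrier \<pi>. i \<alpha> \<in> bimodule_isos (A \<alpha>) (\<Gamma> \<alpha>) (\<Gamma>' \<alpha>) \<and>
        (\<forall>a\<in>carrier (A \<alpha>). i \<alpha> (d \<alpha> a) = d' \<alpha> a))"

text \<open>
  The product of \<open>\<Delta>(a)\<close> with \<open>(id \<otimes> d) \<Delta>(b)\<close> is the action of \<open>A \<alpha> \<otimes> A \<beta>\<close> on \<open>A \<alpha> \<otimes> \<Gamma> \<beta>\<close> given by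
  \<open>(a \<otimes> b) (a' \<otimes> \<omega>) = a a' \<otimes> b \<omega>\<close>.
\<close>

definition left_covariant ::
    "'k ring \<Rightarrow> 'g monoid \<Rightarrow> ('g \<Rightarrow> ('k, 'a) module) \<Rightarrow> ('g \<Rightarrow> 'g \<Rightarrow> 'a \<Rightarrow> ('a, 'a) tensor)
      \<Rightarrow> ('g \<Rightarrow> ('k, 'a, 'm) bimod) \<Rightarrow> ('g \<Rightarrow> 'a \<Rightarrow> 'm) \<Rightarrow> bool" where
  "left_covariant k \<pi> A \<Delta> \<Gamma> d \<longleftrightarrow>
     (\<forall>\<alpha>\<in>carrier \<pi>. \<forall>\<beta>\<in>carrier \<pi>. \<forall>(n::nat) a b.
        a \<in> {..<n} \<rightarrow> carrier (A (\<alpha> \<otimes>\<^bsub>\<pi>\<^esub> \<beta>)) \<longrightarrow>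
        b \<in> {..<n} \<rightarrow> carrier (A (\<alpha> \<otimes>\<^bsub>\<pi>\<^esub> \<beta>)) \<longrightarrow>
        (\<Oplus>\<^bsub>\<Gamma> (\<alpha> \<otimes>\<^bsub>\<pi>\<^esub> \<beta>)\<^esub>j\<in>{..<n}. lact (\<Gamma> (\<alpha> \<otimes>\<^bsub>\<pi>\<^esub> \<beta>)) (a j) (d (\<alpha> \<otimes>\<^bsub>\<pi>\<^esub> \<beta>) (b j)))
          = \<zero>\<^bsub>\<Gamma> (\<alpha> \<otimes>\<^bsub>\<pi>\<^esub> \<beta>)\<^esub> \<longrightarrow>
        (\<Oplus>\<^bsub>tensor_module k (A \<alpha>) (\<Gamma> \<beta>)\<^esub>j\<in>{..<n}.
           tensor_bimap k (A \<alpha>) (\<Gamma> \<beta>) (monoid.mult (A \<alpha>)) (lact (\<Gamma> \<beta>))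
             (\<Delta> \<alpha> \<beta> (a j))
             (tensor_map k (A \<alpha>) (\<Gamma> \<beta>) id (d \<beta>) (\<Delta> \<alpha> \<beta> (b j))))
          = \<zero>\<^bsub>tensor_module k (A \<alpha>) (\<Gamma> \<beta>)\<^esub>)"


section \<open>The universal calculus and its quotients\<close>

definition universal_bimod ::
    "('k, 'r) ring_scheme \<Rightarrow> ('k, 'a, 's) module_scheme \<Rightarrow> ('k, 'a, ('a, 'a) tensor) bimod" where
  "universal_bimod k A =
     \<lparr>carrier = {q \<in> carrier (tensor_module k A A). mult_map A q = \<zero>\<^bsub>A\<^esub>},
      monoid.mult = undefined,
      one = undefined,
      ring.zero = \<zero>\<^bsub>tensor_module k A A\<^esub>,
      ring.add = ring.add (tensor_module k A A),
      module.smult = module.smult (tensor_module k A A),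
      lact = (\<lambda>c. tensor_map k A A (\<lambda>a. c \<otimes>\<^bsub>A\<^esub> a) id),
      ract = (\<lambda>q c. tensor_map k A A id (\<lambda>b. b \<otimes>\<^bsub>A\<^esub> c) q)\<rparr>"

definition universal_d ::
    "('k, 'r) ring_scheme \<Rightarrow> ('k, 'a, 's) module_scheme \<Rightarrow> 'a \<Rightarrow> ('a, 'a) tensor" where
  "universal_d k A b =
     pure_tensor k A A \<one>\<^bsub>A\<^esub> b \<ominus>\<^bsub>tensor_module k A A\<^esub> pure_tensor k A A b \<one>\<^bsub>A\<^esub>"

definition r_map ::
    "'k ring \<Rightarrow> 'g monoid \<Rightarrow> ('g \<Rightarrow> ('k, 'a) module) \<Rightarrow> ('g \<Rightarrow> 'g \<Rightarrow> 'a \<Rightarrow> ('a, 'a) tensor)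
      \<Rightarrow> 'g \<Rightarrow> ('a, 'a) tensor \<Rightarrow> ('a, 'a) tensor" where
  "r_map k \<pi> A \<Delta> \<alpha> =
     tensor_lift (tensor_module k (A \<alpha>) (A \<one>\<^bsub>\<pi>\<^esub>))
       (\<lambda>a b. pure_tensor k (A \<alpha>) (A \<one>\<^bsub>\<pi>\<^esub>) a \<one>\<^bsub>A \<one>\<^bsub>\<pi>\<^esub>\<^esub>
                \<otimes>\<^bsub>tensor_algebra k (A \<alpha>) (A \<one>\<^bsub>\<pi>\<^esub>)\<^esub> \<Delta> \<alpha> \<one>\<^bsub>\<pi>\<^esub> b)"

definition right_ideal :: "'a set \<Rightarrow> ('a, 's) ring_scheme \<Rightarrow> bool" where
  "right_ideal R A \<longleftrightarrow>
     additive_subgroup R A \<and> (\<forall>x\<in>R. \<forall>a\<in>carrier A. x \<otimes>\<^bsub>A\<^esub> a \<in> R)"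

text \<open>
  For a subspace \<open>R\<close> of \<open>W\<close>, the image of \<open>V \<otimes> R\<close> in \<open>V \<otimes> W\<close>; over a field \<open>V \<otimes> R\<close> embeds into
  \<open>V \<otimes> W\<close>, so this is \<open>V \<otimes> R\<close> as a subspace.
\<close>

definition tensor_subspace ::
    "('k, 'r) ring_scheme \<Rightarrow> ('k, 'v, 'p) module_scheme \<Rightarrow> ('k, 'w, 'q) module_scheme
      \<Rightarrow> 'w set \<Rightarrow> ('v, 'w) tensor set" where
  "tensor_subspace k V W R =
     generate (add_monoid (tensor_module k V W))
       {pure_tensor k V W v w | v w. v \<in> carrier V \<and> w \<in> R}"

text \<open>The map \<open>r\<close> is bijective, so the preimage below is the image of \<open>A \<otimes> R\<close> under \<open>r\<^sup>-\<^sup>1\<close>.\<close>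

definition N_of ::
    "'k ring \<Rightarrow> 'g monoid \<Rightarrow> ('g \<Rightarrow> ('k, 'a) module) \<Rightarrow> ('g \<Rightarrow> 'g \<Rightarrow> 'a \<Rightarrow> ('a, 'a) tensor)
      \<Rightarrow> 'a set \<Rightarrow> 'g \<Rightarrow> ('a, 'a) tensor set" where
  "N_of k \<pi> A \<Delta> R \<alpha> =
     {q \<in> carrier (tensor_module k (A \<alpha>) (A \<alpha>)).
        r_map k \<pi> A \<Delta> \<alpha> q \<in> tensor_subspace k (A \<alpha>) (A \<one>\<^bsub>\<pi>\<^esub>) R}"

definition Gamma_of ::
    "'k ring \<Rightarrow> 'g monoid \<Rightarrow> ('g \<Rightarrow> ('k, 'a) module) \<Rightarrow> ('g \<Rightarrow> 'g \<Rightarrow> 'a \<Rightarrow> ('a, 'a) tensor)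
      \<Rightarrow> 'a set \<Rightarrow> 'g \<Rightarrow> ('k, 'a, ('a, 'a) tensor set) bimod" where
  "Gamma_of k \<pi> A \<Delta> R \<alpha> =
     quotient_bimod (universal_bimod k (A \<alpha>)) (N_of k \<pi> A \<Delta> R \<alpha>)"

definition d_of ::
    "'k ring \<Rightarrow> 'g monoid \<Rightarrow> ('g \<Rightarrow> ('k, 'a) module) \<Rightarrow> ('g \<Rightarrow> 'g \<Rightarrow> 'a \<Rightarrow> ('a, 'a) tensor)
      \<Rightarrow> 'a set \<Rightarrow> 'g \<Rightarrow> 'a \<Rightarrow> ('a, 'a) tensor set" where
  "d_of k \<pi> A \<Delta> R \<alpha> b =
     N_of k \<pi> A \<Delta> R \<alpha> +>\<^bsub>universal_bimod k (A \<alpha>)\<^esub> universal_d k (A \<alpha>) b"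

end

theory Submission
  imports Defs
begin

text \<open>
  In a calculus \<open>(\<Gamma>, d)\<close> put \<open>\<omega>(x) = S(x\<^sub>1) d(x\<^sub>2)\<close>. Through the bijection \<open>r\<close>, the map \<open>a \<otimes> b \<mapsto> a db\<close> becomes
  \<open>a \<otimes> x \<mapsto> a \<omega>(x)\<close>, and \<open>\<Delta>(a) (id \<otimes> d) \<Delta>(b)\<close> becomes \<open>a \<otimes> x \<mapsto> a\<^sub>1 \<otimes> a\<^sub>2 \<omega>(x)\<close>. The latter vanishes on
  \<open>A \<otimes> R\<close> as soon as \<open>\<omega>\<close> vanishes on \<open>R\<close>, which gives left covariance of the calculus defined by \<open>R\<close>.
  Conversely, given a left covariant calculus, \<open>R\<close> consists of the \<open>x \<in> ker \<epsilon>\<close> with \<open>\<omega>(x) = 0\<close> in \<open>\<Gamma>\<^sub>1\<close>.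
  By covariance, \<open>a\<^sub>1 \<otimes> a\<^sub>2 \<omega>(x)\<close> vanishes on the image under \<open>r\<close> of the kernel of \<open>a \<otimes> b \<mapsto> a db\<close>; cancelling \<open>a\<^sub>2\<close>
  with the antipode shows that \<open>id \<otimes> \<omega>\<close> vanishes there, and since \<open>k\<close> is a field this image lies in
  \<open>A \<otimes> ker \<omega>\<close>.
\<close>

section \<open>Linear maps and the universal property of the tensor product\<close>

text \<open>Tensors are cosets without preferred representatives, so identities are proved by making
  both sides linear and comparing them on pure tensors. A Sweedler sum is the lift of an arbitrary
  bilinear map along \<open>\<Delta>\<close>; the Hopf axioms then become rewrite rules for nested
  lifts. The converse uses covariance twice. The pair (\<open>\<alpha>\<close>,
  \<open>\<one>\<close>) sends a relation of \<open>\<Gamma> \<alpha>\<close> into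
  \<open>A \<alpha> \<otimes> \<Gamma> \<one>\<close>, so one subset of \<open>A \<one>\<close>
  controls all degrees. The pair (\<open>inv \<beta>\<close>, \<open>\<beta>\<close>) goes back:
  \<open>omega x = 0\<close> in degree 1 becomes \<open>1 \<otimes> omega x = 0\<close> in
  \<open>A (inv \<beta>) \<otimes> \<Gamma> \<beta>\<close>, so an \<open>x\<close> killed in degree
  1 is killed in every degree. The map \<open>a \<otimes> b \<mapsto> a db\<close> is taken on all
  of \<open>A \<otimes> A\<close>, where it also kills \<open>A \<otimes> 1\<close> because
  \<open>d 1 = 0\<close>; likewise \<open>omega 1 = 0\<close>. The projection
  \<open>q - m(q) \<otimes> 1\<close> onto tensors of product zero, and beyond \<open>r\<close> the
  projection \<open>x - \<epsilon>(x) 1\<close> onto \<open>ker \<epsilon>\<close>, remove this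
  part.\<close>

lemma (in abelian_group) minus_eq_zero_iff:
  assumes "x \<in> carrier G" "y \<in> carrier G"
  shows "x \<ominus> y = \<zero> \<longleftrightarrow> x = y"
  using assms r_neg[of y] by (metis a_minus_def add.inv_closed add.inv_solve_right l_zero zero_closed)

lemma (in abelian_group) add_minus_cancel_left:
  assumes "x \<in> carrier G" "y \<in> carrier G"
  shows "(x \<oplus> y) \<ominus> x = y"
  using assms by (simp add: a_minus_def a_comm[of x y] a_assoc r_neg)

lemma (in abelian_group) minus_zero_right: "x \<in> carrier G \<Longrightarrow> x \<ominus> \<zero> = x"
  using add_minus_cancel_left[of "\<zero>" x] by simp

lemma linear_mapsI:
  assumes "\<And>x. x \<in> carrier V \<Longrightarrow> f x \<in> carrier W"
    and "\<And>x y. \<lbrakk>x \<in> carrier V; y \<in> carrier V\<rbrakk> \<Longrightarrow> f (x \<oplus>\<^bsub>V\<^esub> y) = f x \<oplus>\<^bsub>W\<^esub> f y"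
    and "\<And>c x. \<lbrakk>c \<in> carrier k; x \<in> carrier V\<rbrakk> \<Longrightarrow> f (c \<odot>\<^bsub>V\<^esub> x) = c \<odot>\<^bsub>W\<^esub> f x"
  shows "f \<in> linear_maps k V W"
  using assms by (simp add: linear_maps_def)

lemma linear_maps_closed: "\<lbrakk>f \<in> linear_maps k V W; x \<in> carrier V\<rbrakk> \<Longrightarrow> f x \<in> carrier W"
  and linear_maps_add: "\<lbrakk>f \<in> linear_maps k V W; x \<in> carrier V; y \<in> carrier V\<rbrakk>
    \<Longrightarrow> f (x \<oplus>\<^bsub>V\<^esub> y) = f x \<oplus>\<^bsub>W\<^esub> f y"
  and linear_maps_smult: "\<lbrakk>f \<in> linear_maps k V W; c \<in> carrier k; x \<in> carrier V\<rbrakk>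
    \<Longrightarrow> f (c \<odot>\<^bsub>V\<^esub> x) = c \<odot>\<^bsub>W\<^esub> f x"
  by (auto simp: linear_maps_def)

lemma linear_maps_abelian_group_hom:
  assumes "f \<in> linear_maps k V W" "module k V" "module k W"
  shows "abelian_group_hom V W f"
  using assms
  by (intro abelian_group_homI group_hom.intro group_hom_axioms.intro homI)
     (auto simp: linear_maps_def module_def abelian_group.a_group)

lemma linear_maps_zero:
  assumes "f \<in> linear_maps k V W" "module k V" "module k W"
  shows "f \<zero>\<^bsub>V\<^esub> = \<zero>\<^bsub>W\<^esub>"
  using abelian_group_hom.hom_zero[OF linear_maps_abelian_group_hom[OF assms]] .

lemma linear_maps_a_inv:
  assumes "f \<in> linear_maps k V W" "module k V" "module k W" "x \<in> carrier V"
  shows "f (\<ominus>\<^bsub>V\<^esub> x) = \<ominus>\<^bsub>W\<^esub> f x"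
  using abelian_group_hom.hom_a_inv[OF linear_maps_abelian_group_hom[OF assms(1-3)] assms(4)] .

lemma linear_maps_minus:
  assumes "f \<in> linear_maps k V W" "module k V" "module k W" "x \<in> carrier V" "y \<in> carrier V"
  shows "f (x \<ominus>\<^bsub>V\<^esub> y) = f x \<ominus>\<^bsub>W\<^esub> f y"
proof -
  interpret V: module k V by fact
  show ?thesis
    using assms by (simp add: a_minus_def linear_maps_add[OF assms(1)] linear_maps_a_inv)
qed

lemma linear_maps_finsum:
  assumes "f \<in> linear_maps k V W" "module k V" "module k W" "finite I" "g \<in> I \<rightarrow> carrier V"
  shows "f (\<Oplus>\<^bsub>V\<^esub>i\<in>I. g i) = (\<Oplus>\<^bsub>W\<^esub>i\<in>I. f (g i))"
proof -
  interpret V: module k V by fact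
  interpret W: module k W by fact
  from assms(4,5) show ?thesis
  proof (induction I)
    case empty
    then show ?case using linear_maps_zero[OF assms(1-3)] by simp
  next
    case (insert i I)
    then have "g \<in> I \<rightarrow> carrier V" "g i \<in> carrier V" by auto
    then show ?case
      using insert linear_maps_closed[OF assms(1)]
      by (simp add: linear_maps_add[OF assms(1)] Pi_def)
  qed
qed

lemma linear_maps_comp:
  "\<lbrakk>f \<in> linear_maps k V W; g \<in> linear_maps k U V\<rbrakk> \<Longrightarrow> (\<lambda>x. f (g x)) \<in> linear_maps k U W"
  by (simp add: linear_maps_def Pi_iff)

text \<open>Balanced biadditive maps would already descend to tensors; linearity in each argument
  makes the lift \<open>k\<close>-linear as well.\<close>

definition bilinear_maps ::
    "('k, 'r) ring_scheme \<Rightarrow> ('k, 'v, 'p) module_scheme \<Rightarrow> ('k, 'w, 'q) module_scheme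
      \<Rightarrow> ('k, 'm, 's) module_scheme \<Rightarrow> ('v \<Rightarrow> 'w \<Rightarrow> 'm) set" where
  "bilinear_maps k V W M =
     {\<phi>. (\<forall>v\<in>carrier V. (\<lambda>w. \<phi> v w) \<in> linear_maps k W M) \<and>
         (\<forall>w\<in>carrier W. (\<lambda>v. \<phi> v w) \<in> linear_maps k V M)}"

lemma bilinear_mapsI:
  assumes "\<And>v. v \<in> carrier V \<Longrightarrow> (\<lambda>w. \<phi> v w) \<in> linear_maps k W M"
    and "\<And>w. w \<in> carrier W \<Longrightarrow> (\<lambda>v. \<phi> v w) \<in> linear_maps k V M"
  shows "(\<lambda>v w. \<phi> v w) \<in> bilinear_maps k V W M"
  using assms by (simp add: bilinear_maps_def)

lemma bilinear_maps_left: "\<lbrakk>\<phi> \<in> bilinear_maps k V W M; w \<in> carrier W\<rbrakk> \<Longrightarrow> (\<lambda>v. \<phi> v w) \<in> linear_maps k V M"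
  and bilinear_maps_right: "\<lbrakk>\<phi> \<in> bilinear_maps k V W M; v \<in> carrier V\<rbrakk> \<Longrightarrow> \<phi> v \<in> linear_maps k W M"
  by (auto simp: bilinear_maps_def)

section \<open>Evaluation of formal sums and its vanishing on the relators\<close>

locale two_modules = V: module k V + W: module k W
  for k :: "('k, 'r) ring_scheme" and V :: "('k, 'v, 'p) module_scheme"
    and W :: "('k, 'w, 'q) module_scheme"
begin

abbreviation F where "F \<equiv> tensor_free V W"
abbreviation Null where "Null \<equiv> tensor_null k V W"
abbreviation pt where "pt \<equiv> pure_tensor k V W"
abbreviation T where "T \<equiv> tensor_module k V W"

sublocale F: comm_group F
  unfolding tensor_free_def by (rule abelian_free_Abelian_group)

lemma carrier_F [simp]: "f \<in> carrier F \<longleftrightarrow> Poly_Mapping.keys f \<subseteq> carrier V \<times> carrier W"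
  and mult_F [simp]: "monoid.mult F = (+)"
  and one_F [simp]: "\<one>\<^bsub>F\<^esub> = 0"
  by (auto simp: tensor_free_def free_Abelian_group_def)

lemma inv_F [simp]: "Poly_Mapping.keys f \<subseteq> carrier V \<times> carrier W \<Longrightarrow> inv\<^bsub>F\<^esub> f = - f"
  unfolding tensor_free_def by (rule inv_free_Abelian_group)

lemma keys_diff_subset:
  "\<lbrakk>Poly_Mapping.keys f \<subseteq> X; Poly_Mapping.keys g \<subseteq> X\<rbrakk> \<Longrightarrow> Poly_Mapping.keys (f - g) \<subseteq> X"
  using keys_diff[of f g] by blast

lemma relators_subset: "tensor_relators k V W \<subseteq> carrier F"
proof
  have d: "f - g \<in> carrier F" if "f \<in> carrier F" "g \<in> carrier F" for f g
    using that keys_diff_subset by simp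
  fix x assume "x \<in> tensor_relators k V W"
  then show "x \<in> carrier F"
    unfolding tensor_relators_def
    by (elim UnE CollectE exE conjE; hypsubst; intro d) auto
qed

lemma Null_subgroup: "subgroup Null F"
  unfolding tensor_null_def by (rule F.generate_is_subgroup[OF relators_subset])

sublocale Null: normal Null F
  by (rule F.subgroup_imp_normal[OF Null_subgroup])

text \<open>\<open>frag_eval\<close> sums over the keys of \<open>f\<close>, an index set that
  changes with \<open>f\<close>. Over the fixed set of all pairs, with finite support, the sums for
  different \<open>f\<close> can be added termwise.\<close>

lemma frag_eval_eq_gfinprod:
  assumes "abelian_group M" "\<And>v w. \<lbrakk>v \<in> carrier V; w \<in> carrier W\<rbrakk> \<Longrightarrow> \<phi> v w \<in> carrier M"
    and f: "f \<in> carrier F"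
  shows "frag_eval M \<phi> f
    = gfinprod (add_monoid M) (\<lambda>p. add_pow M (Poly_Mapping.lookup f p) (\<phi> (fst p) (snd p)))
        (carrier V \<times> carrier W)"
proof -
  interpret M: abelian_group M by fact
  let ?h = "\<lambda>p. add_pow M (Poly_Mapping.lookup f p) (\<phi> (fst p) (snd p))"
  have h: "?h \<in> carrier V \<times> carrier W \<rightarrow> carrier (add_monoid M)"
    using assms(2) by auto
  have k: "Poly_Mapping.keys f \<subseteq> carrier V \<times> carrier W" using f by simp
  have "gfinprod (add_monoid M) ?h (carrier V \<times> carrier W) = gfinprod (add_monoid M) ?h (Poly_Mapping.keys f)"
    using k h M.add.gfinprod_mono_neutral_cong_right[of "Poly_Mapping.keys f" "carrier V \<times> carrier W" ?h ?h]
    by (auto simp: in_keys_iff add_pow_def int_pow_0)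
  also have "\<dots> = finsum M ?h (Poly_Mapping.keys f)"
    using k h by (intro M.add.gfinprod_eq_finprod) auto
  finally show ?thesis
    by (simp add: frag_eval_def)
qed

lemma frag_eval_add:
  assumes "abelian_group M" "\<And>v w. \<lbrakk>v \<in> carrier V; w \<in> carrier W\<rbrakk> \<Longrightarrow> \<phi> v w \<in> carrier M"
    and f: "f \<in> carrier F" and g: "g \<in> carrier F"
  shows "frag_eval M \<phi> (f + g) = frag_eval M \<phi> f \<oplus>\<^bsub>M\<^esub> frag_eval M \<phi> g"
proof -
  interpret M: abelian_group M by fact
  have fin: "finite {p \<in> carrier V \<times> carrier W. add_pow M (Poly_Mapping.lookup h p) (\<phi> (fst p) (snd p)) \<noteq> \<zero>\<^bsub>M\<^esub>}"
    for h :: "'v \<times> 'w \<Rightarrow>\<^sub>0 int"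
    by (rule finite_subset[OF _ finite_keys[of h]]) (auto simp: in_keys_iff add_pow_def int_pow_0)
  have fg: "f + g \<in> carrier F" using F.m_closed[OF f g] by simp
  have split: "add_pow M (Poly_Mapping.lookup (f + g) p) (\<phi> (fst p) (snd p))
      = add_pow M (Poly_Mapping.lookup f p) (\<phi> (fst p) (snd p))
        \<oplus>\<^bsub>M\<^esub> add_pow M (Poly_Mapping.lookup g p) (\<phi> (fst p) (snd p))"
    if "p \<in> carrier V \<times> carrier W" for p
    using that assms(2)
    by (auto simp: add_pow_def Poly_Mapping.lookup_add group.int_pow_mult[OF M.a_group, simplified])
  note eval = frag_eval_eq_gfinprod[of M \<phi>, OF assms(1) assms(2)]
  show ?thesis
    unfolding eval[OF _ _ f, simplified] eval[OF _ _ g, simplified] eval[OF _ _ fg, simplified]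
    using assms(2)
    by (subst M.add.gfinprod_cong[OF refl, of _ _ "\<lambda>p. add_pow M (Poly_Mapping.lookup f p) (\<phi> (fst p) (snd p))
        \<oplus>\<^bsub>M\<^esub> add_pow M (Poly_Mapping.lookup g p) (\<phi> (fst p) (snd p))"])
       (auto simp: simp_implies_def split[simplified] intro!: M.add.gfinprod_distrib[OF fin fin])
qed

lemma frag_eval_of:
  assumes "abelian_group M" "\<phi> v w \<in> carrier M"
  shows "frag_eval M \<phi> (frag_of (v, w)) = \<phi> v w"
proof -
  interpret M: abelian_group M by fact
  show ?thesis
    using assms(2) by (simp add: frag_eval_def)
qed

lemma frag_eval_closed:
  assumes "abelian_group M" "\<And>v w. \<lbrakk>v \<in> carrier V; w \<in> carrier W\<rbrakk> \<Longrightarrow> \<phi> v w \<in> carrier M"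
    and f: "f \<in> carrier F"
  shows "frag_eval M \<phi> f \<in> carrier M"
proof -
  interpret M: abelian_group M by fact
  show ?thesis
    using f assms(2) unfolding frag_eval_def by (intro M.finsum_closed) auto
qed

lemma frag_eval_hom:
  assumes "abelian_group M" "\<And>v w. \<lbrakk>v \<in> carrier V; w \<in> carrier W\<rbrakk> \<Longrightarrow> \<phi> v w \<in> carrier M"
  shows "group_hom F (add_monoid M) (frag_eval M \<phi>)"
proof -
  interpret M: abelian_group M by fact
  show ?thesis
    by (intro group_hom.intro group_hom_axioms.intro homI F.is_group M.a_group)
       (auto simp: frag_eval_add[OF assms] frag_eval_closed[OF assms] simp del: carrier_F)
qed

lemma bilinear_closed:
  "\<lbrakk>\<phi> \<in> bilinear_maps k V W M; v \<in> carrier V; w \<in> carrier W\<rbrakk> \<Longrightarrow> \<phi> v w \<in> carrier M"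
  by (auto simp: bilinear_maps_def intro: linear_maps_closed)

text \<open>This makes \<open>tensor_lift\<close> well defined: the evaluation is a group
  homomorphism, so its kernel is a subgroup, and bilinearity puts every relator into it.\<close>

lemma frag_eval_Null:
  assumes M: "module k M" and \<phi>: "\<phi> \<in> bilinear_maps k V W M" and f: "f \<in> Null"
  shows "frag_eval M \<phi> f = \<zero>\<^bsub>M\<^esub>"
proof -
  interpret M: module k M by fact
  interpret h: group_hom F "add_monoid M" "frag_eval M \<phi>"
    by (rule frag_eval_hom) (auto intro: bilinear_closed[OF \<phi>] M.abelian_group_axioms)
  have of: "frag_eval M \<phi> (frag_of (v, w)) = \<phi> v w" if "v \<in> carrier V" "w \<in> carrier W" for v w
    using that by (intro frag_eval_of M.abelian_group_axioms bilinear_closed[OF \<phi>])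
  have diff: "frag_eval M \<phi> (x - y) = frag_eval M \<phi> x \<ominus>\<^bsub>M\<^esub> frag_eval M \<phi> y"
    if "x \<in> carrier F" "y \<in> carrier F" for x y
    using h.hom_mult[of x "inv\<^bsub>F\<^esub> y"] h.hom_inv[of y] that by (simp add: a_minus_def a_inv_def)
  note keys_diff_subset [simp]
  have addl: "\<phi> (v \<oplus>\<^bsub>V\<^esub> v') w = \<phi> v w \<oplus>\<^bsub>M\<^esub> \<phi> v' w"
    if "v \<in> carrier V" "v' \<in> carrier V" "w \<in> carrier W" for v v' w
    using linear_maps_add[OF bilinear_maps_left[OF \<phi>]] that by blast
  have addr: "\<phi> v (w \<oplus>\<^bsub>W\<^esub> w') = \<phi> v w \<oplus>\<^bsub>M\<^esub> \<phi> v w'"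
    if "v \<in> carrier V" "w \<in> carrier W" "w' \<in> carrier W" for v w w'
    using linear_maps_add[OF bilinear_maps_right[OF \<phi>]] that by blast
  have sm: "\<phi> (c \<odot>\<^bsub>V\<^esub> v) w = \<phi> v (c \<odot>\<^bsub>W\<^esub> w)"
    if "c \<in> carrier k" "v \<in> carrier V" "w \<in> carrier W" for c v w
    using linear_maps_smult[OF bilinear_maps_right[OF \<phi>]]
      linear_maps_smult[OF bilinear_maps_left[OF \<phi>]] that by simp
  have canc: "(x \<oplus>\<^bsub>M\<^esub> y) \<ominus>\<^bsub>M\<^esub> x \<ominus>\<^bsub>M\<^esub> y = \<zero>\<^bsub>M\<^esub>" if "x \<in> carrier M" "y \<in> carrier M" for x y
    using that M.r_neg[of "x \<oplus>\<^bsub>M\<^esub> y"] by (simp add: a_minus_def M.minus_add M.a_assoc)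
  have "tensor_relators k V W \<subseteq> kernel F (add_monoid M) (frag_eval M \<phi>)"
  proof
    fix x assume x: "x \<in> tensor_relators k V W"
    have "frag_eval M \<phi> x = \<zero>\<^bsub>M\<^esub>"
      using x unfolding tensor_relators_def
      by (auto simp: diff of addl addr sm bilinear_closed[OF \<phi>] canc M.minus_eq_zero_iff)
    with x relators_subset show "x \<in> kernel F (add_monoid M) (frag_eval M \<phi>)"
      by (auto simp: kernel_def simp del: carrier_F)
  qed
  then have "Null \<subseteq> kernel F (add_monoid M) (frag_eval M \<phi>)"
    unfolding tensor_null_def by (intro F.generate_subgroup_incl h.subgroup_kernel)
  with f show ?thesis by (auto simp: kernel_def)
qed

section \<open>The group of cosets and its pure tensors\<close>

abbreviation cls where "cls f \<equiv> Null #>\<^bsub>F\<^esub> f"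

lemma T_fields:
  "carrier T = rcosets\<^bsub>F\<^esub> Null"
  "\<zero>\<^bsub>T\<^esub> = Null"
  "ring.add T = set_mult F"
  by (simp_all add: tensor_module_def FactGroup_def)

lemma T_abelian_group: "abelian_group T"
proof -
  interpret Q: comm_group "F Mod Null" by (rule F.abelian_FactGroup[OF Null_subgroup])
  have Q: "carrier (F Mod Null) = carrier T" "monoid.mult (F Mod Null) = ring.add T"
    "\<one>\<^bsub>F Mod Null\<^esub> = \<zero>\<^bsub>T\<^esub>"
    by (simp_all add: tensor_module_def)
  show ?thesis
    by (rule abelian_groupI)
       (use Q.m_closed[unfolded Q] Q.one_closed[unfolded Q] Q.m_assoc[unfolded Q] Q.m_comm[unfolded Q]
          Q.l_one[unfolded Q] Q.l_inv_ex[unfolded Q] in \<open>simp_all del: T_fields\<close>)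
qed

sublocale T: abelian_group T by (rule T_abelian_group)

lemma cls_closed: "f \<in> carrier F \<Longrightarrow> cls f \<in> carrier T"
  by (auto simp: T_fields intro!: F.rcosetsI Null.subset)

lemma cls_add: "\<lbrakk>f \<in> carrier F; g \<in> carrier F\<rbrakk> \<Longrightarrow> cls (f + g) = cls f \<oplus>\<^bsub>T\<^esub> cls g"
  by (simp add: T_fields Null.rcos_sum del: carrier_F)

lemma cls_zero: "cls 0 = \<zero>\<^bsub>T\<^esub>"
  using F.coset_mult_one[OF Null.subset] by (simp add: T_fields)

lemma cls_hom: "group_hom F (add_monoid T) (\<lambda>f. cls f)"
  by (intro group_hom.intro group_hom_axioms.intro homI F.is_group T.a_group)
     (use cls_closed cls_add in \<open>auto simp del: carrier_F\<close>)

lemma cls_diff: "\<lbrakk>f \<in> carrier F; g \<in> carrier F\<rbrakk> \<Longrightarrow> cls (f - g) = cls f \<ominus>\<^bsub>T\<^esub> cls g"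
  using group_hom.hom_mult[OF cls_hom, of f "inv\<^bsub>F\<^esub> g"] group_hom.hom_inv[OF cls_hom, of g]
  by (simp add: a_minus_def a_inv_def)

lemma cls_Null: "f \<in> Null \<Longrightarrow> cls f = \<zero>\<^bsub>T\<^esub>"
  using F.coset_join2[OF _ Null_subgroup, of f] Null.subset by (auto simp: T_fields simp del: carrier_F)

lemma T_cases: assumes "t \<in> carrier T" obtains f where "f \<in> carrier F" "t = cls f"
  using assms by (auto simp: T_fields RCOSETS_def)

lemma pure_eq_cls: "pt v w = cls (frag_of (v, w))"
  by (simp add: pure_tensor_def)

lemma pure_closed: "\<lbrakk>v \<in> carrier V; w \<in> carrier W\<rbrakk> \<Longrightarrow> pt v w \<in> carrier T"
  unfolding pure_eq_cls by (intro cls_closed) simp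

lemma relator_in_Null: "x \<in> tensor_relators k V W \<Longrightarrow> x \<in> Null"
  unfolding tensor_null_def by (rule generate.incl)

lemma cls_relator2:
  assumes "frag_of p - frag_of q \<in> tensor_relators k V W"
    "p \<in> carrier V \<times> carrier W" "q \<in> carrier V \<times> carrier W"
  shows "cls (frag_of p) = cls (frag_of q)"
proof -
  have "cls (frag_of p) \<ominus>\<^bsub>T\<^esub> cls (frag_of q) = \<zero>\<^bsub>T\<^esub>"
    using cls_Null[OF relator_in_Null[OF assms(1)]] assms by (simp add: cls_diff)
  moreover have "cls (frag_of p) \<in> carrier T" "cls (frag_of q) \<in> carrier T"
    using assms by (auto intro!: cls_closed)
  ultimately show ?thesis by (simp add: T.minus_eq_zero_iff)
qed

lemma cls_relator3:
  assumes "frag_of p - frag_of q - frag_of r \<in> tensor_relators k V W"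
    "p \<in> carrier V \<times> carrier W" "q \<in> carrier V \<times> carrier W" "r \<in> carrier V \<times> carrier W"
  shows "cls (frag_of p) = cls (frag_of q) \<oplus>\<^bsub>T\<^esub> cls (frag_of r)"
proof -
  have c: "cls (frag_of p) \<in> carrier T" "cls (frag_of q) \<in> carrier T" "cls (frag_of r) \<in> carrier T"
    using assms by (auto intro!: cls_closed)
  have "cls (frag_of p) \<ominus>\<^bsub>T\<^esub> cls (frag_of q) \<ominus>\<^bsub>T\<^esub> cls (frag_of r) = \<zero>\<^bsub>T\<^esub>"
    using cls_Null[OF relator_in_Null[OF assms(1)]] assms by (simp add: cls_diff keys_diff_subset)
  then have "cls (frag_of p) \<ominus>\<^bsub>T\<^esub> cls (frag_of q) = cls (frag_of r)" using c by (simp add: T.minus_eq_zero_iff)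
  then have "cls (frag_of q) \<oplus>\<^bsub>T\<^esub> cls (frag_of r) = cls (frag_of q) \<oplus>\<^bsub>T\<^esub> (cls (frag_of p) \<ominus>\<^bsub>T\<^esub> cls (frag_of q))"
    by simp
  also have "\<dots> = cls (frag_of p)"
    using c by (simp add: a_minus_def T.a_ac T.r_neg T.r_neg1 T.r_neg2)
  finally show ?thesis ..
qed

lemma pure_add_left:
  "\<lbrakk>v \<in> carrier V; v' \<in> carrier V; w \<in> carrier W\<rbrakk>
    \<Longrightarrow> pt (v \<oplus>\<^bsub>V\<^esub> v') w = pt v w \<oplus>\<^bsub>T\<^esub> pt v' w"
  unfolding pure_eq_cls by (rule cls_relator3) (auto simp: tensor_relators_def)

lemma pure_add_right:
  "\<lbrakk>v \<in> carrier V; w \<in> carrier W; w' \<in> carrier W\<rbrakk>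
    \<Longrightarrow> pt v (w \<oplus>\<^bsub>W\<^esub> w') = pt v w \<oplus>\<^bsub>T\<^esub> pt v w'"
  unfolding pure_eq_cls by (rule cls_relator3) (auto simp: tensor_relators_def)

lemma pure_balanced:
  "\<lbrakk>c \<in> carrier k; v \<in> carrier V; w \<in> carrier W\<rbrakk>
    \<Longrightarrow> pt (c \<odot>\<^bsub>V\<^esub> v) w = pt v (c \<odot>\<^bsub>W\<^esub> w)"
  unfolding pure_eq_cls by (rule cls_relator2) (auto simp: tensor_relators_def)

lemma pure_zero: "w \<in> carrier W \<Longrightarrow> pt \<zero>\<^bsub>V\<^esub> w = \<zero>\<^bsub>T\<^esub>"
  using pure_add_left[of "\<zero>\<^bsub>V\<^esub>" "\<zero>\<^bsub>V\<^esub>" w] pure_closed[of "\<zero>\<^bsub>V\<^esub>" w] by simp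

lemma pure_neg:
  assumes "v \<in> carrier V" "w \<in> carrier W"
  shows "pt (\<ominus>\<^bsub>V\<^esub> v) w = \<ominus>\<^bsub>T\<^esub> pt v w"
  using pure_add_left[of "\<ominus>\<^bsub>V\<^esub> v" v w] assms
  by (intro T.minus_equality[symmetric]) (auto simp: V.l_neg pure_zero intro: pure_closed)

text \<open>Zero and negatives have no cases of their own because 0 = 0 \<otimes> 0 and -(v
  \<otimes> w) = (-v) \<otimes> w are pure.\<close>

lemma tensor_induct [consumes 1, case_names pure add]:
  assumes t: "t \<in> carrier T"
    and pure: "\<And>v w. \<lbrakk>v \<in> carrier V; w \<in> carrier W\<rbrakk> \<Longrightarrow> P (pt v w)"
    and add: "\<And>x y. \<lbrakk>x \<in> carrier T; y \<in> carrier T; P x; P y\<rbrakk> \<Longrightarrow> P (x \<oplus>\<^bsub>T\<^esub> y)"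
  shows "P t"
proof -
  obtain f where f: "f \<in> carrier F" "t = cls f" using t by (rule T_cases)
  have "Poly_Mapping.keys f \<subseteq> carrier V \<times> carrier W" using f by simp
  \<comment> \<open>Induction on formal sums proceeds by differences, while \<open>P\<close> is only
    known to be stable under sums; carrying the negative along bridges the gap.\<close>
  then have "P (cls f) \<and> P (\<ominus>\<^bsub>T\<^esub> cls f)"
  proof (induction f rule: free_Abelian_group_induct[consumes 1])
    case 1
    have "\<ominus>\<^bsub>T\<^esub> \<zero>\<^bsub>T\<^esub> = \<zero>\<^bsub>T\<^esub>" by simp
    then show ?case
      using pure[of "\<zero>\<^bsub>V\<^esub>" "\<zero>\<^bsub>W\<^esub>"] by (simp only: pure_zero cls_zero W.zero_closed V.zero_closed)
  next
    case (2 x y)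
    then have c: "cls x \<in> carrier T" "cls y \<in> carrier T" by (auto intro: cls_closed)
    have "cls (x - y) = cls x \<oplus>\<^bsub>T\<^esub> \<ominus>\<^bsub>T\<^esub> cls y" using 2 by (simp add: cls_diff a_minus_def)
    with 2 c add show ?case by (auto simp: T.minus_add)
  next
    case (3 a)
    then obtain v w where "a = (v, w)" "v \<in> carrier V" "w \<in> carrier W" by auto
    then show ?case
      using pure[of v w] pure[of "\<ominus>\<^bsub>V\<^esub> v" w] pure_neg[of v w] by (simp add: pure_eq_cls)
  qed
  then show ?thesis using f by simp
qed

text \<open>Two members of a coset differ by an element of \<open>Null\<close>, where the evaluation
  vanishes. The image of the coset is thus a singleton, as \<open>the_elem\<close> requires.\<close>

lemma tensor_lift_cls:
  assumes M: "module k M" and \<phi>: "\<phi> \<in> bilinear_maps k V W M" and f: "f \<in> carrier F"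
  shows "tensor_lift M \<phi> (cls f) = frag_eval M \<phi> f"
proof -
  interpret M: module k M by fact
  have "frag_eval M \<phi> g = frag_eval M \<phi> f" if "g \<in> cls f" for g
  proof -
    obtain n where n: "n \<in> Null" "g = n + f" using \<open>g \<in> cls f\<close> by (auto simp: r_coset_def)
    then have "n \<in> carrier F" using Null.subset by blast
    then show ?thesis
      using n f frag_eval_add[OF M.abelian_group_axioms bilinear_closed[OF \<phi>] \<open>n \<in> carrier F\<close> f]
        frag_eval_closed[OF M.abelian_group_axioms bilinear_closed[OF \<phi>] f]
        frag_eval_Null[OF M \<phi> n(1)]
      by (simp del: carrier_F)
  qed
  moreover have "f \<in> cls f" using F.rcos_self[OF f Null_subgroup] .
  ultimately have "frag_eval M \<phi> ` cls f = {frag_eval M \<phi> f}" by blast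
  then show ?thesis by (simp add: tensor_lift_def)
qed

lemma tensor_lift_pure:
  assumes "module k M" "\<phi> \<in> bilinear_maps k V W M" "v \<in> carrier V" "w \<in> carrier W"
  shows "tensor_lift M \<phi> (pt v w) = \<phi> v w"
  unfolding pure_eq_cls using assms
  by (subst tensor_lift_cls) (auto intro!: frag_eval_of bilinear_closed simp: module_def)

lemma tensor_lift_closed:
  assumes "module k M" "\<phi> \<in> bilinear_maps k V W M" "t \<in> carrier T"
  shows "tensor_lift M \<phi> t \<in> carrier M"
proof -
  obtain f where "f \<in> carrier F" "t = cls f" using assms(3) by (rule T_cases)
  then show ?thesis
    using frag_eval_closed[OF _ bilinear_closed[OF assms(2)]] assms(1)
    by (simp add: tensor_lift_cls[OF assms(1,2)] module_def del: carrier_F)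
qed

lemma tensor_lift_add:
  assumes M: "module k M" and \<phi>: "\<phi> \<in> bilinear_maps k V W M" and s: "s \<in> carrier T" and t: "t \<in> carrier T"
  shows "tensor_lift M \<phi> (s \<oplus>\<^bsub>T\<^esub> t) = tensor_lift M \<phi> s \<oplus>\<^bsub>M\<^esub> tensor_lift M \<phi> t"
proof -
  interpret M: module k M by fact
  obtain f where f: "f \<in> carrier F" "s = cls f" using s by (rule T_cases)
  obtain g where g: "g \<in> carrier F" "t = cls g" using t by (rule T_cases)
  have "f + g \<in> carrier F" using F.m_closed[OF f(1) g(1)] by simp
  then show ?thesis
    using f g by (simp add: cls_add[symmetric] tensor_lift_cls[OF M \<phi>] frag_eval_add[OF M.abelian_group_axioms bilinear_closed[OF \<phi>]] del: carrier_F)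
qed

section \<open>Scalars on the tensor product, and linearity of the lift\<close>

abbreviation scl where "scl c \<equiv> frag_extend (\<lambda>(v, w). frag_of (c \<odot>\<^bsub>V\<^esub> v, w))"

lemma scl_closed:
  assumes "c \<in> carrier k" "f \<in> carrier F"
  shows "scl c f \<in> carrier F"
proof -
  have "Poly_Mapping.keys (scl c f) \<subseteq> (\<Union>p\<in>Poly_Mapping.keys f. Poly_Mapping.keys (case p of (v, w) \<Rightarrow> frag_of (c \<odot>\<^bsub>V\<^esub> v, w)))"
    by (rule keys_frag_extend)
  also have "\<dots> \<subseteq> carrier V \<times> carrier W" using assms by fastforce
  finally show ?thesis by simp
qed

text \<open>Scaling the left factor maps relators to relators. Followed by \<open>cls\<close> it is
  a homomorphism, so its kernel contains the subgroup that they generate.\<close>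

lemma scl_Null:
  assumes c: "c \<in> carrier k" and f: "f \<in> Null"
  shows "scl c f \<in> Null"
proof -
  interpret h': group_hom F "add_monoid T" "\<lambda>f. cls (scl c f)"
    using scl_closed[OF c]
    by (intro group_hom.intro group_hom_axioms.intro homI F.is_group T.a_group) (auto simp: frag_extend_add cls_add cls_closed simp del: carrier_F)
  have n: "cls (scl c x) = Null \<Longrightarrow> scl c x \<in> Null" if "x \<in> carrier F" for x
    using scl_closed[OF c that] F.rcos_self[OF _ Null_subgroup] by (metis)
  have "tensor_relators k V W \<subseteq> kernel F (add_monoid T) (\<lambda>f. cls (scl c f))"
  proof
    fix x assume x: "x \<in> tensor_relators k V W"
    have "scl c x \<in> tensor_relators k V W"
      using x unfolding tensor_relators_def
    proof (elim UnE CollectE exE conjE, goal_cases)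
      case (1 v v' w)
      then show ?case using c
        by (intro UnI1 CollectI exI[of _ "c \<odot>\<^bsub>V\<^esub> v"] exI[of _ "c \<odot>\<^bsub>V\<^esub> v'"] exI[of _ w])
           (auto simp: frag_extend_diff V.smult_r_distr)
    next
      case (2 v w w')
      then show ?case using c
        by (intro UnI1 UnI2 CollectI exI[of _ "c \<odot>\<^bsub>V\<^esub> v"] exI[of _ w] exI[of _ w'])
           (auto simp: frag_extend_diff)
    next
      case (3 b v w)
      \<comment> \<open>Commutativity of \<open>k\<close> turns the image of the balance relator at
        \<open>v\<close> into the balance relator at \<open>c v\<close>.\<close>
      then have e: "c \<odot>\<^bsub>V\<^esub> (b \<odot>\<^bsub>V\<^esub> v) = b \<odot>\<^bsub>V\<^esub> (c \<odot>\<^bsub>V\<^esub> v)" using c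
        by (simp add: V.smult_assoc1[symmetric] V.R.m_comm)
      from 3 show ?case using c
        by (intro UnI2) (auto simp: frag_extend_diff e)
    qed
    then have "scl c x \<in> Null" by (rule relator_in_Null)
    then show "x \<in> kernel F (add_monoid T) (\<lambda>f. cls (scl c f))"
      using x relators_subset cls_Null[of "scl c x"] by (auto simp: kernel_def T_fields simp del: carrier_F)
  qed
  then have "Null \<subseteq> kernel F (add_monoid T) (\<lambda>f. cls (scl c f))"
    using F.generate_subgroup_incl[OF _ h'.subgroup_kernel] unfolding tensor_null_def by blast
  then show ?thesis using f n by (auto simp: kernel_def T_fields simp del: carrier_F)
qed

lemma smult_cls:
  assumes c: "c \<in> carrier k" and f: "f \<in> carrier F"
  shows "c \<odot>\<^bsub>T\<^esub> cls f = cls (scl c f)"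
proof -
  have "cls (scl c g) = cls (scl c f)" if "g \<in> cls f" for g
  proof -
    obtain n where n: "n \<in> Null" "g = n + f" using \<open>g \<in> cls f\<close> by (auto simp: r_coset_def)
    have "scl c n \<in> carrier F" "scl c f \<in> carrier F"
      using subsetD[OF Null.subset scl_Null[OF c n(1)]] scl_closed[OF c f] by auto
    then show ?thesis
      using n scl_Null[OF c n(1)] cls_closed[of "scl c f"]
      by (simp add: frag_extend_add cls_add cls_Null del: carrier_F)
  qed
  moreover have "f \<in> cls f" using F.rcos_self[OF f Null_subgroup] .
  ultimately have "(\<Union>g\<in>cls f. cls (scl c g)) = cls (scl c f)" by blast
  then show ?thesis by (simp add: tensor_module_def)
qed

lemma smult_T_closed: "\<lbrakk>c \<in> carrier k; t \<in> carrier T\<rbrakk> \<Longrightarrow> c \<odot>\<^bsub>T\<^esub> t \<in> carrier T"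
  by (erule T_cases) (simp add: smult_cls scl_closed cls_closed del: carrier_F)

lemma smult_T_add:
  assumes "c \<in> carrier k" "s \<in> carrier T" "t \<in> carrier T"
  shows "c \<odot>\<^bsub>T\<^esub> (s \<oplus>\<^bsub>T\<^esub> t) = c \<odot>\<^bsub>T\<^esub> s \<oplus>\<^bsub>T\<^esub> c \<odot>\<^bsub>T\<^esub> t"
proof -
  obtain f where f: "f \<in> carrier F" "s = cls f" using assms(2) by (rule T_cases)
  obtain g where g: "g \<in> carrier F" "t = cls g" using assms(3) by (rule T_cases)
  have "f + g \<in> carrier F" using F.m_closed[OF f(1) g(1)] by simp
  then show ?thesis
    using f g assms(1) by (simp add: cls_add[symmetric] smult_cls frag_extend_add scl_closed del: carrier_F)
qed

lemma smult_pure: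
  "\<lbrakk>c \<in> carrier k; v \<in> carrier V; w \<in> carrier W\<rbrakk>
    \<Longrightarrow> c \<odot>\<^bsub>T\<^esub> pt v w = pt (c \<odot>\<^bsub>V\<^esub> v) w"
  unfolding pure_eq_cls by (subst smult_cls) auto

lemma T_module: "module k T"
proof (rule moduleI)
  fix a b x assume ab: "a \<in> carrier k" "b \<in> carrier k" and x: "x \<in> carrier T"
  show "(a \<oplus>\<^bsub>k\<^esub> b) \<odot>\<^bsub>T\<^esub> x = (a \<odot>\<^bsub>T\<^esub> x) \<oplus>\<^bsub>T\<^esub> (b \<odot>\<^bsub>T\<^esub> x)"
    using x
  proof (induction x rule: tensor_induct)
    case (pure v w)
    then show ?case using ab by (simp add: smult_pure V.smult_l_distr pure_add_left)
  next
    case (add x y)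
    then show ?case using ab by (simp add: smult_T_add smult_T_closed T.a_ac)
  qed
  show "(a \<otimes>\<^bsub>k\<^esub> b) \<odot>\<^bsub>T\<^esub> x = a \<odot>\<^bsub>T\<^esub> (b \<odot>\<^bsub>T\<^esub> x)"
    using x
  proof (induction x rule: tensor_induct)
    case (pure v w)
    then show ?case using ab by (simp add: smult_pure V.smult_assoc1)
  next
    case (add x y)
    then show ?case using ab by (simp add: smult_T_add smult_T_closed)
  qed
next
  fix x assume "x \<in> carrier T"
  then show "\<one>\<^bsub>k\<^esub> \<odot>\<^bsub>T\<^esub> x = x"
    by (induction x rule: tensor_induct) (simp_all add: smult_pure smult_T_add)
qed (auto simp: smult_T_add intro: smult_T_closed V.cring_axioms T.abelian_group_axioms V.R.is_cring)

lemma pure_bilinear: "pt \<in> bilinear_maps k V W T"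
proof -
  have "(\<lambda>v w. pt v w) \<in> bilinear_maps k V W T"
    by (intro bilinear_mapsI linear_mapsI)
       (auto simp: pure_closed pure_add_left pure_add_right smult_pure pure_balanced)
  then show ?thesis by simp
qed

lemma tensor_lift_linear:
  assumes M: "module k M" and \<phi>: "\<phi> \<in> bilinear_maps k V W M"
  shows "tensor_lift M \<phi> \<in> linear_maps k T M"
proof (intro linear_mapsI)
  interpret M: module k M by fact
  fix c x assume c: "c \<in> carrier k" and "x \<in> carrier T"
  from this(2) show "tensor_lift M \<phi> (c \<odot>\<^bsub>T\<^esub> x) = c \<odot>\<^bsub>M\<^esub> tensor_lift M \<phi> x"
  proof (induction x rule: tensor_induct)
    case (pure v w)
    then show ?case
      using c linear_maps_smult[OF bilinear_maps_left[OF \<phi>]]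
      by (simp add: smult_pure tensor_lift_pure[OF M \<phi>])
  next
    case (add x y)
    then show ?case
      using c by (simp add: smult_T_add smult_T_closed tensor_lift_add[OF M \<phi>] tensor_lift_closed[OF M \<phi>] M.smult_r_distr)
  qed
qed (simp_all add: tensor_lift_closed[OF M \<phi>] tensor_lift_add[OF M \<phi>])

lemma linear_maps_tensor_eqI:
  assumes "f \<in> linear_maps k T M" "g \<in> linear_maps k T M"
    and "\<And>v w. \<lbrakk>v \<in> carrier V; w \<in> carrier W\<rbrakk> \<Longrightarrow> f (pt v w) = g (pt v w)"
    and "t \<in> carrier T"
  shows "f t = g t"
  using assms(4)
  by (induction t rule: tensor_induct)
     (simp_all add: assms(3) linear_maps_add[OF assms(1)] linear_maps_add[OF assms(2)])

end

section \<open>Lifts under congruence, composition and parameters\<close>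

lemma two_modulesI: "\<lbrakk>module k V; module k W\<rbrakk> \<Longrightarrow> two_modules k V W"
  by (simp add: two_modules_def)

lemmas tensor_module_module = two_modules.T_module[OF two_modulesI]
lemmas pure_tensor_closed = two_modules.pure_closed[OF two_modulesI]
lemmas pure_tensor_bilinear = two_modules.pure_bilinear[OF two_modulesI]
lemmas tensor_lift_pure = two_modules.tensor_lift_pure[OF two_modulesI]
lemmas tensor_lift_linear = two_modules.tensor_lift_linear[OF two_modulesI]
lemmas tensor_lift_closed = two_modules.tensor_lift_closed[OF two_modulesI]
lemmas linear_maps_tensor_eqI = two_modules.linear_maps_tensor_eqI[OF two_modulesI]
lemmas tensor_induct [consumes 3, case_names pure add] = two_modules.tensor_induct[OF two_modulesI]

text \<open>\<open>\<phi>\<close> and \<open>\<psi>\<close> agree on the carriers only, so rewriting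
  inside a lift is not plain equality of functions. It is sound since every formal sum in
  \<open>t\<close> has its keys in the carriers.\<close>

lemma tensor_lift_cong:
  assumes "module k V" "module k W" "module k M"
    and eq: "\<And>v w. \<lbrakk>v \<in> carrier V; w \<in> carrier W\<rbrakk> \<Longrightarrow> \<phi> v w = \<psi> v w"
    and cl: "\<And>v w. \<lbrakk>v \<in> carrier V; w \<in> carrier W\<rbrakk> \<Longrightarrow> \<psi> v w \<in> carrier M"
    and t: "t \<in> carrier (tensor_module k V W)"
  shows "tensor_lift M \<phi> t = tensor_lift M \<psi> t"
proof -
  interpret two_modules k V W using assms by (intro two_modulesI)
  interpret M: module k M by fact
  obtain f where f: "f \<in> carrier F" "t = cls f" using t by (rule T_cases)
  have t': "t \<subseteq> carrier F"
    using f F.r_coset_subset_G[OF Null.subset] by simp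
  have "frag_eval M \<phi> g = frag_eval M \<psi> g" if "g \<in> t" for g
  proof -
    have "Poly_Mapping.keys g \<subseteq> carrier V \<times> carrier W" using subsetD[OF t' that] by simp
    then show ?thesis
      unfolding frag_eval_def using eq cl
      by (intro M.finsum_cong') (auto 0 4)
  qed
  then have "frag_eval M \<phi> ` t = frag_eval M \<psi> ` t" by (rule image_cong[OF refl])
  then show ?thesis by (simp add: tensor_lift_def)
qed

lemma linear_tensor_lift:
  assumes "module k V" "module k W" "module k M" "module k M'"
    and "f \<in> linear_maps k M M'" "\<phi> \<in> bilinear_maps k V W M" "t \<in> carrier (tensor_module k V W)"
  shows "f (tensor_lift M \<phi> t) = tensor_lift M' (\<lambda>v w. f (\<phi> v w)) t"
proof -
  interpret two_modules k V W using assms by (intro two_modulesI)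
  have b: "(\<lambda>v w. f (\<phi> v w)) \<in> bilinear_maps k V W M'"
    by (intro bilinear_mapsI linear_maps_comp[OF assms(5)] bilinear_maps_left[OF assms(6)]
        bilinear_maps_right[OF assms(6)])
  show ?thesis
    by (rule linear_maps_tensor_eqI[OF linear_maps_comp[OF assms(5) tensor_lift_linear[OF assms(3,6)]]
          tensor_lift_linear[OF assms(4) b] _ assms(7)])
       (simp add: tensor_lift_pure[OF assms(3,6)] tensor_lift_pure[OF assms(4) b])
qed

lemma linear_maps_id: "V = W \<Longrightarrow> (\<lambda>x. x) \<in> linear_maps k V W"
  by (auto intro: linear_mapsI)

lemma linear_maps_smult_right:
  "\<lbrakk>module k W; c \<in> carrier k; f \<in> linear_maps k V W\<rbrakk> \<Longrightarrow> (\<lambda>x. c \<odot>\<^bsub>W\<^esub> f x) \<in> linear_maps k V W"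
  by (rule linear_mapsI)
     (simp_all add: linear_maps_closed linear_maps_add linear_maps_smult module.smult_closed module.smult_r_distr
       module.smult_assoc1[symmetric] cring.cring_simprules(14)[OF module.axioms(1)])

lemma linear_maps_add_fun:
  assumes "module k W" "f \<in> linear_maps k V W" "g \<in> linear_maps k V W"
  shows "(\<lambda>x. f x \<oplus>\<^bsub>W\<^esub> g x) \<in> linear_maps k V W"
proof -
  interpret W: module k W by fact
  show ?thesis
    using assms(2,3)
    by (intro linear_mapsI)
       (simp_all add: linear_maps_closed linear_maps_add linear_maps_smult W.smult_r_distr W.M.a_ac)
qed

lemma linear_maps_pure_left:
  "\<lbrakk>module k V; module k W; w \<in> carrier W; f \<in> linear_maps k U V\<rbrakk>
    \<Longrightarrow> (\<lambda>x. pure_tensor k V W (f x) w) \<in> linear_maps k U (tensor_module k V W)"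
  by (rule linear_maps_comp[OF bilinear_maps_left[OF pure_tensor_bilinear]])

lemma linear_maps_pure_right:
  "\<lbrakk>module k V; module k W; v \<in> carrier V; f \<in> linear_maps k U W\<rbrakk>
    \<Longrightarrow> (\<lambda>x. pure_tensor k V W v (f x)) \<in> linear_maps k U (tensor_module k V W)"
  by (rule linear_maps_comp[OF bilinear_maps_right[OF pure_tensor_bilinear]])

lemma linear_maps_tensor_lift_arg:
  "\<lbrakk>module k V; module k W; module k M; \<phi> \<in> bilinear_maps k V W M; f \<in> linear_maps k U (tensor_module k V W)\<rbrakk>
    \<Longrightarrow> (\<lambda>x. tensor_lift M \<phi> (f x)) \<in> linear_maps k U M"
  by (rule linear_maps_comp[OF tensor_lift_linear])

text \<open>Here the tensor is fixed and the bilinear map varies. Additivity and homogeneity in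
  \<open>x\<close> are equalities of linear maps in \<open>t\<close>, hence visible on pure tensors;
  this makes nested lifts linear in their outer variables.\<close>

lemma linear_maps_tensor_lift_fun:
  assumes "module k V" "module k W" "module k M" "t \<in> carrier (tensor_module k V W)"
    and U: "module k U"
    and b: "\<And>x. x \<in> carrier U \<Longrightarrow> \<phi> x \<in> bilinear_maps k V W M"
    and l: "\<And>v w. \<lbrakk>v \<in> carrier V; w \<in> carrier W\<rbrakk> \<Longrightarrow> (\<lambda>x. \<phi> x v w) \<in> linear_maps k U M"
  shows "(\<lambda>x. tensor_lift M (\<phi> x) t) \<in> linear_maps k U M"
proof -
  interpret two_modules k V W using assms by (intro two_modulesI)
  interpret M: module k M by fact
  interpret U: module k U by fact
  note lin = tensor_lift_linear[OF \<open>module k M\<close> b]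
  note cl = linear_maps_closed[OF lin]
  show ?thesis
  proof (rule linear_mapsI)
    show "tensor_lift M (\<phi> x) t \<in> carrier M" if "x \<in> carrier U" for x
      using cl that assms(4) by blast
  next
    fix x y assume xy: "x \<in> carrier U" "y \<in> carrier U"
    then have s: "x \<oplus>\<^bsub>U\<^esub> y \<in> carrier U" by simp
    show "tensor_lift M (\<phi> (x \<oplus>\<^bsub>U\<^esub> y)) t = tensor_lift M (\<phi> x) t \<oplus>\<^bsub>M\<^esub> tensor_lift M (\<phi> y) t"
      by (rule linear_maps_tensor_eqI[OF lin[OF s] linear_maps_add_fun[OF assms(3) lin[OF xy(1)] lin[OF xy(2)]] _ assms(4)])
         (simp add: xy s tensor_lift_pure[OF assms(3) b] linear_maps_add[OF l])
  next
    fix c x assume c: "c \<in> carrier k" and x: "x \<in> carrier U"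
    then have s: "c \<odot>\<^bsub>U\<^esub> x \<in> carrier U" by simp
    show "tensor_lift M (\<phi> (c \<odot>\<^bsub>U\<^esub> x)) t = c \<odot>\<^bsub>M\<^esub> tensor_lift M (\<phi> x) t"
      by (rule linear_maps_tensor_eqI[OF lin[OF s] linear_maps_smult_right[OF assms(3) c lin[OF x]] _ assms(4)])
         (simp add: x c s tensor_lift_pure[OF assms(3) b] linear_maps_smult[OF l])
  qed
qed

text \<open>A Fubini rule: both sides are linear in \<open>s\<close>, and for pure \<open>s\<close>
  both are a single lift over \<open>t\<close>. It serves to interchange the Sweedler sums of two
  independent elements.\<close>

lemma tensor_lift_swap:
  assumes "module k V" "module k W" "module k P" "module k Q" "module k M"
    and s: "s \<in> carrier (tensor_module k V W)" and t: "t \<in> carrier (tensor_module k P Q)"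
    and lv: "\<And>w p q. \<lbrakk>w \<in> carrier W; p \<in> carrier P; q \<in> carrier Q\<rbrakk> \<Longrightarrow> (\<lambda>v. \<phi> v w p q) \<in> linear_maps k V M"
    and lw: "\<And>v p q. \<lbrakk>v \<in> carrier V; p \<in> carrier P; q \<in> carrier Q\<rbrakk> \<Longrightarrow> (\<lambda>w. \<phi> v w p q) \<in> linear_maps k W M"
    and lp: "\<And>v w q. \<lbrakk>v \<in> carrier V; w \<in> carrier W; q \<in> carrier Q\<rbrakk> \<Longrightarrow> (\<lambda>p. \<phi> v w p q) \<in> linear_maps k P M"
    and lq: "\<And>v w p. \<lbrakk>v \<in> carrier V; w \<in> carrier W; p \<in> carrier P\<rbrakk> \<Longrightarrow> (\<lambda>q. \<phi> v w p q) \<in> linear_maps k Q M"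
  shows "tensor_lift M (\<lambda>v w. tensor_lift M (\<lambda>p q. \<phi> v w p q) t) s
    = tensor_lift M (\<lambda>p q. tensor_lift M (\<lambda>v w. \<phi> v w p q) s) t"
proof -
  note M = assms(1-5)
  have b1: "(\<lambda>p q. \<phi> v w p q) \<in> bilinear_maps k P Q M" if "v \<in> carrier V" "w \<in> carrier W" for v w
    using that lp lq by (intro bilinear_mapsI)
  have b2: "(\<lambda>v w. \<phi> v w p q) \<in> bilinear_maps k V W M" if "p \<in> carrier P" "q \<in> carrier Q" for p q
    using that lv lw by (intro bilinear_mapsI)
  have B1: "(\<lambda>v w. tensor_lift M (\<lambda>p q. \<phi> v w p q) t) \<in> bilinear_maps k V W M"
    by (intro bilinear_mapsI linear_maps_tensor_lift_fun[OF M(3-5) t] M b1 lv lw)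
  have B2: "(\<lambda>p q. tensor_lift M (\<lambda>v w. \<phi> v w p q) s) \<in> bilinear_maps k P Q M" if "s \<in> carrier (tensor_module k V W)" for s
    by (intro bilinear_mapsI linear_maps_tensor_lift_fun[OF M(1,2,5) that] M b2 lp lq)
  show ?thesis
  proof (rule linear_maps_tensor_eqI[OF M(1,2) tensor_lift_linear[OF M(1,2,5) B1] _ _ s])
    show "(\<lambda>s. tensor_lift M (\<lambda>p q. tensor_lift M (\<lambda>v w. \<phi> v w p q) s) t) \<in> linear_maps k (tensor_module k V W) M"
      by (intro linear_maps_tensor_lift_fun[OF M(3-5) t] tensor_module_module M B2 tensor_lift_linear b2)
    fix v w assume vw: "v \<in> carrier V" "w \<in> carrier W"
    have cl: "\<phi> v w p q \<in> carrier M" if "p \<in> carrier P" "q \<in> carrier Q" for p q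
      using linear_maps_closed[OF lv] vw that by blast
    show "tensor_lift M (\<lambda>v w. tensor_lift M (\<lambda>p q. \<phi> v w p q) t) (pure_tensor k V W v w)
      = tensor_lift M (\<lambda>p q. tensor_lift M (\<lambda>v w. \<phi> v w p q) (pure_tensor k V W v w)) t"
      unfolding tensor_lift_pure[OF M(1,2,5) B1 vw]
      by (rule tensor_lift_cong[OF M(3-5) _ _ t])
         (auto simp: tensor_lift_pure[OF M(1,2,5) b2 vw] cl)
  qed
qed

section \<open>Exactness of the tensor product over a field\<close>

text \<open>
  Graphs of linear maps \<open>h\<close>, defined on a subspace of \<open>W\<close>, with \<open>f (h y) = y\<close> for \<open>y\<close> in the image
  of \<open>f\<close>. A maximal one (Zorn) is defined everywhere and gives \<open>f h f = f\<close>.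
\<close>

definition partial_gen_inverse ::
    "('k, 'r) ring_scheme \<Rightarrow> ('k, 'v, 'p) module_scheme \<Rightarrow> ('k, 'w, 'q) module_scheme
      \<Rightarrow> ('v \<Rightarrow> 'w) \<Rightarrow> ('w \<times> 'v) set \<Rightarrow> bool" where
  "partial_gen_inverse k V W f H \<longleftrightarrow>
     H \<subseteq> carrier W \<times> carrier V \<and> (\<zero>\<^bsub>W\<^esub>, \<zero>\<^bsub>V\<^esub>) \<in> H \<and>
     (\<forall>y x y' x'. (y, x) \<in> H \<longrightarrow> (y', x') \<in> H \<longrightarrow> (y \<oplus>\<^bsub>W\<^esub> y', x \<oplus>\<^bsub>V\<^esub> x') \<in> H) \<and>
     (\<forall>c y x. c \<in> carrier k \<longrightarrow> (y, x) \<in> H \<longrightarrow> (c \<odot>\<^bsub>W\<^esub> y, c \<odot>\<^bsub>V\<^esub> x) \<in> H) \<and>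
     (\<forall>x. (\<zero>\<^bsub>W\<^esub>, x) \<in> H \<longrightarrow> x = \<zero>\<^bsub>V\<^esub>) \<and>
     (\<forall>y x. (y, x) \<in> H \<longrightarrow> y \<in> f ` carrier V \<longrightarrow> f x = y)"

text \<open>The graph is enlarged by the line through (\<open>y0\<close>, \<open>x0\<close>). It
  stays single-valued because \<open>y0\<close> is outside the domain, and the last hypothesis is
  exactly what keeps \<open>f (h y) = y\<close> on the image of \<open>f\<close>.\<close>

lemma partial_gen_inverse_extend:
  assumes "field k" "module k V" "module k W"
    and H: "partial_gen_inverse k V W f H"
    and y0: "y0 \<in> carrier W" "x0 \<in> carrier V"
    and dom: "\<And>x. (y0, x) \<notin> H"
    and inv: "\<And>y x c. \<lbrakk>(y, x) \<in> H; c \<in> carrier k; y \<oplus>\<^bsub>W\<^esub> c \<odot>\<^bsub>W\<^esub> y0 \<in> f ` carrier V\<rbrakk>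
      \<Longrightarrow> f (x \<oplus>\<^bsub>V\<^esub> c \<odot>\<^bsub>V\<^esub> x0) = y \<oplus>\<^bsub>W\<^esub> c \<odot>\<^bsub>W\<^esub> y0"
  obtains H' where "partial_gen_inverse k V W f H'" "H \<subseteq> H'" "(y0, x0) \<in> H'"
proof -
  interpret k: field k by fact
  interpret V: module k V by fact
  interpret W: module k W by fact
  have Hc: "y \<in> carrier W" "x \<in> carrier V" if "(y, x) \<in> H" for x y
    using H that by (auto simp: partial_gen_inverse_def)
  have H0: "(\<zero>\<^bsub>W\<^esub>, \<zero>\<^bsub>V\<^esub>) \<in> H"
    and Ha: "\<And>y x y' x'. \<lbrakk>(y, x) \<in> H; (y', x') \<in> H\<rbrakk> \<Longrightarrow> (y \<oplus>\<^bsub>W\<^esub> y', x \<oplus>\<^bsub>V\<^esub> x') \<in> H"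
    and Hs: "\<And>c y x. \<lbrakk>c \<in> carrier k; (y, x) \<in> H\<rbrakk> \<Longrightarrow> (c \<odot>\<^bsub>W\<^esub> y, c \<odot>\<^bsub>V\<^esub> x) \<in> H"
    and Hz: "\<And>x. (\<zero>\<^bsub>W\<^esub>, x) \<in> H \<Longrightarrow> x = \<zero>\<^bsub>V\<^esub>"
    using H by (auto simp: partial_gen_inverse_def)
  define H' where "H' = {(y \<oplus>\<^bsub>W\<^esub> c \<odot>\<^bsub>W\<^esub> y0, x \<oplus>\<^bsub>V\<^esub> c \<odot>\<^bsub>V\<^esub> x0) | y x c. (y, x) \<in> H \<and> c \<in> carrier k}"
  have "partial_gen_inverse k V W f H'"
    unfolding partial_gen_inverse_def
  proof (intro conjI allI impI)
    show "H' \<subseteq> carrier W \<times> carrier V" using Hc y0 by (auto simp: H'_def)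
    show "(\<zero>\<^bsub>W\<^esub>, \<zero>\<^bsub>V\<^esub>) \<in> H'"
      unfolding H'_def using H0 y0 by (intro CollectI exI[of _ "\<zero>\<^bsub>W\<^esub>"] exI[of _ "\<zero>\<^bsub>V\<^esub>"] exI[of _ "\<zero>\<^bsub>k\<^esub>"]) auto
  next
    fix y x y' x' assume "(y, x) \<in> H'" "(y', x') \<in> H'"
    then obtain v u c v' u' c' where *: "(v, u) \<in> H" "c \<in> carrier k" "(v', u') \<in> H" "c' \<in> carrier k"
      "y = v \<oplus>\<^bsub>W\<^esub> c \<odot>\<^bsub>W\<^esub> y0" "x = u \<oplus>\<^bsub>V\<^esub> c \<odot>\<^bsub>V\<^esub> x0"
      "y' = v' \<oplus>\<^bsub>W\<^esub> c' \<odot>\<^bsub>W\<^esub> y0" "x' = u' \<oplus>\<^bsub>V\<^esub> c' \<odot>\<^bsub>V\<^esub> x0"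
      unfolding H'_def by blast
    then show "(y \<oplus>\<^bsub>W\<^esub> y', x \<oplus>\<^bsub>V\<^esub> x') \<in> H'"
      unfolding H'_def using Ha[OF *(1,3)] y0 Hc
      by (intro CollectI exI[of _ "v \<oplus>\<^bsub>W\<^esub> v'"] exI[of _ "u \<oplus>\<^bsub>V\<^esub> u'"] exI[of _ "c \<oplus>\<^bsub>k\<^esub> c'"])
         (auto simp: V.smult_l_distr W.smult_l_distr V.M.a_ac W.M.a_ac)
  next
    fix b y x assume b: "b \<in> carrier k" and "(y, x) \<in> H'"
    then obtain v u c where *: "(v, u) \<in> H" "c \<in> carrier k"
      "y = v \<oplus>\<^bsub>W\<^esub> c \<odot>\<^bsub>W\<^esub> y0" "x = u \<oplus>\<^bsub>V\<^esub> c \<odot>\<^bsub>V\<^esub> x0"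
      unfolding H'_def by blast
    then show "(b \<odot>\<^bsub>W\<^esub> y, b \<odot>\<^bsub>V\<^esub> x) \<in> H'"
      unfolding H'_def using Hs[OF b *(1)] y0 Hc b
      by (intro CollectI exI[of _ "b \<odot>\<^bsub>W\<^esub> v"] exI[of _ "b \<odot>\<^bsub>V\<^esub> u"] exI[of _ "b \<otimes>\<^bsub>k\<^esub> c"])
         (auto simp: V.smult_r_distr W.smult_r_distr V.smult_assoc1 W.smult_assoc1)
  next
    fix x assume "(\<zero>\<^bsub>W\<^esub>, x) \<in> H'"
    then obtain v u c where *: "(v, u) \<in> H" "c \<in> carrier k"
      "\<zero>\<^bsub>W\<^esub> = v \<oplus>\<^bsub>W\<^esub> c \<odot>\<^bsub>W\<^esub> y0" "x = u \<oplus>\<^bsub>V\<^esub> c \<odot>\<^bsub>V\<^esub> x0"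
      unfolding H'_def by blast
    \<comment> \<open>With \<open>c\<close> invertible, \<open>y0 = - c\<^sup>-\<^sup>1 v\<close>
      would already lie in the domain of \<open>H\<close>.\<close>
    have "c = \<zero>\<^bsub>k\<^esub>"
    proof (rule ccontr)
      assume "c \<noteq> \<zero>\<^bsub>k\<^esub>"
      then have c: "inv\<^bsub>k\<^esub> c \<in> carrier k" "inv\<^bsub>k\<^esub> c \<otimes>\<^bsub>k\<^esub> c = \<one>\<^bsub>k\<^esub>"
        using *(2) k.field_Units by auto
      have "c \<odot>\<^bsub>W\<^esub> y0 = \<ominus>\<^bsub>W\<^esub> v"
        using *(1-3) y0 Hc by (intro W.M.minus_equality[symmetric]) (auto simp: W.M.a_comm)
      also have "\<dots> = (\<ominus>\<^bsub>k\<^esub> \<one>\<^bsub>k\<^esub>) \<odot>\<^bsub>W\<^esub> v" using Hc[OF *(1)] by (simp add: W.smult_l_minus)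
      finally have "inv\<^bsub>k\<^esub> c \<odot>\<^bsub>W\<^esub> (c \<odot>\<^bsub>W\<^esub> y0) = inv\<^bsub>k\<^esub> c \<odot>\<^bsub>W\<^esub> ((\<ominus>\<^bsub>k\<^esub> \<one>\<^bsub>k\<^esub>) \<odot>\<^bsub>W\<^esub> v)" by simp
      then have "y0 = inv\<^bsub>k\<^esub> c \<odot>\<^bsub>W\<^esub> ((\<ominus>\<^bsub>k\<^esub> \<one>\<^bsub>k\<^esub>) \<odot>\<^bsub>W\<^esub> v)"
        using c *(2) y0 by (simp add: W.smult_assoc1[symmetric])
      then show False using Hs[OF c(1) Hs[OF _ *(1), of "\<ominus>\<^bsub>k\<^esub> \<one>\<^bsub>k\<^esub>"]] dom by simp
    qed
    then show "x = \<zero>\<^bsub>V\<^esub>" using * y0 Hc[OF *(1)] Hz by simp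
  next
    fix y x assume "(y, x) \<in> H'" "y \<in> f ` carrier V"
    then show "f x = y" unfolding H'_def using inv by blast
  qed
  moreover have "H \<subseteq> H'"
  proof (rule subrelI)
    fix y x assume "(y, x) \<in> H"
    then show "(y, x) \<in> H'"
      unfolding H'_def using y0 Hc by (intro CollectI exI[of _ y] exI[of _ x] exI[of _ "\<zero>\<^bsub>k\<^esub>"]) auto
  qed
  moreover have "(y0, x0) \<in> H'"
    unfolding H'_def using y0 H0 by (intro CollectI exI[of _ "\<zero>\<^bsub>W\<^esub>"] exI[of _ "\<zero>\<^bsub>V\<^esub>"] exI[of _ "\<one>\<^bsub>k\<^esub>"]) auto
  ultimately show thesis using that by blast
qed

lemma linear_generalized_inverse:
  assumes "field k" "module k V" "module k W" and f: "f \<in> linear_maps k V W"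
  obtains h where "h \<in> linear_maps k W V" "\<And>x. x \<in> carrier V \<Longrightarrow> f (h (f x)) = f x"
proof -
  interpret k: field k by fact
  interpret V: module k V by fact
  interpret W: module k W by fact
  note f_simps = linear_maps_closed[OF f] linear_maps_add[OF f] linear_maps_smult[OF f]
    linear_maps_zero[OF f assms(2,3)]
  let ?P = "Collect (partial_gen_inverse k V W f)"
  have "\<exists>H\<in>?P. \<forall>X\<in>?P. H \<subseteq> X \<longrightarrow> X = H"
  proof (rule subset_Zorn_nonempty)
    have "{(\<zero>\<^bsub>W\<^esub>, \<zero>\<^bsub>V\<^esub>)} \<in> ?P" by (auto simp: partial_gen_inverse_def f_simps)
    then show "?P \<noteq> {}" by blast
  next
    fix C assume "C \<noteq> {}" and chain: "subset.chain ?P C"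
    then have C: "partial_gen_inverse k V W f H" if "H \<in> C" for H
      using that by (auto simp: subset.chain_def)
    have tot: "\<exists>H\<in>C. p \<in> H \<and> q \<in> H" if pq: "p \<in> \<Union>C" "q \<in> \<Union>C" for p q
    proof -
      obtain X Y where X: "X \<in> C" "p \<in> X" and Y: "Y \<in> C" "q \<in> Y" using pq by blast
      have "X \<subseteq> Y \<or> Y \<subseteq> X"
        using chain X(1) Y(1) unfolding subset_chain_def by blast
      then show ?thesis using X Y by blast
    qed
    obtain H0 where H0: "H0 \<in> C" using \<open>C \<noteq> {}\<close> by blast
    show "\<Union>C \<in> ?P"
      unfolding mem_Collect_eq partial_gen_inverse_def
    proof (intro conjI allI impI)
      show "\<Union>C \<subseteq> carrier W \<times> carrier V" using C unfolding partial_gen_inverse_def by blast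
      show "(\<zero>\<^bsub>W\<^esub>, \<zero>\<^bsub>V\<^esub>) \<in> \<Union>C" using C H0 unfolding partial_gen_inverse_def by blast
    next
      fix y x y' x' assume "(y, x) \<in> \<Union>C" "(y', x') \<in> \<Union>C"
      then obtain H where "H \<in> C" "(y, x) \<in> H" "(y', x') \<in> H" using tot by blast
      then show "(y \<oplus>\<^bsub>W\<^esub> y', x \<oplus>\<^bsub>V\<^esub> x') \<in> \<Union>C" using C unfolding partial_gen_inverse_def by blast
    next
      fix c y x assume "c \<in> carrier k" "(y, x) \<in> \<Union>C"
      then show "(c \<odot>\<^bsub>W\<^esub> y, c \<odot>\<^bsub>V\<^esub> x) \<in> \<Union>C" using C unfolding partial_gen_inverse_def by blast
    next
      fix x assume "(\<zero>\<^bsub>W\<^esub>, x) \<in> \<Union>C"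
      then show "x = \<zero>\<^bsub>V\<^esub>" using C unfolding partial_gen_inverse_def by blast
    next
      fix y x assume "(y, x) \<in> \<Union>C" "y \<in> f ` carrier V"
      then show "f x = y" using C unfolding partial_gen_inverse_def by blast
    qed
  qed
  then obtain H where H: "partial_gen_inverse k V W f H"
    and max: "\<And>X. partial_gen_inverse k V W f X \<Longrightarrow> H \<subseteq> X \<Longrightarrow> X = H" by auto
  have Hc: "y \<in> carrier W" "x \<in> carrier V" if "(y, x) \<in> H" for x y
    using H that by (auto simp: partial_gen_inverse_def)
  have Ha: "\<And>y x y' x'. \<lbrakk>(y, x) \<in> H; (y', x') \<in> H\<rbrakk> \<Longrightarrow> (y \<oplus>\<^bsub>W\<^esub> y', x \<oplus>\<^bsub>V\<^esub> x') \<in> H"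
    and Hs: "\<And>c y x. \<lbrakk>c \<in> carrier k; (y, x) \<in> H\<rbrakk> \<Longrightarrow> (c \<odot>\<^bsub>W\<^esub> y, c \<odot>\<^bsub>V\<^esub> x) \<in> H"
    and Hz: "\<And>x. (\<zero>\<^bsub>W\<^esub>, x) \<in> H \<Longrightarrow> x = \<zero>\<^bsub>V\<^esub>"
    and Hf: "\<And>y x. \<lbrakk>(y, x) \<in> H; y \<in> f ` carrier V\<rbrakk> \<Longrightarrow> f x = y"
    using H by (auto simp: partial_gen_inverse_def)
  have Hm: "(y \<ominus>\<^bsub>W\<^esub> y', x \<ominus>\<^bsub>V\<^esub> x') \<in> H" if "(y, x) \<in> H" "(y', x') \<in> H" for y x y' x'
    using Ha[OF that(1) Hs[OF _ that(2), of "\<ominus>\<^bsub>k\<^esub> \<one>\<^bsub>k\<^esub>"]] Hc[OF that(2)]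
    by (simp add: V.smult_l_minus W.smult_l_minus a_minus_def)
  \<comment> \<open>An admissible extension at \<open>y0\<close> would be proper, against
    maximality. So it suffices to name a value \<open>x0\<close> that would be admissible if
    \<open>y0\<close> were outside the domain.\<close>
  have extend: "\<exists>x. (y0, x) \<in> H"
    if y0: "y0 \<in> carrier W" "x0 \<in> carrier V"
      and step: "\<And>y x c. \<lbrakk>(y, x) \<in> H; c \<in> carrier k; y \<oplus>\<^bsub>W\<^esub> c \<odot>\<^bsub>W\<^esub> y0 \<in> f ` carrier V; \<And>x. (y0, x) \<notin> H\<rbrakk>
      \<Longrightarrow> f (x \<oplus>\<^bsub>V\<^esub> c \<odot>\<^bsub>V\<^esub> x0) = y \<oplus>\<^bsub>W\<^esub> c \<odot>\<^bsub>W\<^esub> y0" for y0 x0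
  proof (rule ccontr)
    assume n: "\<nexists>x. (y0, x) \<in> H"
    obtain H' where "partial_gen_inverse k V W f H'" "H \<subseteq> H'" "(y0, x0) \<in> H'"
    proof (rule partial_gen_inverse_extend[OF assms(1-3) H y0])
      show "(y0, x) \<notin> H" for x using n by blast
      show "f (x \<oplus>\<^bsub>V\<^esub> c \<odot>\<^bsub>V\<^esub> x0) = y \<oplus>\<^bsub>W\<^esub> c \<odot>\<^bsub>W\<^esub> y0"
        if "(y, x) \<in> H" "c \<in> carrier k" "y \<oplus>\<^bsub>W\<^esub> c \<odot>\<^bsub>W\<^esub> y0 \<in> f ` carrier V" for y x c
        by (rule step[OF that]) (use n in blast)
    qed
    from max[OF this(1,2)] this(3) n show False by blast
  qed
  \<comment> \<open>The domain contains the image of \<open>f\<close>, with \<open>w\<close> as the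
    value proposed at \<open>f w\<close>: if \<open>y + c f(w)\<close> is in the image, so is
    \<open>y\<close>, and the inverse property at \<open>y\<close> extends.\<close>
  have im: "\<exists>x. (f w, x) \<in> H" if w: "w \<in> carrier V" for w
  proof (rule extend[of _ w])
    fix y x c
    assume yx: "(y, x) \<in> H" and c: "c \<in> carrier k" and "y \<oplus>\<^bsub>W\<^esub> c \<odot>\<^bsub>W\<^esub> f w \<in> f ` carrier V"
    then obtain u where u: "u \<in> carrier V" "y \<oplus>\<^bsub>W\<^esub> c \<odot>\<^bsub>W\<^esub> f w = f u" by blast
    have "y = f u \<ominus>\<^bsub>W\<^esub> c \<odot>\<^bsub>W\<^esub> f w"
      unfolding u(2)[symmetric] using Hc[OF yx] c w
      by (simp add: a_minus_def W.M.a_assoc W.M.r_neg f_simps)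
    also have "\<dots> = f (u \<ominus>\<^bsub>V\<^esub> c \<odot>\<^bsub>V\<^esub> w)"
      using u c w by (simp add: linear_maps_minus[OF f assms(2,3)] f_simps)
    finally have "y \<in> f ` carrier V" using u c w by auto
    then have "f x = y" using Hf yx by blast
    then show "f (x \<oplus>\<^bsub>V\<^esub> c \<odot>\<^bsub>V\<^esub> w) = y \<oplus>\<^bsub>W\<^esub> c \<odot>\<^bsub>W\<^esub> f w"
      using Hc[OF yx] c w by (simp add: f_simps)
  qed (use w f_simps in auto)
  \<comment> \<open>Outside the image the proposed value is 0. If \<open>y + c y0\<close> lies in
    the image, it is in the domain by \<open>im\<close>, hence so is \<open>c y0\<close>; this
    forces \<open>c = 0\<close>, and nothing new is required of \<open>f\<close>.\<close>
  have all: "\<exists>x. (y0, x) \<in> H" if y0: "y0 \<in> carrier W" for y0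
  proof (rule extend[of _ "\<zero>\<^bsub>V\<^esub>"])
    fix y x c
    assume yx: "(y, x) \<in> H" and c: "c \<in> carrier k" and fi: "y \<oplus>\<^bsub>W\<^esub> c \<odot>\<^bsub>W\<^esub> y0 \<in> f ` carrier V"
      and n: "\<And>x. (y0, x) \<notin> H"
    obtain w where "w \<in> carrier V" "y \<oplus>\<^bsub>W\<^esub> c \<odot>\<^bsub>W\<^esub> y0 = f w" using fi by (rule imageE)
    with im[of w] obtain u where "(y \<oplus>\<^bsub>W\<^esub> c \<odot>\<^bsub>W\<^esub> y0, u) \<in> H" by auto
    from Hm[OF this yx] have u: "(c \<odot>\<^bsub>W\<^esub> y0, u \<ominus>\<^bsub>V\<^esub> x) \<in> H"
      using Hc[OF yx] c y0 by (simp add: W.M.add_minus_cancel_left)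
    have "c = \<zero>\<^bsub>k\<^esub>"
    proof (rule ccontr)
      assume "c \<noteq> \<zero>\<^bsub>k\<^esub>"
      then have c': "inv\<^bsub>k\<^esub> c \<in> carrier k" "inv\<^bsub>k\<^esub> c \<otimes>\<^bsub>k\<^esub> c = \<one>\<^bsub>k\<^esub>"
        using c k.field_Units by auto
      then show False using Hs[OF c'(1) u] n y0 c by (simp add: W.smult_assoc1[symmetric])
    qed
    then show "f (x \<oplus>\<^bsub>V\<^esub> c \<odot>\<^bsub>V\<^esub> \<zero>\<^bsub>V\<^esub>) = y \<oplus>\<^bsub>W\<^esub> c \<odot>\<^bsub>W\<^esub> y0"
      using Hf[OF yx] fi Hc[OF yx] y0 by simp
  qed (use y0 in auto)
  define h where "h y = (SOME x. (y, x) \<in> H)" for y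
  have h: "(y, h y) \<in> H" if "y \<in> carrier W" for y
    unfolding h_def using someI_ex[OF all[OF that]] .
  have uniq: "h y = x" if "(y, x) \<in> H" for x y
  proof -
    have "(y, h y) \<in> H" using h Hc[OF that] by blast
    from Hm[OF this that] have "(\<zero>\<^bsub>W\<^esub>, h y \<ominus>\<^bsub>V\<^esub> x) \<in> H"
      using Hc[OF that] by (simp add: a_minus_def W.M.r_neg)
    from Hz[OF this] show ?thesis using Hc[OF that] Hc[OF \<open>(y, h y) \<in> H\<close>] by (simp add: V.M.minus_eq_zero_iff)
  qed
  have "h \<in> linear_maps k W V"
    by (intro linear_mapsI uniq[OF Ha[OF h h]] uniq[OF Hs[OF _ h]] Hc(2)[OF h])
  moreover have "f (h (f x)) = f x" if "x \<in> carrier V" for x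
    using Hf[OF h[of "f x"]] that f_simps(1) by blast
  ultimately show thesis using that by blast
qed

section \<open>The subspace \<open>V \<otimes> R\<close> and exactness\<close>

lemma tensor_subspace_subgroup:
  assumes "module k V" "module k W" "R \<subseteq> carrier W"
  shows "subgroup (tensor_subspace k V W R) (add_monoid (tensor_module k V W))"
proof -
  interpret two_modules k V W using assms by (intro two_modulesI)
  show ?thesis
    unfolding tensor_subspace_def using assms(3) pure_closed
    by (intro T.add.generate_is_subgroup) auto
qed

lemma pure_in_tensor_subspace: "\<lbrakk>v \<in> carrier V; r \<in> R\<rbrakk> \<Longrightarrow> pure_tensor k V W v r \<in> tensor_subspace k V W R"
  unfolding tensor_subspace_def by (rule generate.incl) blast

text \<open>\<open>R\<close> may be any subset, even empty, so zero has its own case. Negatives have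
  none, as -(v \<otimes> r) = (-v) \<otimes> r is again a generator.\<close>

lemma tensor_subspace_induct [consumes 4, case_names zero pure add]:
  assumes "module k V" "module k W" "R \<subseteq> carrier W" "z \<in> tensor_subspace k V W R"
    and "P \<zero>\<^bsub>tensor_module k V W\<^esub>"
    and "\<And>v r. \<lbrakk>v \<in> carrier V; r \<in> R\<rbrakk> \<Longrightarrow> P (pure_tensor k V W v r)"
    and "\<And>x y. \<lbrakk>x \<in> tensor_subspace k V W R; y \<in> tensor_subspace k V W R; P x; P y\<rbrakk>
      \<Longrightarrow> P (x \<oplus>\<^bsub>tensor_module k V W\<^esub> y)"
  shows "P z"
proof -
  interpret two_modules k V W using assms by (intro two_modulesI)
  have "z \<in> tensor_subspace k V W R \<and> P z"
    using assms(4)[unfolded tensor_subspace_def]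
  proof (induction rule: generate.induct)
    case one
    show ?case
      using assms(5) subgroup.one_closed[OF tensor_subspace_subgroup[OF assms(1-3)]] by simp
  next
    case (incl h)
    then obtain v r where "h = pure_tensor k V W v r" "v \<in> carrier V" "r \<in> R" by blast
    then show ?case by (simp add: assms(6) pure_in_tensor_subspace)
  next
    case (inv h)
    then obtain v r where h: "h = pure_tensor k V W v r" "v \<in> carrier V" "r \<in> R" by blast
    then have "inv\<^bsub>add_monoid T\<^esub> h = pure_tensor k V W (\<ominus>\<^bsub>V\<^esub> v) r"
      using assms(3) pure_neg[of v r] by (auto simp: a_inv_def)
    then show ?case using h by (simp add: assms(6) pure_in_tensor_subspace)
  next
    case (eng h1 h2)
    then show ?case
      using assms(7) subgroup.m_closed[OF tensor_subspace_subgroup[OF assms(1-3)]] by simp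
  qed
  then show ?thesis by simp
qed

lemma linear_maps_tensor_subspace_zero:
  assumes "module k V" "module k W" "module k M" "R \<subseteq> carrier W"
    and f: "f \<in> linear_maps k (tensor_module k V W) M"
    and "\<And>v r. \<lbrakk>v \<in> carrier V; r \<in> R\<rbrakk> \<Longrightarrow> f (pure_tensor k V W v r) = \<zero>\<^bsub>M\<^esub>"
    and z: "z \<in> tensor_subspace k V W R"
  shows "f z = \<zero>\<^bsub>M\<^esub>"
proof -
  interpret M: module k M by fact
  note sub = subgroup.subset[OF tensor_subspace_subgroup[OF assms(1,2,4)]]
  show ?thesis
    using assms(1,2,4) z
  proof (induction rule: tensor_subspace_induct)
    case zero
    show ?case by (rule linear_maps_zero[OF f tensor_module_module[OF assms(1,2)] assms(3)])
  next
    case (pure v r)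
    then show ?case by (rule assms(6))
  next
    case (add x y)
    then show ?case using linear_maps_add[OF f, of x y] sub by auto
  qed
qed

text \<open>
  If \<open>f h f = f\<close>, then \<open>z - (id \<otimes> h f) z\<close> lies in \<open>V \<otimes> ker f\<close>, and it equals \<open>z\<close> when \<open>(id \<otimes> f) z = 0\<close>.
\<close>

lemma tensor_kernel_exact:
  assumes "field k" "module k V" "module k W" "module k M" and f: "f \<in> linear_maps k W M"
    and z: "z \<in> carrier (tensor_module k V W)"
    and fz: "tensor_lift (tensor_module k V M) (\<lambda>v w. pure_tensor k V M v (f w)) z = \<zero>\<^bsub>tensor_module k V M\<^esub>"
  shows "z \<in> tensor_subspace k V W {w \<in> carrier W. f w = \<zero>\<^bsub>M\<^esub>}"
proof -
  interpret two_modules k V W using assms by (intro two_modulesI)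
  interpret M: module k M by fact
  interpret VM: two_modules k V M using assms by (intro two_modulesI)
  obtain h where h: "h \<in> linear_maps k M W" "\<And>x. x \<in> carrier W \<Longrightarrow> f (h (f x)) = f x"
    using linear_generalized_inverse[OF assms(1,3,4) f] by blast
  let ?K = "{w \<in> carrier W. f w = \<zero>\<^bsub>M\<^esub>}"
  interpret K: subgroup "tensor_subspace k V W ?K" "add_monoid T"
    by (rule tensor_subspace_subgroup) (use assms in auto)
  have b1: "(\<lambda>v w. pure_tensor k V M v (f w)) \<in> bilinear_maps k V W VM.T"
    by (intro bilinear_mapsI linear_maps_pure_right linear_maps_pure_left linear_maps_id f assms linear_maps_closed[OF f] refl)
  have b2: "(\<lambda>v m. pure_tensor k V W v (h m)) \<in> bilinear_maps k V M T"
    by (intro bilinear_mapsI linear_maps_pure_right linear_maps_pure_left linear_maps_id h assms linear_maps_closed[OF h(1)] refl)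
  let ?f = "tensor_lift VM.T (\<lambda>v w. pure_tensor k V M v (f w))"
  let ?h = "tensor_lift T (\<lambda>v m. pure_tensor k V W v (h m))"
  have lf: "?f \<in> linear_maps k T VM.T" by (rule tensor_lift_linear[OF VM.T_module b1])
  have lh: "?h \<in> linear_maps k VM.T T" by (rule VM.tensor_lift_linear[OF T_module b2])
  have l: "(\<lambda>z. ?h (?f z)) \<in> linear_maps k T T" by (rule linear_maps_comp[OF lh lf])
  have "z \<ominus>\<^bsub>T\<^esub> ?h (?f z) \<in> tensor_subspace k V W ?K" using z
  proof (induction z rule: tensor_induct)
    case (pure v w)
    have c: "f w \<in> carrier M" "h (f w) \<in> carrier W"
      using pure linear_maps_closed[OF f] linear_maps_closed[OF h(1)] by auto
    have "pure_tensor k V W v w \<ominus>\<^bsub>T\<^esub> ?h (?f (pure_tensor k V W v w)) = pure_tensor k V W v w \<ominus>\<^bsub>T\<^esub> pure_tensor k V W v (h (f w))"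
      using pure c by (simp add: tensor_lift_pure[OF VM.T_module b1] VM.tensor_lift_pure[OF T_module b2])
    also have "\<dots> = pure_tensor k V W v (w \<ominus>\<^bsub>W\<^esub> h (f w))"
      using linear_maps_minus[OF bilinear_maps_right[OF pure_bilinear pure(1)] assms(3) T_module pure(2) c(2)] by simp
    also have "\<dots> \<in> tensor_subspace k V W ?K"
      using pure c h(2) linear_maps_minus[OF f assms(3,4) pure(2) c(2)]
      by (intro pure_in_tensor_subspace) (auto simp: M.minus_eq_zero_iff)
    finally show ?case .
  next
    case (add x y)
    have c: "?h (?f x) \<in> carrier T" "?h (?f y) \<in> carrier T"
      using linear_maps_closed[OF l] add by auto
    have "(x \<oplus>\<^bsub>T\<^esub> y) \<ominus>\<^bsub>T\<^esub> ?h (?f (x \<oplus>\<^bsub>T\<^esub> y)) = (x \<ominus>\<^bsub>T\<^esub> ?h (?f x)) \<oplus>\<^bsub>T\<^esub> (y \<ominus>\<^bsub>T\<^esub> ?h (?f y))"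
      using linear_maps_add[OF l add(1,2)] add(1,2) c
      by (simp add: a_minus_def T.minus_add T.a_ac)
    then show ?case using K.m_closed[OF add(3,4)] by simp
  qed
  moreover have "?h (?f z) = \<zero>\<^bsub>T\<^esub>"
    unfolding fz by (rule linear_maps_zero[OF lh VM.T_module T_module])
  ultimately show ?thesis using T.add_minus_cancel_left[of "\<zero>\<^bsub>T\<^esub>" z] z by simp
qed

section \<open>The universal calculus\<close>

text \<open>Concatenation of two families keeps sums within index sets \<open>{..<n}\<close>, the
  form used by \<open>fodc\<close> and \<open>left_covariant\<close>.\<close>

lemma (in abelian_monoid) finsum_append:
  fixes n m :: nat
  assumes "f \<in> {..<n} \<rightarrow> carrier G" "g \<in> {..<m} \<rightarrow> carrier G"
  shows "(\<Oplus>j\<in>{..<n + m}. if j < n then f j else g (j - n)) = (\<Oplus>j\<in>{..<n}. f j) \<oplus> (\<Oplus>j\<in>{..<m}. g j)"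
  using assms(2)
proof (induction m)
  case 0
  have "(\<Oplus>j\<in>{..<n}. if j < n then f j else g (j - n)) = (\<Oplus>j\<in>{..<n}. f j)"
    using assms(1) by (intro finsum_cong') auto
  then show ?case using assms(1) by simp
next
  case (Suc m)
  let ?h = "\<lambda>j. if j < n then f j else g (j - n)"
  have h: "?h \<in> {..<n + m} \<rightarrow> carrier G" "g m \<in> carrier G" "g \<in> {..<m} \<rightarrow> carrier G"
    using assms(1) Suc.prems by (auto simp: Pi_iff)
  have "(\<Oplus>j\<in>{..<n + Suc m}. ?h j) = g m \<oplus> (\<Oplus>j\<in>{..<n + m}. ?h j)"
    using h by (simp add: lessThan_Suc)
  also have "\<dots> = (\<Oplus>j\<in>{..<n}. f j) \<oplus> (g m \<oplus> (\<Oplus>j\<in>{..<m}. g j))"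
    using Suc.IH h assms(1) by (simp add: a_ac)
  also have "g m \<oplus> (\<Oplus>j\<in>{..<m}. g j) = (\<Oplus>j\<in>{..<Suc m}. g j)"
    using h by (simp add: lessThan_Suc)
  finally show ?case .
qed

text \<open>This links the two languages: calculi are axiomatised with finite families
  \<open>a\<close>, \<open>b\<close>, while the proof works with the tensor that they
  define.\<close>

lemma tensor_finite_sum:
  assumes "module k V" "module k W" "t \<in> carrier (tensor_module k V W)"
  obtains n :: nat and v w where "v \<in> {..<n} \<rightarrow> carrier V" "w \<in> {..<n} \<rightarrow> carrier W"
    "t = (\<Oplus>\<^bsub>tensor_module k V W\<^esub>j\<in>{..<n}. pure_tensor k V W (v j) (w j))"
proof -
  interpret two_modules k V W using assms by (intro two_modulesI)
  have "\<exists>(n::nat) v w. v \<in> {..<n} \<rightarrow> carrier V \<and> w \<in> {..<n} \<rightarrow> carrier W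
      \<and> t = (\<Oplus>\<^bsub>T\<^esub>j\<in>{..<n}. pure_tensor k V W (v j) (w j))"
    using assms(3)
  proof (induction t rule: tensor_induct)
    case (pure v w)
    have "pure_tensor k V W v w = (\<Oplus>\<^bsub>T\<^esub>j\<in>{..<1::nat}. pure_tensor k V W v w)"
      using pure_closed[OF pure] by (simp add: lessThan_Suc)
    with pure show ?case
      by (intro exI[of _ "1::nat"] exI[of _ "\<lambda>_. v"] exI[of _ "\<lambda>_. w"]) simp
  next
    case (add x y)
    then obtain n v w m v' w' where x: "v \<in> {..<n::nat} \<rightarrow> carrier V" "w \<in> {..<n} \<rightarrow> carrier W"
        "x = (\<Oplus>\<^bsub>T\<^esub>j\<in>{..<n}. pure_tensor k V W (v j) (w j))"
      and y: "v' \<in> {..<m::nat} \<rightarrow> carrier V" "w' \<in> {..<m} \<rightarrow> carrier W"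
        "y = (\<Oplus>\<^bsub>T\<^esub>j\<in>{..<m}. pure_tensor k V W (v' j) (w' j))"
      by blast
    let ?v = "\<lambda>j. if j < n then v j else v' (j - n)" and ?w = "\<lambda>j. if j < n then w j else w' (j - n)"
    have c: "?v \<in> {..<n + m} \<rightarrow> carrier V" "?w \<in> {..<n + m} \<rightarrow> carrier W"
      using x(1,2) y(1,2) by (auto simp: Pi_iff)
    have "x \<oplus>\<^bsub>T\<^esub> y = (\<Oplus>\<^bsub>T\<^esub>j\<in>{..<n + m}. if j < n then pure_tensor k V W (v j) (w j)
        else pure_tensor k V W (v' (j - n)) (w' (j - n)))"
      unfolding x(3) y(3) using x(1,2) y(1,2) by (intro T.finsum_append[symmetric]) (auto intro!: pure_closed)
    also have "\<dots> = (\<Oplus>\<^bsub>T\<^esub>j\<in>{..<n + m}. pure_tensor k V W (?v j) (?w j))"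
      using c by (intro T.finsum_cong') (auto intro!: pure_closed)
    finally show ?case using c by blast
  qed
  with that show thesis by blast
qed

lemma linear_maps_minus_fun:
  assumes "module k W" "f \<in> linear_maps k V W" "g \<in> linear_maps k V W"
  shows "(\<lambda>x. f x \<ominus>\<^bsub>W\<^esub> g x) \<in> linear_maps k V W"
proof -
  interpret W: module k W by fact
  show ?thesis
    using assms(2,3)
    by (intro linear_mapsI)
       (simp_all add: a_minus_def linear_maps_closed linear_maps_add linear_maps_smult W.smult_r_distr W.M.a_ac
         W.M.minus_add W.smult_r_minus)
qed

section \<open>Multiplication and the two actions on \<open>A \<otimes> A\<close>\<close>

lemma assoc_algebra_module: "assoc_algebra k A \<Longrightarrow> module k A"
  by (simp add: assoc_algebra_def)

lemma linear_maps_mult_left: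
  "\<lbrakk>assoc_algebra k A; c \<in> carrier A; f \<in> linear_maps k V A\<rbrakk> \<Longrightarrow> (\<lambda>x. c \<otimes>\<^bsub>A\<^esub> f x) \<in> linear_maps k V A"
  and linear_maps_mult_right:
  "\<lbrakk>assoc_algebra k A; c \<in> carrier A; f \<in> linear_maps k V A\<rbrakk> \<Longrightarrow> (\<lambda>x. f x \<otimes>\<^bsub>A\<^esub> c) \<in> linear_maps k V A"
proof -
  assume "assoc_algebra k A" and c: "c \<in> carrier A" and f: "f \<in> linear_maps k V A"
  then interpret assoc_algebra k A by simp
  show "(\<lambda>x. c \<otimes>\<^bsub>A\<^esub> f x) \<in> linear_maps k V A"
    using c linear_maps_closed[OF f]
    by (intro linear_mapsI)
       (simp_all add: linear_maps_add[OF f] linear_maps_smult[OF f] Alg.r_distr smult_mult_right)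
  show "(\<lambda>x. f x \<otimes>\<^bsub>A\<^esub> c) \<in> linear_maps k V A"
    using c linear_maps_closed[OF f]
    by (intro linear_mapsI)
       (simp_all add: linear_maps_add[OF f] linear_maps_smult[OF f] Alg.l_distr smult_mult_left)
qed

context assoc_algebra
begin

abbreviation T where "T \<equiv> tensor_module k A A"
abbreviation tens where "tens \<equiv> pure_tensor k A A"
abbreviation U where "U \<equiv> universal_bimod k A"

lemma A_module: "module k A" by (rule Vec.module_axioms)
lemma A_algebra: "assoc_algebra k A" by (rule assoc_algebra_axioms)

sublocale AA: two_modules k A A by (rule two_modulesI[OF A_module A_module])
sublocale TM: module k T by (rule AA.T_module)

lemmas lin_intros =
  linear_maps_mult_left[OF A_algebra] linear_maps_mult_right[OF A_algebra]
  linear_maps_pure_left[OF A_module A_module] linear_maps_pure_right[OF A_module A_module]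
  linear_maps_id[OF refl] bilinear_mapsI

lemma mult_bilinear: "(\<lambda>a b. a \<otimes>\<^bsub>A\<^esub> b) \<in> bilinear_maps k A A A"
  by (intro lin_intros)

lemma mult_map_linear: "mult_map A \<in> linear_maps k T A"
  unfolding mult_map_def using mult_bilinear by (intro tensor_lift_linear A_module) simp

lemma mult_map_pure: "\<lbrakk>a \<in> carrier A; b \<in> carrier A\<rbrakk> \<Longrightarrow> mult_map A (tens a b) = a \<otimes>\<^bsub>A\<^esub> b"
  unfolding mult_map_def using mult_bilinear by (simp add: tensor_lift_pure[OF A_module A_module A_module])

lemma lact_bilinear: "c \<in> carrier A \<Longrightarrow> (\<lambda>v w. tens (c \<otimes>\<^bsub>A\<^esub> v) w) \<in> bilinear_maps k A A T"
  by (intro lin_intros) auto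

lemma ract_bilinear: "c \<in> carrier A \<Longrightarrow> (\<lambda>v w. tens v (w \<otimes>\<^bsub>A\<^esub> c)) \<in> bilinear_maps k A A T"
  by (intro lin_intros) auto

lemma lact_eq: "lact U c q = tensor_lift T (\<lambda>v w. tens (c \<otimes>\<^bsub>A\<^esub> v) w) q"
  and ract_eq: "ract U q c = tensor_lift T (\<lambda>v w. tens v (w \<otimes>\<^bsub>A\<^esub> c)) q"
  by (simp_all add: universal_bimod_def tensor_map_def)

lemma lact_linear: "c \<in> carrier A \<Longrightarrow> lact U c \<in> linear_maps k T T"
  unfolding lact_eq[abs_def] by (rule tensor_lift_linear[OF A_module A_module AA.T_module lact_bilinear])

lemma ract_linear: "c \<in> carrier A \<Longrightarrow> (\<lambda>q. ract U q c) \<in> linear_maps k T T"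
  unfolding ract_eq by (rule linear_maps_tensor_lift_arg[OF A_module A_module AA.T_module ract_bilinear linear_maps_id[OF refl]])

lemma lact_linear': "q \<in> carrier T \<Longrightarrow> (\<lambda>c. lact U c q) \<in> linear_maps k A T"
  unfolding lact_eq
  by (rule linear_maps_tensor_lift_fun[OF A_module A_module AA.T_module _ A_module lact_bilinear])
     (auto intro!: lin_intros)

lemma ract_linear': "q \<in> carrier T \<Longrightarrow> (\<lambda>c. ract U q c) \<in> linear_maps k A T"
  unfolding ract_eq
  by (rule linear_maps_tensor_lift_fun[OF A_module A_module AA.T_module _ A_module ract_bilinear])
     (auto intro!: lin_intros)

lemma lact_pure:
  "\<lbrakk>c \<in> carrier A; a \<in> carrier A; b \<in> carrier A\<rbrakk> \<Longrightarrow> lact U c (tens a b) = tens (c \<otimes>\<^bsub>A\<^esub> a) b"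
  unfolding lact_eq by (rule tensor_lift_pure[OF A_module A_module AA.T_module lact_bilinear])

lemma ract_pure:
  "\<lbrakk>c \<in> carrier A; a \<in> carrier A; b \<in> carrier A\<rbrakk> \<Longrightarrow> ract U (tens a b) c = tens a (b \<otimes>\<^bsub>A\<^esub> c)"
  unfolding ract_eq by (rule tensor_lift_pure[OF A_module A_module AA.T_module ract_bilinear])

lemmas lact_T_closed = linear_maps_closed[OF lact_linear]
lemmas ract_T_closed = linear_maps_closed[OF ract_linear]
lemmas tensor_ext = linear_maps_tensor_eqI[OF A_module A_module]

lemma mult_map_lact:
  assumes "c \<in> carrier A" "q \<in> carrier T"
  shows "mult_map A (lact U c q) = c \<otimes>\<^bsub>A\<^esub> mult_map A q"
  by (rule tensor_ext[OF linear_maps_comp[OF mult_map_linear lact_linear[OF assms(1)]]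
        linear_maps_mult_left[OF A_algebra assms(1) mult_map_linear] _ assms(2)])
     (simp add: assms lact_pure mult_map_pure Alg.m_assoc)

lemma mult_map_ract:
  assumes "c \<in> carrier A" "q \<in> carrier T"
  shows "mult_map A (ract U q c) = mult_map A q \<otimes>\<^bsub>A\<^esub> c"
  by (rule tensor_ext[OF linear_maps_comp[OF mult_map_linear ract_linear[OF assms(1)]]
        linear_maps_mult_right[OF A_algebra assms(1) mult_map_linear] _ assms(2)])
     (simp add: assms ract_pure mult_map_pure Alg.m_assoc)

section \<open>The bimodule of tensors with product zero and its derivation\<close>

lemma U_fields [simp]:
  "\<zero>\<^bsub>U\<^esub> = \<zero>\<^bsub>T\<^esub>" "ring.add U = ring.add T" "module.smult U = module.smult T"
  by (simp_all add: universal_bimod_def)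

lemma carrier_U: "q \<in> carrier U \<longleftrightarrow> q \<in> carrier T \<and> mult_map A q = \<zero>\<^bsub>A\<^esub>"
  by (simp add: universal_bimod_def)

lemma mult_map_closed: "q \<in> carrier T \<Longrightarrow> mult_map A q \<in> carrier A"
  by (rule linear_maps_closed[OF mult_map_linear])

lemma U_abelian_group: "abelian_group U"
proof (rule abelian_groupI)
  fix x assume x: "x \<in> carrier U"
  have "\<ominus>\<^bsub>T\<^esub> x \<in> carrier U"
    using x linear_maps_a_inv[OF mult_map_linear AA.T_module A_module, of x] Alg.minus_zero
    by (simp add: carrier_U)
  then show "\<exists>y\<in>carrier U. y \<oplus>\<^bsub>U\<^esub> x = \<zero>\<^bsub>U\<^esub>"
    using x by (intro bexI[of _ "\<ominus>\<^bsub>T\<^esub> x"]) (simp_all add: carrier_U AA.T.l_neg)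
qed (auto simp: carrier_U linear_maps_add[OF mult_map_linear] linear_maps_zero[OF mult_map_linear AA.T_module A_module]
    AA.T.a_ac)

lemma U_module: "module k U"
  by (rule moduleI)
     (auto simp: carrier_U linear_maps_smult[OF mult_map_linear] Vec.smult_l_distr TM.smult_l_distr TM.smult_r_distr
       TM.smult_assoc1 is_cring U_abelian_group Vec.smult_r_null)

lemma U_bimodule: "bimodule k A U"
proof -
  have cl: "lact U a x \<in> carrier U" "ract U x a \<in> carrier U" if "a \<in> carrier A" "x \<in> carrier U" for a x
    using that by (auto simp: carrier_U lact_T_closed ract_T_closed mult_map_lact mult_map_ract)
  show ?thesis
  proof (intro bimodule.intro bimodule_axioms.intro A_algebra U_module cl)
    fix a b x assume ab: "a \<in> carrier A" "b \<in> carrier A" and "x \<in> carrier U"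
    then have x: "x \<in> carrier T" by (simp add: carrier_U)
    show "lact U (a \<oplus>\<^bsub>A\<^esub> b) x = lact U a x \<oplus>\<^bsub>U\<^esub> lact U b x"
      using linear_maps_add[OF lact_linear'[OF x] ab] by simp
    show "ract U x (a \<oplus>\<^bsub>A\<^esub> b) = ract U x a \<oplus>\<^bsub>U\<^esub> ract U x b"
      using linear_maps_add[OF ract_linear'[OF x] ab] by simp
    show "lact U (a \<otimes>\<^bsub>A\<^esub> b) x = lact U a (lact U b x)"
      using ab by (intro tensor_ext[OF lact_linear linear_maps_comp[OF lact_linear lact_linear] _ x])
        (auto simp: lact_pure Alg.m_assoc)
    show "ract U x (a \<otimes>\<^bsub>A\<^esub> b) = ract U (ract U x a) b"
      using ab by (intro tensor_ext[OF ract_linear linear_maps_comp[OF ract_linear ract_linear] _ x])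
        (auto simp: ract_pure Alg.m_assoc)
    show "ract U (lact U a x) b = lact U a (ract U x b)"
      using ab by (intro tensor_ext[OF linear_maps_comp[OF ract_linear lact_linear]
            linear_maps_comp[OF lact_linear ract_linear] _ x])
        (auto simp: lact_pure ract_pure)
  next
    fix a x y assume a: "a \<in> carrier A" and "x \<in> carrier U" "y \<in> carrier U"
    then have xy: "x \<in> carrier T" "y \<in> carrier T" by (auto simp: carrier_U)
    show "lact U a (x \<oplus>\<^bsub>U\<^esub> y) = lact U a x \<oplus>\<^bsub>U\<^esub> lact U a y"
      using linear_maps_add[OF lact_linear[OF a] xy] by simp
    show "ract U (x \<oplus>\<^bsub>U\<^esub> y) a = ract U x a \<oplus>\<^bsub>U\<^esub> ract U y a"
      using linear_maps_add[OF ract_linear[OF a] xy] by simp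
  next
    fix c a x assume c: "c \<in> carrier k" and a: "a \<in> carrier A" and "x \<in> carrier U"
    then have x: "x \<in> carrier T" by (simp add: carrier_U)
    show "lact U (c \<odot>\<^bsub>A\<^esub> a) x = c \<odot>\<^bsub>U\<^esub> lact U a x"
      using linear_maps_smult[OF lact_linear'[OF x] c a] by simp
    show "ract U x (c \<odot>\<^bsub>A\<^esub> a) = c \<odot>\<^bsub>U\<^esub> ract U x a"
      using linear_maps_smult[OF ract_linear'[OF x] c a] by simp
  next
    fix x assume "x \<in> carrier U"
    then have x: "x \<in> carrier T" by (simp add: carrier_U)
    show "lact U \<one>\<^bsub>A\<^esub> x = x"
      by (rule tensor_ext[OF lact_linear linear_maps_id[OF refl] _ x]) (auto simp: lact_pure)
    show "ract U x \<one>\<^bsub>A\<^esub> = x"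
      by (rule tensor_ext[OF ract_linear linear_maps_id[OF refl] _ x]) (auto simp: ract_pure)
  qed
qed

text \<open>Differences and finite sums in \<open>U\<close> are derived from its own record and are
  not literally those of \<open>A \<otimes> A\<close>; linearity of the inclusion transfers
  them.\<close>

lemma U_subset: "(\<lambda>x. x) \<in> linear_maps k U T"
  by (intro linear_mapsI) (auto simp: carrier_U)

lemma a_minus_U:
  assumes "x \<in> carrier U" "y \<in> carrier U"
  shows "x \<ominus>\<^bsub>U\<^esub> y = x \<ominus>\<^bsub>T\<^esub> y"
  using linear_maps_minus[OF U_subset U_module AA.T_module assms] .

lemma universal_d_closed: "b \<in> carrier A \<Longrightarrow> universal_d k A b \<in> carrier U"
  by (simp add: universal_d_def carrier_U AA.pure_closed linear_maps_minus[OF mult_map_linear AA.T_module A_module]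
      mult_map_pure Vec.M.minus_eq_zero_iff)

lemma universal_d_linear: "universal_d k A \<in> linear_maps k A U"
proof -
  have l: "universal_d k A \<in> linear_maps k A T"
    unfolding universal_d_def[abs_def]
    by (intro linear_maps_minus_fun AA.T_module lin_intros) auto
  then show ?thesis
    using universal_d_closed by (simp add: linear_maps_def Pi_iff)
qed

text \<open>\<open>D(a) b = 1 \<otimes> ab - a \<otimes> b\<close> and
  \<open>a D(b) = a \<otimes> b - ab \<otimes> 1\<close> telescope.\<close>

lemma universal_leibniz:
  assumes "a \<in> carrier A" "b \<in> carrier A"
  shows "universal_d k A (a \<otimes>\<^bsub>A\<^esub> b) = ract U (universal_d k A a) b \<oplus>\<^bsub>U\<^esub> lact U a (universal_d k A b)"
proof -
  have "ract U (universal_d k A a) b = tens \<one>\<^bsub>A\<^esub> (a \<otimes>\<^bsub>A\<^esub> b) \<ominus>\<^bsub>T\<^esub> tens a b"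
    using assms unfolding universal_d_def
    by (subst linear_maps_minus[OF ract_linear AA.T_module AA.T_module]) (auto simp: ract_pure AA.pure_closed)
  moreover have "lact U a (universal_d k A b) = tens a b \<ominus>\<^bsub>T\<^esub> tens (a \<otimes>\<^bsub>A\<^esub> b) \<one>\<^bsub>A\<^esub>"
    using assms unfolding universal_d_def
    by (subst linear_maps_minus[OF lact_linear AA.T_module AA.T_module]) (auto simp: lact_pure AA.pure_closed)
  moreover have "(x \<ominus>\<^bsub>T\<^esub> y) \<oplus>\<^bsub>T\<^esub> (y \<ominus>\<^bsub>T\<^esub> z) = x \<ominus>\<^bsub>T\<^esub> z"
    if "x \<in> carrier T" "y \<in> carrier T" "z \<in> carrier T" for x y z
    using that by (simp add: a_minus_def AA.T.a_assoc AA.T.r_neg1)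
  ultimately show ?thesis
    using assms AA.pure_closed by (simp add: universal_d_def)
qed

text \<open>This is the projection of \<open>A \<otimes> A\<close> onto the kernel of
  \<open>m\<close> along \<open>A \<otimes> 1\<close>. Since \<open>d 1 = 0\<close> in every
  calculus, it does not change the value of \<open>a \<otimes> b \<mapsto> a db\<close>.\<close>

lemma universal_part_linear:
  "(\<lambda>q. q \<ominus>\<^bsub>T\<^esub> tens (mult_map A q) \<one>\<^bsub>A\<^esub>) \<in> linear_maps k T U"
proof -
  have l: "(\<lambda>q. q \<ominus>\<^bsub>T\<^esub> tens (mult_map A q) \<one>\<^bsub>A\<^esub>) \<in> linear_maps k T T"
    by (intro linear_maps_minus_fun AA.T_module lin_intros mult_map_linear) auto
  moreover have "q \<ominus>\<^bsub>T\<^esub> tens (mult_map A q) \<one>\<^bsub>A\<^esub> \<in> carrier U" if "q \<in> carrier T" for q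
    using linear_maps_closed[OF l that] that mult_map_closed[OF that]
    by (simp add: carrier_U linear_maps_minus[OF mult_map_linear AA.T_module A_module] mult_map_pure
        Vec.M.minus_eq_zero_iff AA.pure_closed)
  ultimately show ?thesis by (simp add: linear_maps_def Pi_iff)
qed

text \<open>For one pair, \<open>a D(b) = a \<otimes> b - ab \<otimes> 1\<close> is the projection
  of \<open>a \<otimes> b\<close> to the kernel of \<open>m\<close>; the rest is linearity.\<close>

lemma sum_lact_universal_d:
  assumes "finite I" and a: "a \<in> I \<rightarrow> carrier A" and b: "b \<in> I \<rightarrow> carrier A"
  shows "(\<Oplus>\<^bsub>U\<^esub>j\<in>I. lact U (a j) (universal_d k A (b j)))
    = (\<Oplus>\<^bsub>T\<^esub>j\<in>I. tens (a j) (b j))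
      \<ominus>\<^bsub>T\<^esub> tens (mult_map A (\<Oplus>\<^bsub>T\<^esub>j\<in>I. tens (a j) (b j))) \<one>\<^bsub>A\<^esub>"
proof -
  interpret UB: bimodule k A U by (rule U_bimodule)
  define f where "f q = q \<ominus>\<^bsub>T\<^esub> tens (mult_map A q) \<one>\<^bsub>A\<^esub>" for q
  have f: "f \<in> linear_maps k T T"
    unfolding f_def[abs_def]
    by (intro linear_maps_minus_fun AA.T_module lin_intros mult_map_linear) auto
  have p: "(\<lambda>j. tens (a j) (b j)) \<in> I \<rightarrow> carrier T"
    using a b by (auto intro!: AA.pure_closed)
  have l: "(\<lambda>j. lact U (a j) (universal_d k A (b j))) \<in> I \<rightarrow> carrier U"
    using a b universal_d_closed by (auto intro!: UB.lact_closed)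
  have "(\<Oplus>\<^bsub>U\<^esub>j\<in>I. lact U (a j) (universal_d k A (b j))) = (\<Oplus>\<^bsub>T\<^esub>j\<in>I. lact U (a j) (universal_d k A (b j)))"
    using linear_maps_finsum[OF U_subset U_module AA.T_module assms(1) l] .
  also have "\<dots> = (\<Oplus>\<^bsub>T\<^esub>j\<in>I. f (tens (a j) (b j)))"
  proof (rule AA.T.finsum_cong'[OF refl])
    show "(\<lambda>j. f (tens (a j) (b j))) \<in> I \<rightarrow> carrier T"
      using p linear_maps_closed[OF f] by auto
    fix j assume "j \<in> I"
    then have ab: "a j \<in> carrier A" "b j \<in> carrier A" using a b by auto
    then show "lact U (a j) (universal_d k A (b j)) = f (tens (a j) (b j))"
      unfolding universal_d_def f_def
      by (subst linear_maps_minus[OF lact_linear AA.T_module AA.T_module])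
         (auto simp: lact_pure mult_map_pure AA.pure_closed)
  qed
  also have "\<dots> = f (\<Oplus>\<^bsub>T\<^esub>j\<in>I. tens (a j) (b j))"
    using linear_maps_finsum[OF f AA.T_module AA.T_module assms(1) p] by simp
  finally show ?thesis by (simp add: f_def)
qed

lemma universal_fodc: "fodc k A U (universal_d k A)"
proof (intro fodc.intro fodc_axioms.intro U_bimodule universal_d_linear universal_leibniz)
  fix x assume "x \<in> carrier U"
  then have x: "x \<in> carrier T" "mult_map A x = \<zero>\<^bsub>A\<^esub>" by (auto simp: carrier_U)
  obtain n :: nat and a b where ab: "a \<in> {..<n} \<rightarrow> carrier A" "b \<in> {..<n} \<rightarrow> carrier A"
    "x = (\<Oplus>\<^bsub>T\<^esub>j\<in>{..<n}. tens (a j) (b j))"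
    using tensor_finite_sum[OF A_module A_module x(1)] by blast
  \<comment> \<open>As \<open>m(x) = 0\<close>, the projection fixes \<open>x\<close>, so any
    expansion of \<open>x\<close> into pure tensors is at once an expansion into terms
    \<open>a D(b)\<close>.\<close>
  have "x = (\<Oplus>\<^bsub>U\<^esub>j\<in>{..<n}. lact U (a j) (universal_d k A (b j)))"
    using x AA.T.add_minus_cancel_left[of "\<zero>\<^bsub>T\<^esub>" x]
    by (simp add: sum_lact_universal_d[OF _ ab(1,2)] ab(3)[symmetric] AA.pure_zero)
  with ab show "\<exists>(n::nat) a b. a \<in> {..<n} \<rightarrow> carrier A \<and> b \<in> {..<n} \<rightarrow> carrier A \<and>
      x = (\<Oplus>\<^bsub>U\<^esub>j\<in>{..<n}. lact U (a j) (universal_d k A (b j)))" by blast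
qed

end

section \<open>Quotients of calculi\<close>

context bimodule
begin

text \<open>The axioms tie scalars to the algebra argument only. Writing \<open>c x\<close> as
  \<open>(c 1) x\<close> reduces the claim to the fact that \<open>c 1\<close> is central in
  \<open>A\<close>.\<close>

lemma lact_map_linear: "a \<in> carrier A \<Longrightarrow> lact M a \<in> linear_maps k M M"
proof (rule linear_mapsI)
  fix c x assume a: "a \<in> carrier A" and c: "c \<in> carrier k" and x: "x \<in> carrier M"
  have "lact M a (c \<odot>\<^bsub>M\<^esub> x) = lact M a (lact M (c \<odot>\<^bsub>A\<^esub> \<one>\<^bsub>A\<^esub>) x)"
    using c x by (simp add: lact_smult lact_one)
  also have "\<dots> = lact M (a \<otimes>\<^bsub>A\<^esub> (c \<odot>\<^bsub>A\<^esub> \<one>\<^bsub>A\<^esub>)) x" using a c x by (simp add: lact_assoc)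
  also have "\<dots> = c \<odot>\<^bsub>M\<^esub> lact M a x" using a c x by (simp add: smult_mult_right lact_smult)
  finally show "lact M a (c \<odot>\<^bsub>M\<^esub> x) = c \<odot>\<^bsub>M\<^esub> lact M a x" .
qed (auto simp: lact_closed lact_add_right)

lemma ract_map_linear: "a \<in> carrier A \<Longrightarrow> (\<lambda>x. ract M x a) \<in> linear_maps k M M"
proof (rule linear_mapsI)
  fix c x assume a: "a \<in> carrier A" and c: "c \<in> carrier k" and x: "x \<in> carrier M"
  have "ract M (c \<odot>\<^bsub>M\<^esub> x) a = ract M (ract M x (c \<odot>\<^bsub>A\<^esub> \<one>\<^bsub>A\<^esub>)) a"
    using c x by (simp add: ract_smult ract_one)
  also have "\<dots> = ract M x ((c \<odot>\<^bsub>A\<^esub> \<one>\<^bsub>A\<^esub>) \<otimes>\<^bsub>A\<^esub> a)" using a c x by (simp add: ract_assoc)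
  also have "\<dots> = c \<odot>\<^bsub>M\<^esub> ract M x a" using a c x by (simp add: smult_mult_left ract_smult)
  finally show "ract M (c \<odot>\<^bsub>M\<^esub> x) a = c \<odot>\<^bsub>M\<^esub> ract M x a" .
qed (auto simp: ract_closed ract_add_left)

lemma lact_arg_linear: "x \<in> carrier M \<Longrightarrow> (\<lambda>a. lact M a x) \<in> linear_maps k A M"
  by (rule linear_mapsI) (auto simp: lact_closed lact_add_left lact_smult)

end

context sub_bimodule
begin

interpretation abelian_subgroup N M
  by (intro abelian_subgroupI3 Sub.additive_subgroup_axioms Bim.abelian_group_axioms)

abbreviation Q where "Q \<equiv> quotient_bimod M N"
abbreviation proj where "proj x \<equiv> N +>\<^bsub>M\<^esub> x"

lemma N_subset: "N \<subseteq> carrier M" by (rule Sub.a_subset)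

lemma Q_fields [simp]:
  "\<zero>\<^bsub>Q\<^esub> = N" "ring.add Q = set_add M" "carrier Q = a_rcosets\<^bsub>M\<^esub> N"
  by (simp_all add: quotient_bimod_def)

lemma proj_closed: "x \<in> carrier M \<Longrightarrow> proj x \<in> carrier Q"
  using N_subset by (simp add: Bim.a_rcosetsI)

lemma Q_cases: assumes "X \<in> carrier Q" obtains x where "x \<in> carrier M" "X = proj x"
  using assms by (auto simp: A_RCOSETS_def')

lemma proj_add: "\<lbrakk>x \<in> carrier M; y \<in> carrier M\<rbrakk> \<Longrightarrow> proj x \<oplus>\<^bsub>Q\<^esub> proj y = proj (x \<oplus>\<^bsub>M\<^esub> y)"
  by (simp add: a_rcos_sum)

lemma proj_zero_iff: "x \<in> carrier M \<Longrightarrow> proj x = N \<longleftrightarrow> x \<in> N"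
  using Bim.a_coset_join1[OF _ _ Sub.a_subgroup] Bim.a_coset_join2[OF _ Sub.a_subgroup] by blast

text \<open>A linear map preserving \<open>N\<close> sends a coset into a single coset, so the union
  defining each operation of the quotient collapses to one member.\<close>

lemma Union_proj:
  assumes g: "g \<in> linear_maps k M M" and gN: "\<And>x. x \<in> N \<Longrightarrow> g x \<in> N" and x: "x \<in> carrier M"
  shows "(\<Union>y\<in>proj x. proj (g y)) = proj (g x)"
proof -
  have "proj (g y) = proj (g x)" if "y \<in> proj x" for y
  proof -
    have "y \<in> (\<Union>n\<in>N. {n \<oplus>\<^bsub>M\<^esub> x})" using \<open>y \<in> proj x\<close> by (simp only: a_r_coset_def')
    then obtain n where n: "n \<in> N" "y = n \<oplus>\<^bsub>M\<^esub> x" by auto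
    then have "n \<in> carrier M" using N_subset by blast
    then have "g y = g n \<oplus>\<^bsub>M\<^esub> g x" using n x by (simp add: linear_maps_add[OF g])
    then have "g y \<in> proj (g x)"
      using Bim.a_rcosI[OF gN[OF n(1)] N_subset linear_maps_closed[OF g x]] by simp
    then show ?thesis
      using Bim.a_repr_independence[OF _ linear_maps_closed[OF g x] Sub.a_subgroup] by blast
  qed
  moreover have "x \<in> proj x" by (rule a_rcos_self[OF x])
  ultimately show ?thesis by blast
qed

lemma smult_linear: "c \<in> carrier k \<Longrightarrow> (\<lambda>x. c \<odot>\<^bsub>M\<^esub> x) \<in> linear_maps k M M"
  by (rule linear_mapsI) (auto simp: Bim.smult_r_distr Bim.smult_assoc1[symmetric] m_comm)

text \<open>Closure under scalars is no axiom of \<open>sub_bimodule\<close>; it follows from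
  closure under the left action of \<open>c 1\<close>.\<close>

lemma sub_smult: "\<lbrakk>c \<in> carrier k; x \<in> N\<rbrakk> \<Longrightarrow> c \<odot>\<^bsub>M\<^esub> x \<in> N"
  using sub_lact[of "c \<odot>\<^bsub>A\<^esub> \<one>\<^bsub>A\<^esub>" x] N_subset by (auto simp: lact_smult lact_one subset_iff)

lemma proj_smult: "\<lbrakk>c \<in> carrier k; x \<in> carrier M\<rbrakk> \<Longrightarrow> c \<odot>\<^bsub>Q\<^esub> proj x = proj (c \<odot>\<^bsub>M\<^esub> x)"
  by (simp add: quotient_bimod_def Union_proj[OF smult_linear] sub_smult)

lemma proj_lact: "\<lbrakk>a \<in> carrier A; x \<in> carrier M\<rbrakk> \<Longrightarrow> lact Q a (proj x) = proj (lact M a x)"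
  by (simp add: quotient_bimod_def Union_proj[OF lact_map_linear] sub_lact)

lemma proj_ract: "\<lbrakk>a \<in> carrier A; x \<in> carrier M\<rbrakk> \<Longrightarrow> ract Q (proj x) a = proj (ract M x a)"
  by (simp add: quotient_bimod_def Union_proj[OF ract_map_linear] sub_ract)

lemma Q_abelian_group: "abelian_group Q"
proof (rule abelian_groupI)
  show "\<zero>\<^bsub>Q\<^esub> \<in> carrier Q"
    using proj_closed[of "\<zero>\<^bsub>M\<^esub>"] N_subset by simp
next
  fix X assume "X \<in> carrier Q"
  then obtain x where x: "x \<in> carrier M" "X = proj x" by (rule Q_cases)
  then show "\<zero>\<^bsub>Q\<^esub> \<oplus>\<^bsub>Q\<^esub> X = X"
    using proj_add[of "\<zero>\<^bsub>M\<^esub>" x] N_subset by (simp del: Q_fields(2))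
  show "\<exists>Y\<in>carrier Q. Y \<oplus>\<^bsub>Q\<^esub> X = \<zero>\<^bsub>Q\<^esub>"
    using x N_subset proj_closed[of "\<ominus>\<^bsub>M\<^esub> x"]
    by (intro bexI[of _ "proj (\<ominus>\<^bsub>M\<^esub> x)"]) (simp_all add: proj_add Bim.l_neg del: Q_fields(2,3))
next
  fix X Y assume "X \<in> carrier Q" "Y \<in> carrier Q"
  then obtain x y where x: "x \<in> carrier M" "X = proj x" and y: "y \<in> carrier M" "Y = proj y" by (meson Q_cases)
  show "X \<oplus>\<^bsub>Q\<^esub> Y \<in> carrier Q" "X \<oplus>\<^bsub>Q\<^esub> Y = Y \<oplus>\<^bsub>Q\<^esub> X"
    using x y proj_closed[of "x \<oplus>\<^bsub>M\<^esub> y"] by (simp_all add: proj_add Bim.a_comm del: Q_fields(2,3))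
  fix Z assume "Z \<in> carrier Q"
  then obtain z where z: "z \<in> carrier M" "Z = proj z" by (meson Q_cases)
  show "X \<oplus>\<^bsub>Q\<^esub> Y \<oplus>\<^bsub>Q\<^esub> Z = X \<oplus>\<^bsub>Q\<^esub> (Y \<oplus>\<^bsub>Q\<^esub> Z)"
    using x y z by (simp add: proj_add Bim.a_assoc del: Q_fields(2,3))
qed

lemma Q_module: "module k Q"
proof (rule moduleI[OF is_cring Q_abelian_group])
  fix a b X assume a: "a \<in> carrier k" "b \<in> carrier k" and "X \<in> carrier Q"
  from this(3) obtain x where x: "x \<in> carrier M" "X = proj x" by (rule Q_cases)
  show "a \<odot>\<^bsub>Q\<^esub> X \<in> carrier Q" using x a proj_closed by (simp add: proj_smult del: Q_fields)
  show "(a \<oplus>\<^bsub>k\<^esub> b) \<odot>\<^bsub>Q\<^esub> X = a \<odot>\<^bsub>Q\<^esub> X \<oplus>\<^bsub>Q\<^esub> b \<odot>\<^bsub>Q\<^esub> X"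
    using a x by (simp add: proj_smult proj_add Bim.smult_l_distr del: Q_fields)
  show "(a \<otimes>\<^bsub>k\<^esub> b) \<odot>\<^bsub>Q\<^esub> X = a \<odot>\<^bsub>Q\<^esub> (b \<odot>\<^bsub>Q\<^esub> X)"
    using a x by (simp add: proj_smult Bim.smult_assoc1 del: Q_fields)
next
  fix a X Y assume a: "a \<in> carrier k" and "X \<in> carrier Q" "Y \<in> carrier Q"
  then obtain x y where x: "x \<in> carrier M" "X = proj x" and y: "y \<in> carrier M" "Y = proj y" by (meson Q_cases)
  then show "a \<odot>\<^bsub>Q\<^esub> (X \<oplus>\<^bsub>Q\<^esub> Y) = a \<odot>\<^bsub>Q\<^esub> X \<oplus>\<^bsub>Q\<^esub> a \<odot>\<^bsub>Q\<^esub> Y"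
    using a by (simp add: proj_smult proj_add Bim.smult_r_distr del: Q_fields)
next
  fix X assume "X \<in> carrier Q"
  then obtain x where "x \<in> carrier M" "X = proj x" by (rule Q_cases)
  then show "\<one>\<^bsub>k\<^esub> \<odot>\<^bsub>Q\<^esub> X = X" by (simp add: proj_smult)
qed

lemma proj_linear: "(\<lambda>x. proj x) \<in> linear_maps k M Q"
  by (rule linear_mapsI) (auto simp: proj_closed proj_smult proj_add simp del: Q_fields)

lemma Q_bimodule: "bimodule k A Q"
proof (intro bimodule.intro bimodule_axioms.intro assoc_algebra_axioms Q_module)
  note [simp del] = Q_fields
  note [simp] = proj_closed proj_smult proj_add proj_lact proj_ract lact_closed ract_closed
  fix X assume "X \<in> carrier Q"
  then obtain x where x: "x \<in> carrier M" "X = proj x" by (rule Q_cases)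
  show "lact Q \<one>\<^bsub>A\<^esub> X = X" "ract Q X \<one>\<^bsub>A\<^esub> = X" using x by (auto simp: lact_one ract_one)
  fix a b assume a: "a \<in> carrier A"
  show "lact Q a X \<in> carrier Q" "ract Q X a \<in> carrier Q" using a x by auto
  show "lact Q (c \<odot>\<^bsub>A\<^esub> a) X = c \<odot>\<^bsub>Q\<^esub> lact Q a X" "ract Q X (c \<odot>\<^bsub>A\<^esub> a) = c \<odot>\<^bsub>Q\<^esub> ract Q X a"
    if "c \<in> carrier k" for c
    using that a x by (auto simp: lact_smult ract_smult)
  show "lact Q a (X \<oplus>\<^bsub>Q\<^esub> Y) = lact Q a X \<oplus>\<^bsub>Q\<^esub> lact Q a Y"
    "ract Q (X \<oplus>\<^bsub>Q\<^esub> Y) a = ract Q X a \<oplus>\<^bsub>Q\<^esub> ract Q Y a" if "Y \<in> carrier Q" for Y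
    using a x that by (auto elim!: Q_cases simp: lact_add_right ract_add_left)
  assume b: "b \<in> carrier A"
  show "lact Q (a \<oplus>\<^bsub>A\<^esub> b) X = lact Q a X \<oplus>\<^bsub>Q\<^esub> lact Q b X"
    "ract Q X (a \<oplus>\<^bsub>A\<^esub> b) = ract Q X a \<oplus>\<^bsub>Q\<^esub> ract Q X b"
    "lact Q (a \<otimes>\<^bsub>A\<^esub> b) X = lact Q a (lact Q b X)"
    "ract Q X (a \<otimes>\<^bsub>A\<^esub> b) = ract Q (ract Q X a) b"
    "ract Q (lact Q a X) b = lact Q a (ract Q X b)"
    using a b x by (auto simp: lact_add_left ract_add_right lact_assoc ract_assoc lact_ract)
qed

lemma Q_fodc:
  assumes "fodc k A M d"
  shows "fodc k A Q (\<lambda>b. proj (d b))"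
proof -
  interpret d: fodc k A M d by fact
  have cl: "d b \<in> carrier M" if "b \<in> carrier A" for b using linear_maps_closed[OF d.d_linear that] .
  show ?thesis
  proof (intro fodc.intro fodc_axioms.intro Q_bimodule linear_maps_comp[OF proj_linear d.d_linear])
    fix a b assume "a \<in> carrier A" "b \<in> carrier A"
    then show "proj (d (a \<otimes>\<^bsub>A\<^esub> b)) = ract Q (proj (d a)) b \<oplus>\<^bsub>Q\<^esub> lact Q a (proj (d b))"
      by (simp add: d.leibniz proj_ract proj_lact proj_add cl lact_closed ract_closed del: Q_fields)
  next
    fix X assume "X \<in> carrier Q"
    then obtain x where x: "x \<in> carrier M" "X = proj x" by (rule Q_cases)
    obtain n :: nat and a b where ab: "a \<in> {..<n} \<rightarrow> carrier A" "b \<in> {..<n} \<rightarrow> carrier A"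
      "x = (\<Oplus>\<^bsub>M\<^esub>j\<in>{..<n}. lact M (a j) (d (b j)))"
      using d.generated[OF x(1)] by blast
    have "X = (\<Oplus>\<^bsub>Q\<^esub>j\<in>{..<n}. proj (lact M (a j) (d (b j))))"
      unfolding x(2) ab(3)
      by (rule linear_maps_finsum[OF proj_linear Bim.module_axioms Q_module])
         (use ab in \<open>auto intro!: lact_closed cl\<close>)
    also have "\<dots> = (\<Oplus>\<^bsub>Q\<^esub>j\<in>{..<n}. lact Q (a j) (proj (d (b j))))"
      using ab(1,2) proj_closed
      by (intro abelian_monoid.finsum_cong'[OF abelian_group.axioms(1)[OF Q_abelian_group]])
         (auto simp: proj_lact cl Pi_iff lact_closed simp del: Q_fields)
    finally show "\<exists>(n::nat) a b. a \<in> {..<n} \<rightarrow> carrier A \<and> b \<in> {..<n} \<rightarrow> carrier A \<and>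
        X = (\<Oplus>\<^bsub>Q\<^esub>j\<in>{..<n}. lact Q (a j) (proj (d (b j))))"
      using ab(1,2) by blast
  qed
qed

end

context fodc
begin

text \<open>The map \<open>a \<otimes> b \<mapsto> a db\<close>, on the whole of \<open>A \<otimes> A\<close>.\<close>

definition eval_form where "eval_form = tensor_lift M (\<lambda>a b. lact M a (d b))"

lemma d_closed: "b \<in> carrier A \<Longrightarrow> d b \<in> carrier M"
  by (rule linear_maps_closed[OF d_linear])

lemma M_module: "module k M" by (rule Bim.module_axioms)

lemma eval_bilinear: "(\<lambda>a b. lact M a (d b)) \<in> bilinear_maps k A A M"
  by (intro bilinear_mapsI linear_maps_comp[OF lact_map_linear d_linear] lact_arg_linear d_closed)

lemma eval_form_linear: "eval_form \<in> linear_maps k T M"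
  unfolding eval_form_def by (rule tensor_lift_linear[OF A_module A_module M_module eval_bilinear])

lemma eval_form_pure: "\<lbrakk>a \<in> carrier A; b \<in> carrier A\<rbrakk> \<Longrightarrow> eval_form (tens a b) = lact M a (d b)"
  unfolding eval_form_def by (rule tensor_lift_pure[OF A_module A_module M_module eval_bilinear])

lemmas eval_form_closed = linear_maps_closed[OF eval_form_linear]

lemma d_one: "d \<one>\<^bsub>A\<^esub> = \<zero>\<^bsub>M\<^esub>"
proof -
  have "d \<one>\<^bsub>A\<^esub> = d \<one>\<^bsub>A\<^esub> \<oplus>\<^bsub>M\<^esub> d \<one>\<^bsub>A\<^esub>"
    using leibniz[of "\<one>\<^bsub>A\<^esub>" "\<one>\<^bsub>A\<^esub>"] d_closed[of "\<one>\<^bsub>A\<^esub>"] by (simp add: lact_one ract_one)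
  then show ?thesis using d_closed[of "\<one>\<^bsub>A\<^esub>"] by simp
qed

lemma lact_zero: "a \<in> carrier A \<Longrightarrow> lact M a \<zero>\<^bsub>M\<^esub> = \<zero>\<^bsub>M\<^esub>"
  by (rule linear_maps_zero[OF lact_map_linear M_module M_module])

lemma eval_form_lact:
  assumes "c \<in> carrier A" "q \<in> carrier T"
  shows "eval_form (lact U c q) = lact M c (eval_form q)"
  by (rule tensor_ext[OF linear_maps_comp[OF eval_form_linear lact_linear[OF assms(1)]]
        linear_maps_comp[OF lact_map_linear[OF assms(1)] eval_form_linear] _ assms(2)])
     (simp add: assms lact_pure eval_form_pure lact_assoc d_closed)

text \<open>By the Leibniz rule \<open>a d(bc) = (a db) c + ab dc\<close>. The defect is
  \<open>m(q) dc\<close>, so the evaluation respects the right action once it is restricted to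
  tensors of product zero.\<close>

lemma eval_form_ract:
  assumes "c \<in> carrier A" "q \<in> carrier T"
  shows "eval_form (ract U q c) = ract M (eval_form q) c \<oplus>\<^bsub>M\<^esub> lact M (mult_map A q) (d c)"
  by (rule tensor_ext[OF linear_maps_comp[OF eval_form_linear ract_linear[OF assms(1)]]
        linear_maps_add_fun[OF M_module linear_maps_comp[OF ract_map_linear[OF assms(1)] eval_form_linear]
          linear_maps_comp[OF lact_arg_linear[OF d_closed[OF assms(1)]] mult_map_linear]] _ assms(2)])
     (simp add: assms ract_pure eval_form_pure mult_map_pure lact_assoc d_closed leibniz lact_add_right lact_ract
        lact_closed ract_closed)

lemma eval_form_universal_d: "b \<in> carrier A \<Longrightarrow> eval_form (universal_d k A b) = d b"
  unfolding universal_d_def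
  by (subst linear_maps_minus[OF eval_form_linear AA.T_module M_module])
     (auto simp: AA.pure_closed eval_form_pure d_one lact_one lact_zero d_closed Bim.minus_zero_right)

lemma eval_form_finsum:
  assumes "a \<in> {..<n::nat} \<rightarrow> carrier A" "b \<in> {..<n} \<rightarrow> carrier A"
  shows "eval_form (\<Oplus>\<^bsub>T\<^esub>j\<in>{..<n}. tens (a j) (b j)) = (\<Oplus>\<^bsub>M\<^esub>j\<in>{..<n}. lact M (a j) (d (b j)))"
proof -
  have "eval_form (\<Oplus>\<^bsub>T\<^esub>j\<in>{..<n}. tens (a j) (b j))
      = (\<Oplus>\<^bsub>M\<^esub>j\<in>{..<n}. eval_form (tens (a j) (b j)))"
    by (rule linear_maps_finsum[OF eval_form_linear AA.T_module M_module])
       (use assms in \<open>auto intro!: AA.pure_closed\<close>)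
  also have "\<dots> = (\<Oplus>\<^bsub>M\<^esub>j\<in>{..<n}. lact M (a j) (d (b j)))"
    using assms by (intro Bim.finsum_cong') (auto simp: Pi_iff eval_form_pure lact_closed d_closed)
  finally show ?thesis .
qed

lemma universal_part:
  assumes "q \<in> carrier T"
  shows "q \<ominus>\<^bsub>T\<^esub> tens (mult_map A q) \<one>\<^bsub>A\<^esub> \<in> carrier U"
    and "eval_form (q \<ominus>\<^bsub>T\<^esub> tens (mult_map A q) \<one>\<^bsub>A\<^esub>) = eval_form q"
proof -
  have c: "mult_map A q \<in> carrier A" "tens (mult_map A q) \<one>\<^bsub>A\<^esub> \<in> carrier T"
    using mult_map_closed[OF assms] by (auto intro: AA.pure_closed)
  show "q \<ominus>\<^bsub>T\<^esub> tens (mult_map A q) \<one>\<^bsub>A\<^esub> \<in> carrier U"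
    by (rule linear_maps_closed[OF universal_part_linear assms])
  show "eval_form (q \<ominus>\<^bsub>T\<^esub> tens (mult_map A q) \<one>\<^bsub>A\<^esub>) = eval_form q"
    using assms c eval_form_closed[OF assms]
    by (simp add: linear_maps_minus[OF eval_form_linear AA.T_module M_module] eval_form_pure d_one lact_zero Bim.minus_zero_right)
qed

lemma eval_form_surj:
  assumes "x \<in> carrier M"
  obtains q where "q \<in> carrier U" "eval_form q = x"
proof -
  obtain n :: nat and a b where ab: "a \<in> {..<n} \<rightarrow> carrier A" "b \<in> {..<n} \<rightarrow> carrier A"
    "x = (\<Oplus>\<^bsub>M\<^esub>j\<in>{..<n}. lact M (a j) (d (b j)))"
    using generated[OF assms] by blast
  let ?q = "\<Oplus>\<^bsub>T\<^esub>j\<in>{..<n}. tens (a j) (b j)"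
  have "?q \<in> carrier T" using ab by (intro AA.T.finsum_closed) (auto intro!: AA.pure_closed)
  from universal_part[OF this] that show thesis using eval_form_finsum[OF ab(1,2)] ab(3) by auto
qed

text \<open>The isomorphism sends \<open>x\<close> to its fibre under \<open>eval_form\<close>, which is a coset of \<open>N\<close>.\<close>

lemma isomorphic_quotient:
  assumes "sub_bimodule k A U N"
    and N: "\<And>q. q \<in> carrier U \<Longrightarrow> q \<in> N \<longleftrightarrow> eval_form q = \<zero>\<^bsub>M\<^esub>"
  shows "\<exists>i \<in> bimodule_isos A M (quotient_bimod U N).
    \<forall>b\<in>carrier A. i (d b) = N +>\<^bsub>U\<^esub> universal_d k A b"
proof -
  interpret S: sub_bimodule k A U N by fact
  have ev: "eval_form q \<in> carrier M" if "q \<in> carrier U" for q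
    using that eval_form_closed by (auto simp: carrier_U)
  have evadd: "eval_form (q \<oplus>\<^bsub>U\<^esub> q') = eval_form q \<oplus>\<^bsub>M\<^esub> eval_form q'"
    if "q \<in> carrier U" "q' \<in> carrier U" for q q'
    using that by (auto simp: carrier_U linear_maps_add[OF eval_form_linear])
  have evminus: "eval_form (q \<ominus>\<^bsub>U\<^esub> q') = eval_form q \<ominus>\<^bsub>M\<^esub> eval_form q'"
    if "q \<in> carrier U" "q' \<in> carrier U" for q q'
    using that by (auto simp: carrier_U a_minus_U linear_maps_minus[OF eval_form_linear AA.T_module M_module])
  define i where "i x = {q \<in> carrier U. eval_form q = x}" for x
  have i: "i (eval_form q) = S.proj q" if q: "q \<in> carrier U" for q
  proof (intro Set.set_eqI iffI)
    fix p assume "p \<in> i (eval_form q)"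
    then have p: "p \<in> carrier U" "eval_form p = eval_form q" by (auto simp: i_def)
    then have "p \<ominus>\<^bsub>U\<^esub> q \<in> N"
      using q N[of "p \<ominus>\<^bsub>U\<^esub> q"] evminus[OF p(1) q] ev by (simp add: Bim.minus_eq_zero_iff)
    moreover have "p = (p \<ominus>\<^bsub>U\<^esub> q) \<oplus>\<^bsub>U\<^esub> q"
      using p q by (simp add: a_minus_def S.Bim.a_assoc S.Bim.l_neg del: U_fields)
    ultimately show "p \<in> S.proj q" unfolding a_r_coset_def' by blast
  next
    fix p assume "p \<in> S.proj q"
    then have "p \<in> (\<Union>n\<in>N. {n \<oplus>\<^bsub>U\<^esub> q})" by (simp only: a_r_coset_def')
    then obtain n where n: "n \<in> N" "p = n \<oplus>\<^bsub>U\<^esub> q" by auto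
    then have nU: "n \<in> carrier U" using S.N_subset by blast
    then show "p \<in> i (eval_form q)"
      using n q N[OF nU] ev evadd[OF nU q] S.Bim.a_closed[OF nU q] by (simp add: i_def)
  qed
  have cl: "i x \<in> carrier S.Q" if "x \<in> carrier M" for x
    using eval_form_surj[OF that] i S.proj_closed by metis
  have "i \<in> iso (add_monoid M) (add_monoid S.Q)"
    unfolding iso_def
  proof (intro CollectI conjI homI bij_betw_imageI)
    fix x y assume "x \<in> carrier (add_monoid M)" "y \<in> carrier (add_monoid M)"
    then obtain p q where "p \<in> carrier U" "eval_form p = x" "q \<in> carrier U" "eval_form q = y"
      by (metis eval_form_surj partial_object.select_convs(1))
    then show "i (x \<otimes>\<^bsub>add_monoid M\<^esub> y) = i x \<otimes>\<^bsub>add_monoid S.Q\<^esub> i y"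
      using i[of p] i[of q] i[of "p \<oplus>\<^bsub>U\<^esub> q"] evadd[of p q] S.proj_add[of p q] S.Bim.a_closed[of p q]
      by (simp del: S.Q_fields U_fields)
  next
    show "inj_on i (carrier (add_monoid M))"
    proof (rule inj_onI)
      fix x y assume "x \<in> carrier (add_monoid M)" and eq: "i x = i y"
      then obtain p where "p \<in> carrier U" "eval_form p = x" by (metis eval_form_surj partial_object.select_convs(1))
      then have "p \<in> i x" by (simp add: i_def)
      with eq have "p \<in> i y" by simp
      then show "x = y" using \<open>eval_form p = x\<close> by (simp add: i_def)
    qed
    show "i ` carrier (add_monoid M) = carrier (add_monoid S.Q)"
    proof (intro equalityI subsetI)
      fix X assume "X \<in> carrier (add_monoid S.Q)"
      then have "X \<in> carrier S.Q" by simp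
      then obtain q where "q \<in> carrier U" "X = S.proj q" by (rule S.Q_cases)
      then show "X \<in> i ` carrier (add_monoid M)" using i ev by (intro image_eqI[of _ _ "eval_form q"]) auto
    qed (use cl in auto)
  qed (use cl in auto)
  moreover have "i (lact M a x) = lact S.Q a (i x) \<and> i (ract M x a) = ract S.Q (i x) a"
    if a: "a \<in> carrier A" and x: "x \<in> carrier M" for a x
  proof -
    obtain q where q: "q \<in> carrier U" "eval_form q = x" using eval_form_surj[OF x] .
    then have q': "q \<in> carrier T" "mult_map A q = \<zero>\<^bsub>A\<^esub>" by (auto simp: carrier_U)
    \<comment> \<open>Needed for the right action: with \<open>m(q) = 0\<close> the Leibniz defect
      becomes \<open>0 da\<close>.\<close>
    have z: "lact M \<zero>\<^bsub>A\<^esub> (d a) = \<zero>\<^bsub>M\<^esub>"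
      by (rule linear_maps_zero[OF lact_arg_linear[OF d_closed[OF a]] A_module M_module])
    show ?thesis
      using a q q' i[OF q(1)] i[OF S.lact_closed[OF a q(1)]] i[OF S.ract_closed[OF a q(1)]] ract_closed[OF a x]
      by (simp add: eval_form_lact eval_form_ract S.proj_lact S.proj_ract z del: S.Q_fields)
  qed
  ultimately have "i \<in> bimodule_isos A M S.Q" by (auto simp: bimodule_isos_def)
  moreover have "i (d b) = S.proj (universal_d k A b)" if "b \<in> carrier A" for b
    using i[OF universal_d_closed[OF that]] eval_form_universal_d[OF that] by simp
  ultimately show ?thesis by blast
qed

end

section \<open>Sweedler calculus in a Hopf group coalgebra\<close>

context hopf_group_coalgebra
begin

abbreviation AT where "AT \<alpha> \<beta> \<equiv> tensor_module k (A \<alpha>) (A \<beta>)"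
text \<open>In Sweedler notation, \<open>sw M \<alpha> \<beta> \<phi> x\<close> is the sum of the \<open>\<phi> x\<^sub>1 x\<^sub>2\<close> with \<open>\<Delta> \<alpha> \<beta> x = x\<^sub>1 \<otimes> x\<^sub>2\<close>.\<close>

abbreviation pt where "pt \<alpha> \<beta> \<equiv> pure_tensor k (A \<alpha>) (A \<beta>)"
abbreviation sw where "sw M \<alpha> \<beta> \<phi> x \<equiv> tensor_lift M \<phi> (\<Delta> \<alpha> \<beta> x)"

section \<open>Sweedler sums as lifts along the comultiplication\<close>

lemma alg_module: "\<alpha> \<in> carrier \<pi> \<Longrightarrow> module k (A \<alpha>)"
  by (rule assoc_algebra_module[OF algebras])

lemma alg_ring: "\<alpha> \<in> carrier \<pi> \<Longrightarrow> ring (A \<alpha>)"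
  using algebras by (simp add: assoc_algebra_def)

lemma AT_module: "\<lbrakk>\<alpha> \<in> carrier \<pi>; \<beta> \<in> carrier \<pi>\<rbrakk> \<Longrightarrow> module k (AT \<alpha> \<beta>)"
  by (intro tensor_module_module alg_module)

lemma tensor_algebra_fields [simp]:
  "carrier (tensor_algebra k V W) = carrier (tensor_module k V W)"
  "ring.add (tensor_algebra k V W) = ring.add (tensor_module k V W)"
  "module.smult (tensor_algebra k V W) = module.smult (tensor_module k V W)"
  "monoid.mult (tensor_algebra k V W) = tensor_bimap k V W (monoid.mult V) (monoid.mult W)"
  "\<one>\<^bsub>tensor_algebra k V W\<^esub> = pure_tensor k V W \<one>\<^bsub>V\<^esub> \<one>\<^bsub>W\<^esub>"
  by (simp_all add: tensor_algebra_def)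

lemma comult_linear': "\<lbrakk>\<alpha> \<in> carrier \<pi>; \<beta> \<in> carrier \<pi>\<rbrakk> \<Longrightarrow> \<Delta> \<alpha> \<beta> \<in> linear_maps k (A (\<alpha> \<otimes> \<beta>)) (AT \<alpha> \<beta>)"
  using comult_linear[of \<alpha> \<beta>] by (simp add: linear_maps_def)

lemma comult_closed: "\<lbrakk>\<alpha> \<in> carrier \<pi>; \<beta> \<in> carrier \<pi>; x \<in> carrier (A (\<alpha> \<otimes> \<beta>))\<rbrakk> \<Longrightarrow> \<Delta> \<alpha> \<beta> x \<in> carrier (AT \<alpha> \<beta>)"
  by (rule linear_maps_closed[OF comult_linear'])

lemma comult_one: "\<lbrakk>\<alpha> \<in> carrier \<pi>; \<beta> \<in> carrier \<pi>\<rbrakk>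
    \<Longrightarrow> \<Delta> \<alpha> \<beta> \<one>\<^bsub>A (\<alpha> \<otimes> \<beta>)\<^esub> = pt \<alpha> \<beta> \<one>\<^bsub>A \<alpha>\<^esub> \<one>\<^bsub>A \<beta>\<^esub>"
  using ring_hom_one[OF comult_ring_hom[of \<alpha> \<beta>]] by simp

lemma comult_mult: "\<lbrakk>\<alpha> \<in> carrier \<pi>; \<beta> \<in> carrier \<pi>; x \<in> carrier (A (\<alpha> \<otimes> \<beta>)); y \<in> carrier (A (\<alpha> \<otimes> \<beta>))\<rbrakk>
    \<Longrightarrow> \<Delta> \<alpha> \<beta> (x \<otimes>\<^bsub>A (\<alpha> \<otimes> \<beta>)\<^esub> y)
      = tensor_bimap k (A \<alpha>) (A \<beta>) (monoid.mult (A \<alpha>)) (monoid.mult (A \<beta>)) (\<Delta> \<alpha> \<beta> x) (\<Delta> \<alpha> \<beta> y)"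
  using ring_hom_mult[OF comult_ring_hom[of \<alpha> \<beta>]] by simp

lemma sw_linear:
  "\<lbrakk>module k M; \<alpha> \<in> carrier \<pi>; \<beta> \<in> carrier \<pi>; \<phi> \<in> bilinear_maps k (A \<alpha>) (A \<beta>) M; f \<in> linear_maps k V (A (\<alpha> \<otimes> \<beta>))\<rbrakk>
    \<Longrightarrow> (\<lambda>x. sw M \<alpha> \<beta> \<phi> (f x)) \<in> linear_maps k V M"
  by (rule linear_maps_tensor_lift_arg[OF alg_module alg_module _ _ linear_maps_comp[OF comult_linear']])

lemma sw_linear_param:
  "\<lbrakk>module k M; \<alpha> \<in> carrier \<pi>; \<beta> \<in> carrier \<pi>; x \<in> carrier (A (\<alpha> \<otimes> \<beta>)); module k V;
    \<And>v. v \<in> carrier V \<Longrightarrow> \<phi> v \<in> bilinear_maps k (A \<alpha>) (A \<beta>) M;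
    \<And>a b. \<lbrakk>a \<in> carrier (A \<alpha>); b \<in> carrier (A \<beta>)\<rbrakk> \<Longrightarrow> (\<lambda>v. \<phi> v a b) \<in> linear_maps k V M\<rbrakk>
    \<Longrightarrow> (\<lambda>v. sw M \<alpha> \<beta> (\<phi> v) x) \<in> linear_maps k V M"
  by (rule linear_maps_tensor_lift_fun[OF alg_module alg_module _ comult_closed])

lemma sw_closed:
  "\<lbrakk>module k M; \<alpha> \<in> carrier \<pi>; \<beta> \<in> carrier \<pi>; \<phi> \<in> bilinear_maps k (A \<alpha>) (A \<beta>) M; x \<in> carrier (A (\<alpha> \<otimes> \<beta>))\<rbrakk>
    \<Longrightarrow> sw M \<alpha> \<beta> \<phi> x \<in> carrier M"
  by (rule tensor_lift_closed[OF alg_module alg_module _ _ comult_closed])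

lemma sw_cong:
  "\<lbrakk>module k M; \<alpha> \<in> carrier \<pi>; \<beta> \<in> carrier \<pi>; x \<in> carrier (A (\<alpha> \<otimes> \<beta>));
    \<And>a b. \<lbrakk>a \<in> carrier (A \<alpha>); b \<in> carrier (A \<beta>)\<rbrakk> \<Longrightarrow> \<phi> a b = \<psi> a b;
    \<And>a b. \<lbrakk>a \<in> carrier (A \<alpha>); b \<in> carrier (A \<beta>)\<rbrakk> \<Longrightarrow> \<psi> a b \<in> carrier M\<rbrakk>
    \<Longrightarrow> sw M \<alpha> \<beta> \<phi> x = sw M \<alpha> \<beta> \<psi> x"
  by (rule tensor_lift_cong[OF alg_module alg_module _ _ _ comult_closed])

lemma linear_sw:
  "\<lbrakk>module k M; module k M'; \<alpha> \<in> carrier \<pi>; \<beta> \<in> carrier \<pi>; f \<in> linear_maps k M M';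
    \<phi> \<in> bilinear_maps k (A \<alpha>) (A \<beta>) M; x \<in> carrier (A (\<alpha> \<otimes> \<beta>))\<rbrakk>
    \<Longrightarrow> f (sw M \<alpha> \<beta> \<phi> x) = sw M' \<alpha> \<beta> (\<lambda>a b. f (\<phi> a b)) x"
  by (rule linear_tensor_lift[OF alg_module alg_module _ _ _ _ comult_closed])

lemma sw_one:
  "\<lbrakk>module k M; \<alpha> \<in> carrier \<pi>; \<beta> \<in> carrier \<pi>; \<phi> \<in> bilinear_maps k (A \<alpha>) (A \<beta>) M\<rbrakk>
    \<Longrightarrow> sw M \<alpha> \<beta> \<phi> \<one>\<^bsub>A (\<alpha> \<otimes> \<beta>)\<^esub> = \<phi> \<one>\<^bsub>A \<alpha>\<^esub> \<one>\<^bsub>A \<beta>\<^esub>"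
  by (simp add: comult_one tensor_lift_pure alg_module alg_ring ring.ring_simprules)

text \<open>Pushing \<open>\<phi>\<close> through both lifts in the product of
  \<open>\<Delta> x\<close> with \<open>t\<close> leaves two nested lifts. With \<open>f\<close> and
  \<open>g\<close> the multiplications this becomes multiplicativity of \<open>\<Delta>\<close> in
  Sweedler form.\<close>

lemma tensor_bimap_sw:
  assumes "module k V" "module k W" "\<alpha> \<in> carrier \<pi>" "\<beta> \<in> carrier \<pi>" "x \<in> carrier (A (\<alpha> \<otimes> \<beta>))"
    and t: "t \<in> carrier (tensor_module k V' W')" and "module k V'" "module k W'" "module k M"
    and \<phi>: "\<phi> \<in> bilinear_maps k V W M"
    and f: "\<And>a. a \<in> carrier (A \<alpha>) \<Longrightarrow> f a \<in> linear_maps k V' V"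
      "\<And>v. v \<in> carrier V' \<Longrightarrow> (\<lambda>a. f a v) \<in> linear_maps k (A \<alpha>) V"
    and g: "\<And>b. b \<in> carrier (A \<beta>) \<Longrightarrow> g b \<in> linear_maps k W' W"
      "\<And>w. w \<in> carrier W' \<Longrightarrow> (\<lambda>b. g b w) \<in> linear_maps k (A \<beta>) W"
  shows "tensor_lift M \<phi> (tensor_bimap k V W f g (\<Delta> \<alpha> \<beta> x) t)
    = sw M \<alpha> \<beta> (\<lambda>a b. tensor_lift M (\<lambda>v w. \<phi> (f a v) (g b w)) t) x"
proof -
  note m = assms(1,2,7-9) tensor_module_module[OF assms(1,2)] alg_module[OF assms(3)] alg_module[OF assms(4)]
  have fc: "f a v \<in> carrier V" if "a \<in> carrier (A \<alpha>)" "v \<in> carrier V'" for a v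
    using linear_maps_closed[OF f(1)] that by blast
  have gc: "g b w \<in> carrier W" if "b \<in> carrier (A \<beta>)" "w \<in> carrier W'" for b w
    using linear_maps_closed[OF g(1)] that by blast
  have b1: "(\<lambda>v w. pure_tensor k V W (f a v) (g b w)) \<in> bilinear_maps k V' W' (tensor_module k V W)"
    if "a \<in> carrier (A \<alpha>)" "b \<in> carrier (A \<beta>)" for a b
    using that by (intro bilinear_mapsI linear_maps_pure_left linear_maps_pure_right f(1) g(1) fc gc m)
  have b2: "(\<lambda>a b. tensor_lift (tensor_module k V W) (\<lambda>v w. pure_tensor k V W (f a v) (g b w)) t)
      \<in> bilinear_maps k (A \<alpha>) (A \<beta>) (tensor_module k V W)"
    by (intro bilinear_mapsI linear_maps_tensor_lift_fun[OF assms(7,8) _ t] m b1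
        linear_maps_pure_left linear_maps_pure_right f(2) g(2) fc gc)
  have lp: "tensor_lift M \<phi> \<in> linear_maps k (tensor_module k V W) M"
    by (intro tensor_lift_linear m \<phi>)
  have b3: "(\<lambda>v w. \<phi> (f a v) (g b w)) \<in> bilinear_maps k V' W' M" if "a \<in> carrier (A \<alpha>)" "b \<in> carrier (A \<beta>)" for a b
    using that by (intro bilinear_mapsI linear_maps_comp[OF bilinear_maps_left[OF \<phi> gc] f(1)]
        linear_maps_comp[OF bilinear_maps_right[OF \<phi> fc] g(1)])
  have "tensor_lift M \<phi> (tensor_bimap k V W f g (\<Delta> \<alpha> \<beta> x) t)
    = sw M \<alpha> \<beta> (\<lambda>a b. tensor_lift M \<phi> (tensor_lift (tensor_module k V W) (\<lambda>v w. pure_tensor k V W (f a v) (g b w)) t)) x"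
    unfolding tensor_bimap_def tensor_map_def
    by (rule linear_sw[OF _ _ assms(3,4) lp b2 assms(5)]) (intro m)+
  also have "\<dots> = sw M \<alpha> \<beta> (\<lambda>a b. tensor_lift M (\<lambda>v w. \<phi> (f a v) (g b w)) t) x"
  proof (rule sw_cong[OF assms(9,3,4,5)])
    fix a b assume ab: "a \<in> carrier (A \<alpha>)" "b \<in> carrier (A \<beta>)"
    show "tensor_lift M (\<lambda>v w. \<phi> (f a v) (g b w)) t \<in> carrier M"
      by (rule tensor_lift_closed[OF assms(7-9) b3[OF ab] t])
    have "tensor_lift M \<phi> (tensor_lift (tensor_module k V W) (\<lambda>v w. pure_tensor k V W (f a v) (g b w)) t)
      = tensor_lift M (\<lambda>v w. tensor_lift M \<phi> (pure_tensor k V W (f a v) (g b w))) t"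
      by (rule linear_tensor_lift[OF assms(7,8) m(6) assms(9) lp b1[OF ab] t])
    also have "\<dots> = tensor_lift M (\<lambda>v w. \<phi> (f a v) (g b w)) t"
      using ab by (intro tensor_lift_cong[OF assms(7,8,9) _ _ t] tensor_lift_pure m \<phi> fc gc
          linear_maps_closed[OF bilinear_maps_left[OF \<phi> gc] fc])
    finally show "tensor_lift M \<phi> (tensor_lift (tensor_module k V W) (\<lambda>v w. pure_tensor k V W (f a v) (g b w)) t)
      = tensor_lift M (\<lambda>v w. \<phi> (f a v) (g b w)) t" .
  qed
  finally show ?thesis .
qed

lemma sw_mult:
  assumes "module k M" "\<alpha> \<in> carrier \<pi>" "\<beta> \<in> carrier \<pi>" "x \<in> carrier (A (\<alpha> \<otimes> \<beta>))" "y \<in> carrier (A (\<alpha> \<otimes> \<beta>))"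
    and \<phi>: "\<phi> \<in> bilinear_maps k (A \<alpha>) (A \<beta>) M"
  shows "sw M \<alpha> \<beta> \<phi> (x \<otimes>\<^bsub>A (\<alpha> \<otimes> \<beta>)\<^esub> y)
    = sw M \<alpha> \<beta> (\<lambda>a b. sw M \<alpha> \<beta> (\<lambda>c d. \<phi> (a \<otimes>\<^bsub>A \<alpha>\<^esub> c) (b \<otimes>\<^bsub>A \<beta>\<^esub> d)) y) x"
  unfolding comult_mult[OF assms(2-5)]
  by (rule tensor_bimap_sw[OF _ _ assms(2-4) comult_closed[OF assms(2,3,5)]])
     (use assms in \<open>auto intro: alg_module linear_maps_mult_left linear_maps_mult_right algebras linear_maps_id
       linear_maps_mult_left[OF algebras, where f = "\<lambda>x. x", simplified]\<close>)

text \<open>The coassociativity axiom is an equation in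
  \<open>A \<alpha> \<otimes> (A \<beta> \<otimes> A \<gamma>)\<close>. Applying to both sides the
  linear map \<open>F\<close> with \<open>F (a \<otimes> (b \<otimes> c)) = \<phi> a b c\<close>
  yields the two iterated sums, for any trilinear \<open>\<phi>\<close>.\<close>

lemma sw_coassoc:
  assumes M: "module k M" and \<alpha>: "\<alpha> \<in> carrier \<pi>" and \<beta>: "\<beta> \<in> carrier \<pi>" and \<gamma>: "\<gamma> \<in> carrier \<pi>"
    and x: "x \<in> carrier (A (\<alpha> \<otimes> \<beta> \<otimes> \<gamma>))"
    and la: "\<And>b c. \<lbrakk>b \<in> carrier (A \<beta>); c \<in> carrier (A \<gamma>)\<rbrakk> \<Longrightarrow> (\<lambda>a. \<phi> a b c) \<in> linear_maps k (A \<alpha>) M"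
    and lb: "\<And>a c. \<lbrakk>a \<in> carrier (A \<alpha>); c \<in> carrier (A \<gamma>)\<rbrakk> \<Longrightarrow> (\<lambda>b. \<phi> a b c) \<in> linear_maps k (A \<beta>) M"
    and lc: "\<And>a b. \<lbrakk>a \<in> carrier (A \<alpha>); b \<in> carrier (A \<beta>)\<rbrakk> \<Longrightarrow> (\<lambda>c. \<phi> a b c) \<in> linear_maps k (A \<gamma>) M"
  shows "sw M (\<alpha> \<otimes> \<beta>) \<gamma> (\<lambda>u c. sw M \<alpha> \<beta> (\<lambda>a b. \<phi> a b c) u) x
    = sw M \<alpha> (\<beta> \<otimes> \<gamma>) (\<lambda>a v. sw M \<beta> \<gamma> (\<lambda>b c. \<phi> a b c) v) x"
proof -
  note m = M alg_module[OF \<alpha>] alg_module[OF \<beta>] alg_module[OF \<gamma>]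
  define T12 where "T12 = AT \<alpha> \<beta>"
  define T23 where "T23 = AT \<beta> \<gamma>"
  define T3 where "T3 = tensor_module k (A \<alpha>) T23"
  have m12: "module k T12" and m23: "module k T23" and m3: "module k T3"
    unfolding T3_def T12_def T23_def by (intro tensor_module_module m)+
  have x': "x \<in> carrier (A (\<alpha> \<otimes> (\<beta> \<otimes> \<gamma>)))" using x \<alpha> \<beta> \<gamma> by (simp add: m_assoc)
  have \<alpha>\<beta>: "\<alpha> \<otimes> \<beta> \<in> carrier \<pi>" and \<beta>\<gamma>: "\<beta> \<otimes> \<gamma> \<in> carrier \<pi>" using \<alpha> \<beta> \<gamma> by auto
  have bc: "(\<lambda>b c. \<phi> a b c) \<in> bilinear_maps k (A \<beta>) (A \<gamma>) M" if "a \<in> carrier (A \<alpha>)" for a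
    using that by (intro bilinear_mapsI lb lc)
  have ab: "(\<lambda>a b. \<phi> a b c) \<in> bilinear_maps k (A \<alpha>) (A \<beta>) M" if "c \<in> carrier (A \<gamma>)" for c
    using that by (intro bilinear_mapsI la lb)
  have cl: "\<phi> a b c \<in> carrier M" if "a \<in> carrier (A \<alpha>)" "b \<in> carrier (A \<beta>)" "c \<in> carrier (A \<gamma>)" for a b c
    using linear_maps_closed[OF la] that by blast
  define F where "F = tensor_lift M (\<lambda>a s. tensor_lift M (\<lambda>b c. \<phi> a b c) s)"
  have bF: "(\<lambda>a s. tensor_lift M (\<lambda>b c. \<phi> a b c) s) \<in> bilinear_maps k (A \<alpha>) T23 M"
    by (intro bilinear_mapsI linear_maps_tensor_lift_fun[OF m(3,4)] m bc la, unfold T23_def)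
       (auto intro: linear_maps_tensor_lift_fun[OF m(3,4)] tensor_lift_linear m bc la)
  have F: "F \<in> linear_maps k T3 M"
    unfolding F_def T3_def by (intro tensor_lift_linear m m23 bF)
  have Fp: "F (pure_tensor k (A \<alpha>) T23 a s) = tensor_lift M (\<lambda>b c. \<phi> a b c) s"
    if "a \<in> carrier (A \<alpha>)" "s \<in> carrier T23" for a s
    unfolding F_def by (intro tensor_lift_pure m m23 bF that)
  have p23: "pt \<beta> \<gamma> b c \<in> carrier T23" if "b \<in> carrier (A \<beta>)" "c \<in> carrier (A \<gamma>)" for b c
    unfolding T23_def by (intro pure_tensor_closed m that)
  have l23: "(\<lambda>b. pt \<beta> \<gamma> b c) \<in> linear_maps k (A \<beta>) T23" if "c \<in> carrier (A \<gamma>)" for c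
    unfolding T23_def by (intro linear_maps_pure_left m that linear_maps_id refl)
  have r23: "(\<lambda>c. pt \<beta> \<gamma> b c) \<in> linear_maps k (A \<gamma>) T23" if "b \<in> carrier (A \<beta>)" for b
    unfolding T23_def by (intro linear_maps_pure_right m that linear_maps_id refl)
  have l3: "(\<lambda>x. pure_tensor k (A \<alpha>) T23 (f x) s) \<in> linear_maps k V T3"
    if "s \<in> carrier T23" "f \<in> linear_maps k V (A \<alpha>)" for s f and V :: "('k, 'z) module"
    unfolding T3_def by (intro linear_maps_pure_left m m23 that)
  have r3: "(\<lambda>x. pure_tensor k (A \<alpha>) T23 a (f x)) \<in> linear_maps k V T3"
    if "a \<in> carrier (A \<alpha>)" "f \<in> linear_maps k V T23" for a f and V :: "('k, 'z) module"
    unfolding T3_def by (intro linear_maps_pure_right m m23 that)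
  let ?as = "\<lambda>t w. tensor_lift T3 (\<lambda>u v. pure_tensor k (A \<alpha>) T23 u (pt \<beta> \<gamma> v w)) t"
  have bas: "(\<lambda>u v. pure_tensor k (A \<alpha>) T23 u (pt \<beta> \<gamma> v w)) \<in> bilinear_maps k (A \<alpha>) (A \<beta>) T3"
    if "w \<in> carrier (A \<gamma>)" for w
    using that by (intro bilinear_mapsI l3 r3 l23 p23 linear_maps_id refl)
  have bas2: "?as \<in> bilinear_maps k T12 (A \<gamma>) T3"
    unfolding T12_def
    by (intro bilinear_mapsI linear_maps_tensor_lift_fun[OF m(2,3)] tensor_lift_linear m m3 bas r3 r23)
  \<comment> \<open>On the left of the axiom \<open>F\<close> comes after reassociation; the
    composite sends \<open>(a \<otimes> b) \<otimes> w\<close> to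
    \<open>\<phi> a b w\<close>.\<close>
  have asp: "F (?as t w) = tensor_lift M (\<lambda>a b. \<phi> a b w) t" if "t \<in> carrier T12" "w \<in> carrier (A \<gamma>)" for t w
  proof -
    have "F (?as t w) = tensor_lift M (\<lambda>u v. F (pure_tensor k (A \<alpha>) T23 u (pt \<beta> \<gamma> v w))) t"
      by (rule linear_tensor_lift[OF m(2,3) m3 M F bas]) (use that in \<open>auto simp: T12_def\<close>)
    also have "\<dots> = tensor_lift M (\<lambda>a b. \<phi> a b w) t"
      by (rule tensor_lift_cong[OF m(2,3) M])
         (use that in \<open>auto simp: T12_def Fp p23 cl tensor_lift_pure[OF m(3,4) M bc]\<close>)
    finally show ?thesis .
  qed
  define as where "as = tensor_lift T3 ?as"
  have las: "as \<in> linear_maps k (tensor_module k T12 (A \<gamma>)) T3"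
    unfolding as_def by (intro tensor_lift_linear m12 m m3 bas2)
  have bd: "(\<lambda>u w. pure_tensor k T12 (A \<gamma>) (\<Delta> \<alpha> \<beta> u) w) \<in> bilinear_maps k (A (\<alpha> \<otimes> \<beta>)) (A \<gamma>) (tensor_module k T12 (A \<gamma>))"
    using comult_linear'[OF \<alpha> \<beta>] comult_closed[OF \<alpha> \<beta>]
    by (intro bilinear_mapsI linear_maps_pure_left linear_maps_pure_right m m12 linear_maps_id refl) (auto simp: T12_def)
  have bd': "(\<lambda>a v. pure_tensor k (A \<alpha>) T23 a (\<Delta> \<beta> \<gamma> v)) \<in> bilinear_maps k (A \<alpha>) (A (\<beta> \<otimes> \<gamma>)) T3"
    using comult_linear'[OF \<beta> \<gamma>] comult_closed[OF \<beta> \<gamma>] unfolding T3_def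
    by (intro bilinear_mapsI linear_maps_pure_left linear_maps_pure_right m m23 linear_maps_id refl) (auto simp: T23_def)
  have "as (sw (tensor_module k T12 (A \<gamma>)) (\<alpha> \<otimes> \<beta>) \<gamma> (\<lambda>u w. pure_tensor k T12 (A \<gamma>) (\<Delta> \<alpha> \<beta> u) w) x)
    = sw T3 \<alpha> (\<beta> \<otimes> \<gamma>) (\<lambda>a v. pure_tensor k (A \<alpha>) T23 a (\<Delta> \<beta> \<gamma> v)) x"
    using coassoc[OF \<alpha> \<beta> \<gamma> x]
    by (simp add: tensor_assoc_def tensor_map_def as_def T3_def T12_def T23_def)
  then have eq: "F (as (sw (tensor_module k T12 (A \<gamma>)) (\<alpha> \<otimes> \<beta>) \<gamma> (\<lambda>u w. pure_tensor k T12 (A \<gamma>) (\<Delta> \<alpha> \<beta> u) w) x))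
    = F (sw T3 \<alpha> (\<beta> \<otimes> \<gamma>) (\<lambda>a v. pure_tensor k (A \<alpha>) T23 a (\<Delta> \<beta> \<gamma> v)) x)" by simp
  have "F (as (sw (tensor_module k T12 (A \<gamma>)) (\<alpha> \<otimes> \<beta>) \<gamma> (\<lambda>u w. pure_tensor k T12 (A \<gamma>) (\<Delta> \<alpha> \<beta> u) w) x))
    = sw M (\<alpha> \<otimes> \<beta>) \<gamma> (\<lambda>u w. F (as (pure_tensor k T12 (A \<gamma>) (\<Delta> \<alpha> \<beta> u) w))) x"
    by (rule linear_sw[OF _ M \<alpha>\<beta> \<gamma> linear_maps_comp[OF F las] bd x]) (intro tensor_module_module m12 m)
  also have "\<dots> = sw M (\<alpha> \<otimes> \<beta>) \<gamma> (\<lambda>u c. sw M \<alpha> \<beta> (\<lambda>a b. \<phi> a b c) u) x"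
  proof (rule sw_cong[OF M \<alpha>\<beta> \<gamma> x])
    fix u c assume u: "u \<in> carrier (A (\<alpha> \<otimes> \<beta>))" "c \<in> carrier (A \<gamma>)"
    show "sw M \<alpha> \<beta> (\<lambda>a b. \<phi> a b c) u \<in> carrier M" by (intro sw_closed M \<alpha> \<beta> ab u)
    have d: "\<Delta> \<alpha> \<beta> u \<in> carrier T12" using comult_closed[OF \<alpha> \<beta> u(1)] by (simp add: T12_def)
    have "as (pure_tensor k T12 (A \<gamma>) (\<Delta> \<alpha> \<beta> u) c) = ?as (\<Delta> \<alpha> \<beta> u) c"
      unfolding as_def by (rule tensor_lift_pure[OF m12 m(4) m3 bas2 d u(2)])
    then show "F (as (pure_tensor k T12 (A \<gamma>) (\<Delta> \<alpha> \<beta> u) c)) = sw M \<alpha> \<beta> (\<lambda>a b. \<phi> a b c) u"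
      using asp[OF d u(2)] by simp
  qed
  moreover have "F (sw T3 \<alpha> (\<beta> \<otimes> \<gamma>) (\<lambda>a v. pure_tensor k (A \<alpha>) T23 a (\<Delta> \<beta> \<gamma> v)) x)
    = sw M \<alpha> (\<beta> \<otimes> \<gamma>) (\<lambda>a v. F (pure_tensor k (A \<alpha>) T23 a (\<Delta> \<beta> \<gamma> v))) x"
    by (rule linear_sw[OF m3 M \<alpha> \<beta>\<gamma> F bd' x'])
  moreover have "\<dots> = sw M \<alpha> (\<beta> \<otimes> \<gamma>) (\<lambda>a v. sw M \<beta> \<gamma> (\<lambda>b c. \<phi> a b c) v) x"
    using comult_closed[OF \<beta> \<gamma>]
    by (intro sw_cong[OF M \<alpha> \<beta>\<gamma> x'] Fp sw_closed M \<beta> \<gamma> bc) (auto simp: T23_def)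
  ultimately show ?thesis using eq by simp
qed

end

context hopf_group_coalgebra
begin

lemma alg_m_closed [simp]:
  "\<lbrakk>\<alpha> \<in> carrier \<pi>; x \<in> carrier (A \<alpha>); y \<in> carrier (A \<alpha>)\<rbrakk> \<Longrightarrow> x \<otimes>\<^bsub>A \<alpha>\<^esub> y \<in> carrier (A \<alpha>)"
  and alg_one_closed [simp]: "\<alpha> \<in> carrier \<pi> \<Longrightarrow> \<one>\<^bsub>A \<alpha>\<^esub> \<in> carrier (A \<alpha>)"
  and alg_l_one [simp]: "\<lbrakk>\<alpha> \<in> carrier \<pi>; x \<in> carrier (A \<alpha>)\<rbrakk> \<Longrightarrow> \<one>\<^bsub>A \<alpha>\<^esub> \<otimes>\<^bsub>A \<alpha>\<^esub> x = x"
  and alg_r_one [simp]: "\<lbrakk>\<alpha> \<in> carrier \<pi>; x \<in> carrier (A \<alpha>)\<rbrakk> \<Longrightarrow> x \<otimes>\<^bsub>A \<alpha>\<^esub> \<one>\<^bsub>A \<alpha>\<^esub> = x"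
  and alg_m_assoc: "\<lbrakk>\<alpha> \<in> carrier \<pi>; x \<in> carrier (A \<alpha>); y \<in> carrier (A \<alpha>); z \<in> carrier (A \<alpha>)\<rbrakk>
    \<Longrightarrow> x \<otimes>\<^bsub>A \<alpha>\<^esub> y \<otimes>\<^bsub>A \<alpha>\<^esub> z = x \<otimes>\<^bsub>A \<alpha>\<^esub> (y \<otimes>\<^bsub>A \<alpha>\<^esub> z)"
  using alg_ring[of \<alpha>] by (simp_all add: ring.ring_simprules monoid.r_one[OF ring.is_monoid])

declare alg_module [simp] AT_module [simp] algebras [simp] pure_tensor_closed [simp] linear_maps_id [simp]

lemma antipode_inv_linear: "\<alpha> \<in> carrier \<pi> \<Longrightarrow> S (inv \<alpha>) \<in> linear_maps k (A (inv \<alpha>)) (A \<alpha>)"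
  using antipode_linear[of "inv \<alpha>"] by simp

lemma antipode_inv_closed [simp]: "\<lbrakk>\<alpha> \<in> carrier \<pi>; x \<in> carrier (A (inv \<alpha>))\<rbrakk> \<Longrightarrow> S (inv \<alpha>) x \<in> carrier (A \<alpha>)"
  by (rule linear_maps_closed[OF antipode_inv_linear])

lemma counit_closed [simp]: "x \<in> carrier (A \<one>) \<Longrightarrow> \<epsilon> x \<in> carrier k"
  by (rule ring_hom_closed[OF counit_ring_hom])

lemma counit_one: "\<epsilon> \<one>\<^bsub>A \<one>\<^esub> = \<one>\<^bsub>k\<^esub>"
  using counit_ring_hom by (rule ring_hom_one)

lemma counit_add: "\<lbrakk>x \<in> carrier (A \<one>); y \<in> carrier (A \<one>)\<rbrakk> \<Longrightarrow> \<epsilon> (x \<oplus>\<^bsub>A \<one>\<^esub> y) = \<epsilon> x \<oplus>\<^bsub>k\<^esub> \<epsilon> y"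
  by (rule ring_hom_add[OF counit_ring_hom])

lemma counit_smult_linear:
  assumes "module k M" "m \<in> carrier M" "f \<in> linear_maps k V (A \<one>)"
  shows "(\<lambda>x. \<epsilon> (f x) \<odot>\<^bsub>M\<^esub> m) \<in> linear_maps k V M"
proof -
  interpret M: module k M by fact
  show ?thesis
    using assms(2) linear_maps_closed[OF assms(3)]
    by (intro linear_mapsI)
       (simp_all add: linear_maps_add[OF assms(3)] linear_maps_smult[OF assms(3)] counit_add counit_linear
         M.smult_l_distr M.smult_assoc1)
qed

text \<open>The algebra being split often appears in simplified form, such as
  \<open>A \<alpha>\<close> for \<open>A (\<alpha> \<otimes> \<one>)\<close>; the separate equation
  for \<open>B\<close> absorbs this.\<close>

lemma sw_linear':
  "\<lbrakk>module k M; \<alpha> \<in> carrier \<pi>; \<beta> \<in> carrier \<pi>; \<phi> \<in> bilinear_maps k (A \<alpha>) (A \<beta>) M; f \<in> linear_maps k V B; B = A (\<alpha> \<otimes> \<beta>)\<rbrakk>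
    \<Longrightarrow> (\<lambda>x. sw M \<alpha> \<beta> \<phi> (f x)) \<in> linear_maps k V M"
  by (simp add: sw_linear)

text \<open>These rules reduce linearity of a nested Sweedler expression in each of its variables to
  membership in carriers.\<close>

lemmas lin = linear_maps_id[OF refl] linear_maps_pure_left linear_maps_pure_right linear_maps_mult_left linear_maps_mult_right
  linear_maps_comp[OF antipode_inv_linear] sw_linear' sw_linear_param bilinear_mapsI sw_closed counit_smult_linear
  linear_maps_smult_right

section \<open>Counit and antipode axioms under a linear map\<close>

lemma sw_counit_left:
  assumes M: "module k M" and \<alpha>: "\<alpha> \<in> carrier \<pi>" and f: "f \<in> linear_maps k (A \<alpha>) M" and x: "x \<in> carrier (A \<alpha>)"
  shows "sw M \<one> \<alpha> (\<lambda>a b. \<epsilon> a \<odot>\<^bsub>M\<^esub> f b) x = f x"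
proof -
  interpret M: module k M by fact
  have b: "(\<lambda>a b. \<epsilon> a \<odot>\<^bsub>A \<alpha>\<^esub> b) \<in> bilinear_maps k (A \<one>) (A \<alpha>) (A \<alpha>)"
    using \<alpha> by (intro lin; simp)
  have "f x = f (sw (A \<alpha>) \<one> \<alpha> (\<lambda>a b. \<epsilon> a \<odot>\<^bsub>A \<alpha>\<^esub> b) x)" using counit_left[OF \<alpha> x] by simp
  also have "\<dots> = sw M \<one> \<alpha> (\<lambda>a b. f (\<epsilon> a \<odot>\<^bsub>A \<alpha>\<^esub> b)) x"
    using \<alpha> x by (intro linear_sw[OF _ _ _ _ f b] M) auto
  also have "\<dots> = sw M \<one> \<alpha> (\<lambda>a b. \<epsilon> a \<odot>\<^bsub>M\<^esub> f b) x"
    using \<alpha> x linear_maps_closed[OF f] by (intro sw_cong M) (auto simp: linear_maps_smult[OF f])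
  finally show ?thesis ..
qed

lemma sw_counit_right:
  assumes M: "module k M" and \<alpha>: "\<alpha> \<in> carrier \<pi>" and f: "f \<in> linear_maps k (A \<alpha>) M" and x: "x \<in> carrier (A \<alpha>)"
  shows "sw M \<alpha> \<one> (\<lambda>a b. \<epsilon> b \<odot>\<^bsub>M\<^esub> f a) x = f x"
proof -
  interpret M: module k M by fact
  have b: "(\<lambda>a b. \<epsilon> b \<odot>\<^bsub>A \<alpha>\<^esub> a) \<in> bilinear_maps k (A \<alpha>) (A \<one>) (A \<alpha>)"
    using \<alpha> by (intro lin; simp)
  have "f x = f (sw (A \<alpha>) \<alpha> \<one> (\<lambda>a b. \<epsilon> b \<odot>\<^bsub>A \<alpha>\<^esub> a) x)" using counit_right[OF \<alpha> x] by simp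
  also have "\<dots> = sw M \<alpha> \<one> (\<lambda>a b. f (\<epsilon> b \<odot>\<^bsub>A \<alpha>\<^esub> a)) x"
    using \<alpha> x by (intro linear_sw[OF _ _ _ _ f b] M) auto
  also have "\<dots> = sw M \<alpha> \<one> (\<lambda>a b. \<epsilon> b \<odot>\<^bsub>M\<^esub> f a) x"
    using \<alpha> x linear_maps_closed[OF f] by (intro sw_cong M) (auto simp: linear_maps_smult[OF f])
  finally show ?thesis ..
qed

lemma sw_antipode_left:
  assumes M: "module k M" and \<alpha>: "\<alpha> \<in> carrier \<pi>" and f: "f \<in> linear_maps k (A \<alpha>) M" and x: "x \<in> carrier (A \<one>)"
  shows "sw M (inv \<alpha>) \<alpha> (\<lambda>a b. f (S (inv \<alpha>) a \<otimes>\<^bsub>A \<alpha>\<^esub> b)) x = \<epsilon> x \<odot>\<^bsub>M\<^esub> f \<one>\<^bsub>A \<alpha>\<^esub>"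
proof -
  interpret M: module k M by fact
  interpret AA: assoc_algebra k "A \<alpha>" by (rule algebras[OF \<alpha>])
  have b: "(\<lambda>a b. pt \<alpha> \<alpha> (S (inv \<alpha>) a) b) \<in> bilinear_maps k (A (inv \<alpha>)) (A \<alpha>) (AT \<alpha> \<alpha>)"
    using \<alpha> by (intro lin; simp)
  let ?g = "\<lambda>t. f (mult_map (A \<alpha>) t)"
  have g: "?g \<in> linear_maps k (AT \<alpha> \<alpha>) M" by (rule linear_maps_comp[OF f AA.mult_map_linear])
  have "\<epsilon> x \<odot>\<^bsub>M\<^esub> f \<one>\<^bsub>A \<alpha>\<^esub> = f (\<epsilon> x \<odot>\<^bsub>A \<alpha>\<^esub> \<one>\<^bsub>A \<alpha>\<^esub>)"
    using \<alpha> x by (simp add: linear_maps_smult[OF f])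
  also have "\<dots> = ?g (sw (AT \<alpha> \<alpha>) (inv \<alpha>) \<alpha> (\<lambda>a b. pt \<alpha> \<alpha> (S (inv \<alpha>) a) b) x)"
    using antipode_left[OF \<alpha> x] by (simp add: tensor_map_def)
  also have "\<dots> = sw M (inv \<alpha>) \<alpha> (\<lambda>a b. ?g (pt \<alpha> \<alpha> (S (inv \<alpha>) a) b)) x"
    using \<alpha> x by (intro linear_sw[OF _ _ _ _ g b] M) auto
  also have "\<dots> = sw M (inv \<alpha>) \<alpha> (\<lambda>a b. f (S (inv \<alpha>) a \<otimes>\<^bsub>A \<alpha>\<^esub> b)) x"
    using \<alpha> x linear_maps_closed[OF f] by (intro sw_cong M) (auto simp: AA.mult_map_pure)
  finally show ?thesis ..
qed

lemma sw_antipode_right: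
  assumes M: "module k M" and \<alpha>: "\<alpha> \<in> carrier \<pi>" and f: "f \<in> linear_maps k (A \<alpha>) M" and x: "x \<in> carrier (A \<one>)"
  shows "sw M \<alpha> (inv \<alpha>) (\<lambda>a b. f (a \<otimes>\<^bsub>A \<alpha>\<^esub> S (inv \<alpha>) b)) x = \<epsilon> x \<odot>\<^bsub>M\<^esub> f \<one>\<^bsub>A \<alpha>\<^esub>"
proof -
  interpret M: module k M by fact
  interpret AA: assoc_algebra k "A \<alpha>" by (rule algebras[OF \<alpha>])
  have b: "(\<lambda>a b. pt \<alpha> \<alpha> a (S (inv \<alpha>) b)) \<in> bilinear_maps k (A \<alpha>) (A (inv \<alpha>)) (AT \<alpha> \<alpha>)"
    using \<alpha> by (intro lin; simp)
  let ?g = "\<lambda>t. f (mult_map (A \<alpha>) t)"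
  have g: "?g \<in> linear_maps k (AT \<alpha> \<alpha>) M" by (rule linear_maps_comp[OF f AA.mult_map_linear])
  have "\<epsilon> x \<odot>\<^bsub>M\<^esub> f \<one>\<^bsub>A \<alpha>\<^esub> = f (\<epsilon> x \<odot>\<^bsub>A \<alpha>\<^esub> \<one>\<^bsub>A \<alpha>\<^esub>)"
    using \<alpha> x by (simp add: linear_maps_smult[OF f])
  also have "\<dots> = ?g (sw (AT \<alpha> \<alpha>) \<alpha> (inv \<alpha>) (\<lambda>a b. pt \<alpha> \<alpha> a (S (inv \<alpha>) b)) x)"
    using antipode_right[OF \<alpha> x] by (simp add: tensor_map_def)
  also have "\<dots> = sw M \<alpha> (inv \<alpha>) (\<lambda>a b. ?g (pt \<alpha> \<alpha> a (S (inv \<alpha>) b))) x"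
    using \<alpha> x by (intro linear_sw[OF _ _ _ _ g b] M) auto
  also have "\<dots> = sw M \<alpha> (inv \<alpha>) (\<lambda>a b. f (a \<otimes>\<^bsub>A \<alpha>\<^esub> S (inv \<alpha>) b)) x"
    using \<alpha> x linear_maps_closed[OF f] by (intro sw_cong M) (auto simp: AA.mult_map_pure)
  finally show ?thesis ..
qed

section \<open>The map \<open>r\<close> and its inverse\<close>

abbreviation r where "r \<alpha> \<equiv> r_map k \<pi> A \<Delta> \<alpha>"

definition r_inv where
  "r_inv \<alpha> = tensor_lift (AT \<alpha> \<alpha>) (\<lambda>a x. sw (AT \<alpha> \<alpha>) (inv \<alpha>) \<alpha>
     (\<lambda>s t. pt \<alpha> \<alpha> (a \<otimes>\<^bsub>A \<alpha>\<^esub> S (inv \<alpha>) s) t) x)"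

lemma r_inv_bilinear:
  assumes \<alpha>: "\<alpha> \<in> carrier \<pi>"
  shows "(\<lambda>a x. sw (AT \<alpha> \<alpha>) (inv \<alpha>) \<alpha> (\<lambda>s t. pt \<alpha> \<alpha> (a \<otimes>\<^bsub>A \<alpha>\<^esub> S (inv \<alpha>) s) t) x)
    \<in> bilinear_maps k (A \<alpha>) (A \<one>) (AT \<alpha> \<alpha>)"
  using \<alpha> by (intro lin; simp)

lemma r_inv_linear: "\<alpha> \<in> carrier \<pi> \<Longrightarrow> r_inv \<alpha> \<in> linear_maps k (AT \<alpha> \<one>) (AT \<alpha> \<alpha>)"
  unfolding r_inv_def by (intro tensor_lift_linear r_inv_bilinear) auto

lemma r_inv_pure:
  "\<lbrakk>\<alpha> \<in> carrier \<pi>; a \<in> carrier (A \<alpha>); x \<in> carrier (A \<one>)\<rbrakk> \<Longrightarrow> r_inv \<alpha> (pt \<alpha> \<one> a x)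
    = sw (AT \<alpha> \<alpha>) (inv \<alpha>) \<alpha> (\<lambda>s t. pt \<alpha> \<alpha> (a \<otimes>\<^bsub>A \<alpha>\<^esub> S (inv \<alpha>) s) t) x"
  unfolding r_inv_def by (rule tensor_lift_pure[OF _ _ _ r_inv_bilinear]) auto

lemma r_bilinear:
  assumes \<alpha>: "\<alpha> \<in> carrier \<pi>"
  shows "(\<lambda>a b. sw (AT \<alpha> \<one>) \<alpha> \<one> (\<lambda>u x. pt \<alpha> \<one> (a \<otimes>\<^bsub>A \<alpha>\<^esub> u) x) b)
    \<in> bilinear_maps k (A \<alpha>) (A \<alpha>) (AT \<alpha> \<one>)"
  using \<alpha> by (intro lin; simp)

text \<open>The product in the tensor algebra is evaluated: \<open>(a \<otimes> 1) \<Delta>(b) = a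
  b\<^sub>1 \<otimes> 1 b\<^sub>2 = a b\<^sub>1 \<otimes> b\<^sub>2\<close>.\<close>

lemma r_eq:
  assumes \<alpha>: "\<alpha> \<in> carrier \<pi>" and q: "q \<in> carrier (AT \<alpha> \<alpha>)"
  shows "r \<alpha> q = tensor_lift (AT \<alpha> \<one>) (\<lambda>a b. sw (AT \<alpha> \<one>) \<alpha> \<one> (\<lambda>u x. pt \<alpha> \<one> (a \<otimes>\<^bsub>A \<alpha>\<^esub> u) x) b) q"
  unfolding r_map_def
proof (rule tensor_lift_cong[OF _ _ _ _ _ q])
  fix a b assume ab: "a \<in> carrier (A \<alpha>)" "b \<in> carrier (A \<alpha>)"
  show "sw (AT \<alpha> \<one>) \<alpha> \<one> (\<lambda>u x. pt \<alpha> \<one> (a \<otimes>\<^bsub>A \<alpha>\<^esub> u) x) b \<in> carrier (AT \<alpha> \<one>)"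
    using \<alpha> ab by (intro lin; simp)
  have d: "\<Delta> \<alpha> \<one> b \<in> carrier (AT \<alpha> \<one>)" using comult_closed[of \<alpha> \<one> b] \<alpha> ab by simp
  have b1: "(\<lambda>a c. tensor_lift (AT \<alpha> \<one>) (\<lambda>v w. pt \<alpha> \<one> (a \<otimes>\<^bsub>A \<alpha>\<^esub> v) (c \<otimes>\<^bsub>A \<one>\<^esub> w)) (\<Delta> \<alpha> \<one> b))
    \<in> bilinear_maps k (A \<alpha>) (A \<one>) (AT \<alpha> \<one>)"
    using \<alpha> ab by (intro lin; simp)
  have "pt \<alpha> \<one> a \<one>\<^bsub>A \<one>\<^esub> \<otimes>\<^bsub>tensor_algebra k (A \<alpha>) (A \<one>)\<^esub> \<Delta> \<alpha> \<one> b
    = sw (AT \<alpha> \<one>) \<alpha> \<one> (\<lambda>u x. pt \<alpha> \<one> (a \<otimes>\<^bsub>A \<alpha>\<^esub> u) (\<one>\<^bsub>A \<one>\<^esub> \<otimes>\<^bsub>A \<one>\<^esub> x)) b"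
    using \<alpha> ab d by (simp add: tensor_bimap_def tensor_map_def tensor_lift_pure[OF _ _ _ b1])
  also have "\<dots> = sw (AT \<alpha> \<one>) \<alpha> \<one> (\<lambda>u x. pt \<alpha> \<one> (a \<otimes>\<^bsub>A \<alpha>\<^esub> u) x) b"
    using \<alpha> ab by (intro sw_cong) auto
  finally show "pt \<alpha> \<one> a \<one>\<^bsub>A \<one>\<^esub> \<otimes>\<^bsub>tensor_algebra k (A \<alpha>) (A \<one>)\<^esub> \<Delta> \<alpha> \<one> b
    = sw (AT \<alpha> \<one>) \<alpha> \<one> (\<lambda>u x. pt \<alpha> \<one> (a \<otimes>\<^bsub>A \<alpha>\<^esub> u) x) b" .
qed (use \<alpha> in auto)

lemma r_linear: assumes \<alpha>: "\<alpha> \<in> carrier \<pi>" shows "r \<alpha> \<in> linear_maps k (AT \<alpha> \<alpha>) (AT \<alpha> \<one>)"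
proof -
  interpret T: module k "AT \<alpha> \<alpha>" using \<alpha> by simp
  have "tensor_lift (AT \<alpha> \<one>) (\<lambda>a b. sw (AT \<alpha> \<one>) \<alpha> \<one> (\<lambda>u x. pt \<alpha> \<one> (a \<otimes>\<^bsub>A \<alpha>\<^esub> u) x) b)
    \<in> linear_maps k (AT \<alpha> \<alpha>) (AT \<alpha> \<one>)"
    using \<alpha> by (intro tensor_lift_linear r_bilinear) auto
  then show ?thesis using r_eq[OF \<alpha>] by (simp add: linear_maps_def Pi_iff)
qed

lemma r_pure:
  "\<lbrakk>\<alpha> \<in> carrier \<pi>; a \<in> carrier (A \<alpha>); b \<in> carrier (A \<alpha>)\<rbrakk> \<Longrightarrow> r \<alpha> (pt \<alpha> \<alpha> a b)
    = sw (AT \<alpha> \<one>) \<alpha> \<one> (\<lambda>u x. pt \<alpha> \<one> (a \<otimes>\<^bsub>A \<alpha>\<^esub> u) x) b"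
  by (simp add: r_eq tensor_lift_pure[OF _ _ _ r_bilinear])

end

section \<open>Linear maps with values in a subgroup\<close>

lemma tensor_lift_in_subgroup:
  assumes "module k V" "module k W" "module k M" and H: "subgroup H (add_monoid M)"
    and \<phi>: "\<phi> \<in> bilinear_maps k V W M"
    and \<phi>H: "\<And>v w. \<lbrakk>v \<in> carrier V; w \<in> carrier W\<rbrakk> \<Longrightarrow> \<phi> v w \<in> H"
    and t: "t \<in> carrier (tensor_module k V W)"
  shows "tensor_lift M \<phi> t \<in> H"
  using assms(1,2) t
proof (induction t rule: tensor_induct)
  case (pure v w)
  then show ?case by (simp add: tensor_lift_pure[OF assms(1-3) \<phi>] \<phi>H)
next
  case (add x y)
  then show ?case
    using linear_maps_add[OF tensor_lift_linear[OF assms(1-3) \<phi>] add(1,2)] subgroup.m_closed[OF H] by simp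
qed

lemma linear_maps_tensor_subspace:
  assumes "module k V" "module k W" "module k M" "R \<subseteq> carrier W"
    and f: "f \<in> linear_maps k (tensor_module k V W) M" and H: "subgroup H (add_monoid M)"
    and fH: "\<And>v r. \<lbrakk>v \<in> carrier V; r \<in> R\<rbrakk> \<Longrightarrow> f (pure_tensor k V W v r) \<in> H"
    and z: "z \<in> tensor_subspace k V W R"
  shows "f z \<in> H"
proof -
  note sub = subgroup.subset[OF tensor_subspace_subgroup[OF assms(1,2,4)]]
  show ?thesis
    using assms(1,2,4) z
  proof (induction rule: tensor_subspace_induct)
    case zero
    show ?case
      using linear_maps_zero[OF f tensor_module_module[OF assms(1,2)] assms(3)] subgroup.one_closed[OF H] by simp
  next
    case (pure v r)
    then show ?case by (rule fH)
  next
    case (add x y)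
    then have "x \<in> carrier (tensor_module k V W)" "y \<in> carrier (tensor_module k V W)"
      using subsetD[OF sub] by auto
    then show ?case using linear_maps_add[OF f] subgroup.m_closed[OF H add(3,4)] by simp
  qed
qed

context hopf_group_coalgebra
begin

text \<open>Coassociativity at (\<open>\<alpha>\<close>, \<open>\<beta>\<close>,
  \<open>\<one>\<close>), and in the next lemma at (\<open>\<alpha>\<close>,
  \<open>inv \<alpha>\<close>, \<open>\<alpha>\<close>), with products in the group simplified.
  These triples suit the two compositions of \<open>r\<close> with its inverse.\<close>

lemma sw_coassoc_one:
  assumes "module k M" "\<alpha> \<in> carrier \<pi>" "\<beta> \<in> carrier \<pi>" "x \<in> carrier (A (\<alpha> \<otimes> \<beta>))"
    and "\<And>b c. \<lbrakk>b \<in> carrier (A \<beta>); c \<in> carrier (A \<one>)\<rbrakk> \<Longrightarrow> (\<lambda>a. \<phi> a b c) \<in> linear_maps k (A \<alpha>) M"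
    and "\<And>a c. \<lbrakk>a \<in> carrier (A \<alpha>); c \<in> carrier (A \<one>)\<rbrakk> \<Longrightarrow> (\<lambda>b. \<phi> a b c) \<in> linear_maps k (A \<beta>) M"
    and "\<And>a b. \<lbrakk>a \<in> carrier (A \<alpha>); b \<in> carrier (A \<beta>)\<rbrakk> \<Longrightarrow> (\<lambda>c. \<phi> a b c) \<in> linear_maps k (A \<one>) M"
  shows "sw M (\<alpha> \<otimes> \<beta>) \<one> (\<lambda>u c. sw M \<alpha> \<beta> (\<lambda>a b. \<phi> a b c) u) x
    = sw M \<alpha> \<beta> (\<lambda>a v. sw M \<beta> \<one> (\<lambda>b c. \<phi> a b c) v) x"
  using sw_coassoc[OF assms(1-3) one_closed _ assms(5-7), of x] assms(2-4) by simp

lemma sw_coassoc_inv: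
  assumes "module k M" "\<alpha> \<in> carrier \<pi>" "x \<in> carrier (A \<alpha>)"
    and "\<And>b c. \<lbrakk>b \<in> carrier (A (inv \<alpha>)); c \<in> carrier (A \<alpha>)\<rbrakk> \<Longrightarrow> (\<lambda>a. \<phi> a b c) \<in> linear_maps k (A \<alpha>) M"
    and "\<And>a c. \<lbrakk>a \<in> carrier (A \<alpha>); c \<in> carrier (A \<alpha>)\<rbrakk> \<Longrightarrow> (\<lambda>b. \<phi> a b c) \<in> linear_maps k (A (inv \<alpha>)) M"
    and "\<And>a b. \<lbrakk>a \<in> carrier (A \<alpha>); b \<in> carrier (A (inv \<alpha>))\<rbrakk> \<Longrightarrow> (\<lambda>c. \<phi> a b c) \<in> linear_maps k (A \<alpha>) M"
  shows "sw M \<one> \<alpha> (\<lambda>u c. sw M \<alpha> (inv \<alpha>) (\<lambda>a b. \<phi> a b c) u) x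
    = sw M \<alpha> \<one> (\<lambda>a v. sw M (inv \<alpha>) \<alpha> (\<lambda>b c. \<phi> a b c) v) x"
  using sw_coassoc[OF assms(1,2) inv_closed[OF assms(2)] assms(2) _ assms(4-6), of x] assms(2,3) by simp

text \<open>In Sweedler notation \<open>a S(x\<^sub>1) x\<^sub>2 \<otimes> x\<^sub>3 = a \<otimes>
  \<epsilon>(x\<^sub>1) x\<^sub>2 = a \<otimes> x\<close>: coassociativity makes
  \<open>x\<^sub>1\<close>, \<open>x\<^sub>2\<close> the legs of one element of
  \<open>A \<one>\<close>, to which the antipode axiom applies.\<close>

lemma r_r_inv_pure:
  assumes \<alpha>: "\<alpha> \<in> carrier \<pi>" and a: "a \<in> carrier (A \<alpha>)" and x: "x \<in> carrier (A \<one>)"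
  shows "r \<alpha> (r_inv \<alpha> (pt \<alpha> \<one> a x)) = pt \<alpha> \<one> a x"
proof -
  let ?M = "AT \<alpha> \<one>" and ?p = "pt \<alpha> \<one>"
  let ?\<phi> = "\<lambda>s u v. ?p (a \<otimes>\<^bsub>A \<alpha>\<^esub> (S (inv \<alpha>) s \<otimes>\<^bsub>A \<alpha>\<^esub> u)) v"
  have M: "module k ?M" using \<alpha> by simp
  interpret M: module k ?M by fact
  have "r \<alpha> (r_inv \<alpha> (?p a x)) = r \<alpha> (sw (AT \<alpha> \<alpha>) (inv \<alpha>) \<alpha> (\<lambda>s t. pt \<alpha> \<alpha> (a \<otimes>\<^bsub>A \<alpha>\<^esub> S (inv \<alpha>) s) t) x)"
    using assms by (simp add: r_inv_pure)
  also have "\<dots> = sw ?M (inv \<alpha>) \<alpha> (\<lambda>s t. r \<alpha> (pt \<alpha> \<alpha> (a \<otimes>\<^bsub>A \<alpha>\<^esub> S (inv \<alpha>) s) t)) x"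
    using assms by (intro linear_sw[OF _ _ _ _ r_linear[OF \<alpha>]] lin; simp)
  also have "\<dots> = sw ?M (inv \<alpha>) \<alpha> (\<lambda>s t. sw ?M \<alpha> \<one> (\<lambda>u v. ?\<phi> s u v) t) x"
  proof (rule sw_cong)
    fix s t assume st: "s \<in> carrier (A (inv \<alpha>))" "t \<in> carrier (A \<alpha>)"
    show "sw ?M \<alpha> \<one> (\<lambda>u v. ?\<phi> s u v) t \<in> carrier ?M" using assms st by (intro lin; simp)
    show "r \<alpha> (pt \<alpha> \<alpha> (a \<otimes>\<^bsub>A \<alpha>\<^esub> S (inv \<alpha>) s) t) = sw ?M \<alpha> \<one> (\<lambda>u v. ?\<phi> s u v) t"
      using assms st by (simp add: r_pure) (intro sw_cong; simp add: alg_m_assoc)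
  qed (use assms in auto)
  also have "\<dots> = sw ?M (inv \<alpha> \<otimes> \<alpha>) \<one> (\<lambda>w v. sw ?M (inv \<alpha>) \<alpha> (\<lambda>s u. ?\<phi> s u v) w) x"
    using assms by (intro sw_coassoc_one[symmetric] lin; simp)
  also have "\<dots> = sw ?M \<one> \<one> (\<lambda>w v. sw ?M (inv \<alpha>) \<alpha> (\<lambda>s u. ?\<phi> s u v) w) x"
    using \<alpha> by simp
  also have "\<dots> = sw ?M \<one> \<one> (\<lambda>w v. \<epsilon> w \<odot>\<^bsub>?M\<^esub> ?p a v) x"
  proof (rule sw_cong)
    fix w v assume wv: "w \<in> carrier (A \<one>)" "v \<in> carrier (A \<one>)"
    have "(\<lambda>y. ?p (a \<otimes>\<^bsub>A \<alpha>\<^esub> y) v) \<in> linear_maps k (A \<alpha>) ?M" using assms wv by (intro lin; simp)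
    from sw_antipode_left[OF M \<alpha> this wv(1)]
    show "sw ?M (inv \<alpha>) \<alpha> (\<lambda>s u. ?\<phi> s u v) w = \<epsilon> w \<odot>\<^bsub>?M\<^esub> ?p a v" using assms by simp
  qed (use assms in auto)
  also have "\<dots> = ?p a x"
    using assms by (intro sw_counit_left[OF M] lin; simp)
  finally show ?thesis .
qed

text \<open>Mirror image of the preceding computation: \<open>a b\<^sub>1 S(b\<^sub>2) \<otimes>
  b\<^sub>3 = a \<otimes> \<epsilon>(b\<^sub>1) b\<^sub>2 = a \<otimes> b\<close>, with the right
  antipode axiom.\<close>

lemma r_inv_r_pure:
  assumes \<alpha>: "\<alpha> \<in> carrier \<pi>" and a: "a \<in> carrier (A \<alpha>)" and b: "b \<in> carrier (A \<alpha>)"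
  shows "r_inv \<alpha> (r \<alpha> (pt \<alpha> \<alpha> a b)) = pt \<alpha> \<alpha> a b"
proof -
  let ?M = "AT \<alpha> \<alpha>" and ?p = "pt \<alpha> \<alpha>"
  let ?\<phi> = "\<lambda>u s t. ?p (a \<otimes>\<^bsub>A \<alpha>\<^esub> (u \<otimes>\<^bsub>A \<alpha>\<^esub> S (inv \<alpha>) s)) t"
  have M: "module k ?M" using \<alpha> by simp
  interpret M: module k ?M by fact
  have "r_inv \<alpha> (r \<alpha> (?p a b)) = r_inv \<alpha> (sw (AT \<alpha> \<one>) \<alpha> \<one> (\<lambda>u x. pt \<alpha> \<one> (a \<otimes>\<^bsub>A \<alpha>\<^esub> u) x) b)"
    using assms by (simp add: r_pure)
  also have "\<dots> = sw ?M \<alpha> \<one> (\<lambda>u x. r_inv \<alpha> (pt \<alpha> \<one> (a \<otimes>\<^bsub>A \<alpha>\<^esub> u) x)) b"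
    using assms by (intro linear_sw[OF _ _ _ _ r_inv_linear[OF \<alpha>]] lin; simp)
  also have "\<dots> = sw ?M \<alpha> \<one> (\<lambda>u x. sw ?M (inv \<alpha>) \<alpha> (\<lambda>s t. ?\<phi> u s t) x) b"
  proof (rule sw_cong)
    fix u x assume ux: "u \<in> carrier (A \<alpha>)" "x \<in> carrier (A \<one>)"
    show "sw ?M (inv \<alpha>) \<alpha> (\<lambda>s t. ?\<phi> u s t) x \<in> carrier ?M" using assms ux by (intro lin; simp)
    show "r_inv \<alpha> (pt \<alpha> \<one> (a \<otimes>\<^bsub>A \<alpha>\<^esub> u) x) = sw ?M (inv \<alpha>) \<alpha> (\<lambda>s t. ?\<phi> u s t) x"
      using assms ux by (simp add: r_inv_pure) (intro sw_cong; simp add: alg_m_assoc)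
  qed (use assms in auto)
  also have "\<dots> = sw ?M \<one> \<alpha> (\<lambda>w t. sw ?M \<alpha> (inv \<alpha>) (\<lambda>u s. ?\<phi> u s t) w) b"
    using assms by (intro sw_coassoc_inv[symmetric] lin; simp)
  also have "\<dots> = sw ?M \<one> \<alpha> (\<lambda>w t. \<epsilon> w \<odot>\<^bsub>?M\<^esub> ?p a t) b"
  proof (rule sw_cong)
    fix w v assume wv: "w \<in> carrier (A \<one>)" "v \<in> carrier (A \<alpha>)"
    have "(\<lambda>y. ?p (a \<otimes>\<^bsub>A \<alpha>\<^esub> y) v) \<in> linear_maps k (A \<alpha>) ?M" using assms wv by (intro lin; simp)
    from sw_antipode_right[OF M \<alpha> this wv(1)]
    show "sw ?M \<alpha> (inv \<alpha>) (\<lambda>u s. ?\<phi> u s v) w = \<epsilon> w \<odot>\<^bsub>?M\<^esub> ?p a v" using assms by simp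
  qed (use assms in auto)
  also have "\<dots> = ?p a b"
    using assms by (intro sw_counit_left[OF M] lin; simp)
  finally show ?thesis .
qed

lemma r_r_inv: "\<lbrakk>\<alpha> \<in> carrier \<pi>; z \<in> carrier (AT \<alpha> \<one>)\<rbrakk> \<Longrightarrow> r \<alpha> (r_inv \<alpha> z) = z"
  by (rule linear_maps_tensor_eqI[where f = "\<lambda>z. r \<alpha> (r_inv \<alpha> z)" and g = "\<lambda>z. z",
        OF _ _ linear_maps_comp[OF r_linear r_inv_linear]])
     (auto simp: r_r_inv_pure)

lemma r_inv_r: "\<lbrakk>\<alpha> \<in> carrier \<pi>; q \<in> carrier (AT \<alpha> \<alpha>)\<rbrakk> \<Longrightarrow> r_inv \<alpha> (r \<alpha> q) = q"
  by (rule linear_maps_tensor_eqI[where f = "\<lambda>z. r_inv \<alpha> (r \<alpha> z)" and g = "\<lambda>z. z",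
        OF _ _ linear_maps_comp[OF r_inv_linear r_linear]])
     (auto simp: r_inv_r_pure)

section \<open>Multiplication and the two actions read through \<open>r\<close>\<close>

definition id_counit where "id_counit \<alpha> = tensor_lift (A \<alpha>) (\<lambda>a x. \<epsilon> x \<odot>\<^bsub>A \<alpha>\<^esub> a)"

lemma id_counit_bilinear: "\<alpha> \<in> carrier \<pi> \<Longrightarrow> (\<lambda>a x. \<epsilon> x \<odot>\<^bsub>A \<alpha>\<^esub> a) \<in> bilinear_maps k (A \<alpha>) (A \<one>) (A \<alpha>)"
  by (intro lin; simp)

lemma id_counit_linear: "\<alpha> \<in> carrier \<pi> \<Longrightarrow> id_counit \<alpha> \<in> linear_maps k (AT \<alpha> \<one>) (A \<alpha>)"
  unfolding id_counit_def by (intro tensor_lift_linear id_counit_bilinear) auto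

lemma id_counit_pure: "\<lbrakk>\<alpha> \<in> carrier \<pi>; a \<in> carrier (A \<alpha>); x \<in> carrier (A \<one>)\<rbrakk>
    \<Longrightarrow> id_counit \<alpha> (pt \<alpha> \<one> a x) = \<epsilon> x \<odot>\<^bsub>A \<alpha>\<^esub> a"
  unfolding id_counit_def by (simp add: tensor_lift_pure[OF _ _ _ id_counit_bilinear])

text \<open>\<open>a b\<^sub>1 \<epsilon>(b\<^sub>2) = ab\<close> by the counit axiom. Beyond
  \<open>r\<close>, having product zero is thus a condition on the second leg.\<close>

lemma id_counit_r:
  assumes \<alpha>: "\<alpha> \<in> carrier \<pi>" and q: "q \<in> carrier (AT \<alpha> \<alpha>)"
  shows "id_counit \<alpha> (r \<alpha> q) = mult_map (A \<alpha>) q"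
proof (rule linear_maps_tensor_eqI[OF _ _ linear_maps_comp[OF id_counit_linear r_linear] assoc_algebra.mult_map_linear _ q])
  interpret assoc_algebra k "A \<alpha>" by (rule algebras[OF \<alpha>])
  fix a b assume ab: "a \<in> carrier (A \<alpha>)" "b \<in> carrier (A \<alpha>)"
  have "id_counit \<alpha> (r \<alpha> (pt \<alpha> \<alpha> a b))
    = id_counit \<alpha> (sw (AT \<alpha> \<one>) \<alpha> \<one> (\<lambda>u x. pt \<alpha> \<one> (a \<otimes>\<^bsub>A \<alpha>\<^esub> u) x) b)"
    using \<alpha> ab by (simp add: r_pure)
  also have "\<dots> = sw (A \<alpha>) \<alpha> \<one> (\<lambda>u x. id_counit \<alpha> (pt \<alpha> \<one> (a \<otimes>\<^bsub>A \<alpha>\<^esub> u) x)) b"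
    using \<alpha> ab by (intro linear_sw[OF _ _ _ _ id_counit_linear[OF \<alpha>]] lin; simp)
  also have "\<dots> = sw (A \<alpha>) \<alpha> \<one> (\<lambda>u x. \<epsilon> x \<odot>\<^bsub>A \<alpha>\<^esub> (a \<otimes>\<^bsub>A \<alpha>\<^esub> u)) b"
    using \<alpha> ab by (intro sw_cong) (auto simp: id_counit_pure)
  also have "\<dots> = a \<otimes>\<^bsub>A \<alpha>\<^esub> b"
    using \<alpha> ab by (intro sw_counit_right lin; simp)
  finally show "id_counit \<alpha> (r \<alpha> (pt \<alpha> \<alpha> a b)) = mult_map (A \<alpha>) (pt \<alpha> \<alpha> a b)"
    using ab by (simp add: mult_map_pure)
qed (use \<alpha> in auto)

lemma r_lact:
  assumes \<alpha>: "\<alpha> \<in> carrier \<pi>" and q: "q \<in> carrier (AT \<alpha> \<alpha>)" and c: "c \<in> carrier (A \<alpha>)"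
  shows "r \<alpha> (lact (universal_bimod k (A \<alpha>)) c q)
    = tensor_lift (AT \<alpha> \<one>) (\<lambda>a x. pt \<alpha> \<one> (c \<otimes>\<^bsub>A \<alpha>\<^esub> a) x) (r \<alpha> q)"
proof -
  interpret assoc_algebra k "A \<alpha>" by (rule algebras[OF \<alpha>])
  let ?f = "tensor_lift (AT \<alpha> \<one>) (\<lambda>a x. pt \<alpha> \<one> (c \<otimes>\<^bsub>A \<alpha>\<^esub> a) x)"
  have b: "(\<lambda>a x. pt \<alpha> \<one> (c \<otimes>\<^bsub>A \<alpha>\<^esub> a) x) \<in> bilinear_maps k (A \<alpha>) (A \<one>) (AT \<alpha> \<one>)"
    using \<alpha> c by (intro lin; simp)
  have f: "?f \<in> linear_maps k (AT \<alpha> \<one>) (AT \<alpha> \<one>)"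
    using \<alpha> by (intro tensor_lift_linear b) auto
  show ?thesis
  proof (rule tensor_ext[OF linear_maps_comp[OF r_linear[OF \<alpha>] lact_linear[OF c]] linear_maps_comp[OF f r_linear[OF \<alpha>]] _ q])
    fix a b assume ab: "a \<in> carrier (A \<alpha>)" "b \<in> carrier (A \<alpha>)"
    have "?f (r \<alpha> (pt \<alpha> \<alpha> a b))
      = sw (AT \<alpha> \<one>) \<alpha> \<one> (\<lambda>u x. ?f (pt \<alpha> \<one> (a \<otimes>\<^bsub>A \<alpha>\<^esub> u) x)) b"
      using \<alpha> ab by (simp add: r_pure) (intro linear_sw[OF _ _ _ _ f] lin; simp)
    also have "\<dots> = sw (AT \<alpha> \<one>) \<alpha> \<one> (\<lambda>u x. pt \<alpha> \<one> (c \<otimes>\<^bsub>A \<alpha>\<^esub> a \<otimes>\<^bsub>A \<alpha>\<^esub> u) x) b"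
      using \<alpha> ab c by (intro sw_cong; simp add: tensor_lift_pure[OF _ _ _ \<open>_ \<in> bilinear_maps k _ _ _\<close>] alg_m_assoc)
    finally show "r \<alpha> (lact U c (pt \<alpha> \<alpha> a b)) = ?f (r \<alpha> (pt \<alpha> \<alpha> a b))"
      using \<alpha> ab c by (simp add: r_pure lact_pure)
  qed
qed

text \<open>Multiplicativity of \<open>\<Delta>\<close> makes right multiplication by
  \<open>c\<close> act on both legs,
  \<open>a \<otimes> x \<mapsto> a c\<^sub>1 \<otimes> x c\<^sub>2\<close>. This is where right
  ideals of \<open>A \<one>\<close> enter.\<close>

lemma r_ract:
  assumes \<alpha>: "\<alpha> \<in> carrier \<pi>" and q: "q \<in> carrier (AT \<alpha> \<alpha>)" and c: "c \<in> carrier (A \<alpha>)"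
  shows "r \<alpha> (ract (universal_bimod k (A \<alpha>)) q c)
    = tensor_lift (AT \<alpha> \<one>) (\<lambda>a x. sw (AT \<alpha> \<one>) \<alpha> \<one> (\<lambda>u v. pt \<alpha> \<one> (a \<otimes>\<^bsub>A \<alpha>\<^esub> u) (x \<otimes>\<^bsub>A \<one>\<^esub> v)) c) (r \<alpha> q)"
    (is "_ = ?f (r \<alpha> q)")
proof -
  interpret assoc_algebra k "A \<alpha>" by (rule algebras[OF \<alpha>])
  let ?M = "AT \<alpha> \<one>" and ?p = "pt \<alpha> \<one>"
  have b: "(\<lambda>a x. sw ?M \<alpha> \<one> (\<lambda>u v. ?p (a \<otimes>\<^bsub>A \<alpha>\<^esub> u) (x \<otimes>\<^bsub>A \<one>\<^esub> v)) c) \<in> bilinear_maps k (A \<alpha>) (A \<one>) ?M"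
    using \<alpha> c by (intro lin; simp)
  have f: "?f \<in> linear_maps k ?M ?M"
    using \<alpha> by (intro tensor_lift_linear b) auto
  show ?thesis
  proof (rule tensor_ext[OF linear_maps_comp[OF r_linear[OF \<alpha>] ract_linear[OF c]] linear_maps_comp[OF f r_linear[OF \<alpha>]] _ q])
    fix a e assume ab: "a \<in> carrier (A \<alpha>)" "e \<in> carrier (A \<alpha>)"
    have "?f (r \<alpha> (pt \<alpha> \<alpha> a e)) = sw ?M \<alpha> \<one> (\<lambda>u x. ?f (?p (a \<otimes>\<^bsub>A \<alpha>\<^esub> u) x)) e"
      using \<alpha> ab by (simp add: r_pure) (intro linear_sw[OF _ _ _ _ f] lin; simp)
    also have "\<dots> = sw ?M \<alpha> \<one> (\<lambda>u x. sw ?M \<alpha> \<one> (\<lambda>w v. ?p (a \<otimes>\<^bsub>A \<alpha>\<^esub> (u \<otimes>\<^bsub>A \<alpha>\<^esub> w)) (x \<otimes>\<^bsub>A \<one>\<^esub> v)) c) e"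
    proof (rule sw_cong)
      fix u x assume ux: "u \<in> carrier (A \<alpha>)" "x \<in> carrier (A \<one>)"
      show "sw ?M \<alpha> \<one> (\<lambda>w v. ?p (a \<otimes>\<^bsub>A \<alpha>\<^esub> (u \<otimes>\<^bsub>A \<alpha>\<^esub> w)) (x \<otimes>\<^bsub>A \<one>\<^esub> v)) c \<in> carrier ?M"
        using \<alpha> ab c ux by (intro lin; simp)
      show "?f (?p (a \<otimes>\<^bsub>A \<alpha>\<^esub> u) x) = sw ?M \<alpha> \<one> (\<lambda>w v. ?p (a \<otimes>\<^bsub>A \<alpha>\<^esub> (u \<otimes>\<^bsub>A \<alpha>\<^esub> w)) (x \<otimes>\<^bsub>A \<one>\<^esub> v)) c"
        using \<alpha> ab c ux by (simp add: tensor_lift_pure[OF _ _ _ b]) (intro sw_cong; simp add: alg_m_assoc)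
    qed (use \<alpha> ab in auto)
    also have "\<dots> = sw ?M \<alpha> \<one> (\<lambda>u x. ?p (a \<otimes>\<^bsub>A \<alpha>\<^esub> u) x) (e \<otimes>\<^bsub>A \<alpha>\<^esub> c)"
    proof -
      have "(\<lambda>u x. ?p (a \<otimes>\<^bsub>A \<alpha>\<^esub> u) x) \<in> bilinear_maps k (A \<alpha>) (A \<one>) ?M"
        using \<alpha> ab by (intro lin; simp)
      from sw_mult[OF _ \<alpha> one_closed _ _ this, of e c] show ?thesis using \<alpha> ab c by simp
    qed
    finally show "r \<alpha> (ract U (pt \<alpha> \<alpha> a e) c) = ?f (r \<alpha> (pt \<alpha> \<alpha> a e))"
      using \<alpha> ab c by (simp add: r_pure ract_pure)
  qed
qed

end

lemma linear_maps_lact_right: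
  "\<lbrakk>bimodule k B M; c \<in> carrier B; f \<in> linear_maps k V M\<rbrakk> \<Longrightarrow> (\<lambda>x. lact M c (f x)) \<in> linear_maps k V M"
  by (rule linear_maps_comp[OF bimodule.lact_map_linear])

lemma linear_maps_lact_left:
  "\<lbrakk>bimodule k B M; m \<in> carrier M; f \<in> linear_maps k V B\<rbrakk> \<Longrightarrow> (\<lambda>x. lact M (f x) m) \<in> linear_maps k V M"
  by (rule linear_maps_comp[OF bimodule.lact_arg_linear])

section \<open>The coaction of a calculus\<close>

text \<open>Only the component of a calculus in one degree \<open>\<beta>\<close> is fixed:
  \<open>omega\<close> and the coaction take their values in modules built from it, and the proof
  instantiates it in several degrees.\<close>

locale hopf_fodc = hopf_group_coalgebra k \<pi> A \<Delta> \<epsilon> S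
  for k :: "'k ring" and \<pi> :: "'g monoid" (structure) and A :: "'g \<Rightarrow> ('k, 'a) module" and \<Delta> \<epsilon> S +
  fixes \<beta> and M :: "('k, 'a, 'm) bimod" and d
  assumes \<beta>: "\<beta> \<in> carrier \<pi>" and fodc: "fodc k (A \<beta>) M d"
begin

sublocale C: fodc k "A \<beta>" M d by (rule fodc)

lemma M_bimodule: "bimodule k (A \<beta>) M" by (rule C.bimodule_axioms)

declare C.M_module [simp] \<beta> [simp]

lemmas lin' = lin linear_maps_lact_right[OF M_bimodule] linear_maps_lact_left[OF M_bimodule]
  linear_maps_comp[OF C.d_linear]

text \<open>In Sweedler notation, \<open>omega x = S(x\<^sub>1) d(x\<^sub>2)\<close>.\<close>

definition omega where "omega x = C.eval_form (r_inv \<beta> (pt \<beta> \<one> \<one>\<^bsub>A \<beta>\<^esub> x))"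

lemma omega_linear: "omega \<in> linear_maps k (A \<one>) M"
proof -
  have "(\<lambda>x. pt \<beta> \<one> \<one>\<^bsub>A \<beta>\<^esub> x) \<in> linear_maps k (A \<one>) (AT \<beta> \<one>)"
    by (intro lin; simp)
  from linear_maps_comp[OF linear_maps_comp[OF C.eval_form_linear r_inv_linear[OF \<beta>]] this]
  show ?thesis unfolding omega_def[abs_def] .
qed

lemma omega_closed [simp]: "x \<in> carrier (A \<one>) \<Longrightarrow> omega x \<in> carrier M"
  by (rule linear_maps_closed[OF omega_linear])

declare C.lact_closed [simp] C.d_closed [simp]

text \<open>\<open>a S(x\<^sub>1) d(x\<^sub>2)\<close> is left linear in \<open>a\<close>, so
  \<open>a\<close> can be pulled out of the Sweedler sum.\<close>

lemma eval_form_r_inv_pure: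
  assumes a: "a \<in> carrier (A \<beta>)" and x: "x \<in> carrier (A \<one>)"
  shows "C.eval_form (r_inv \<beta> (pt \<beta> \<one> a x)) = lact M a (omega x)"
proof -
  have f: "(\<lambda>q. lact M a (C.eval_form q)) \<in> linear_maps k (AT \<beta> \<beta>) M"
    using a by (intro lin' C.eval_form_linear)
  have "C.eval_form (r_inv \<beta> (pt \<beta> \<one> a x))
    = sw M (inv \<beta>) \<beta> (\<lambda>s t. C.eval_form (pt \<beta> \<beta> (a \<otimes>\<^bsub>A \<beta>\<^esub> S (inv \<beta>) s) t)) x"
    using a x by (simp add: r_inv_pure) (intro linear_sw[OF _ _ _ _ C.eval_form_linear] lin; simp)
  \<comment> \<open>The unit is inserted because \<open>omega\<close> is defined through
    \<open>r_inv\<close> at \<open>1 \<otimes> x\<close>.\<close>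
  also have "\<dots> = sw M (inv \<beta>) \<beta> (\<lambda>s t. lact M a (C.eval_form (pt \<beta> \<beta> (\<one>\<^bsub>A \<beta>\<^esub> \<otimes>\<^bsub>A \<beta>\<^esub> S (inv \<beta>) s) t))) x"
    using a x by (intro sw_cong; simp add: C.eval_form_pure C.lact_assoc)
  also have "\<dots> = lact M a (C.eval_form (sw (AT \<beta> \<beta>) (inv \<beta>) \<beta> (\<lambda>s t. pt \<beta> \<beta> (\<one>\<^bsub>A \<beta>\<^esub> \<otimes>\<^bsub>A \<beta>\<^esub> S (inv \<beta>) s) t) x))"
    using a x by (intro linear_sw[OF _ _ _ _ f, symmetric] lin; simp)
  also have "\<dots> = lact M a (omega x)"
    using x by (simp add: omega_def r_inv_pure)
  finally show ?thesis .
qed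

lemma act_omega_bilinear: "(\<lambda>a x. lact M a (omega x)) \<in> bilinear_maps k (A \<beta>) (A \<one>) M"
  by (intro lin' linear_maps_comp[OF omega_linear]; simp)

lemma eval_form_r:
  assumes q: "q \<in> carrier (AT \<beta> \<beta>)"
  shows "C.eval_form q = tensor_lift M (\<lambda>a x. lact M a (omega x)) (r \<beta> q)"
proof -
  have z: "r \<beta> q \<in> carrier (AT \<beta> \<one>)" by (rule linear_maps_closed[OF r_linear[OF \<beta>] q])
  have "C.eval_form (r_inv \<beta> z) = tensor_lift M (\<lambda>a x. lact M a (omega x)) z" if "z \<in> carrier (AT \<beta> \<one>)" for z
    by (rule linear_maps_tensor_eqI[OF _ _ linear_maps_comp[OF C.eval_form_linear r_inv_linear[OF \<beta>]]
          tensor_lift_linear[OF _ _ _ act_omega_bilinear] _ that])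
       (auto simp: eval_form_r_inv_pure tensor_lift_pure[OF _ _ _ act_omega_bilinear])
  from this[OF z] show ?thesis using q by (simp add: r_inv_r)
qed

text \<open>\<open>omega\<close> determines \<open>d\<close> by
  \<open>db = b\<^sub>1 omega(b\<^sub>2)\<close>: evaluate at \<open>1 \<otimes> b\<close>, which
  \<open>r\<close> sends to \<open>\<Delta>(b)\<close>.\<close>

lemma d_eq_sw: "b \<in> carrier (A \<beta>) \<Longrightarrow> d b = sw M \<beta> \<one> (\<lambda>u x. lact M u (omega x)) b"
proof -
  assume b: "b \<in> carrier (A \<beta>)"
  have "d b = C.eval_form (pt \<beta> \<beta> \<one>\<^bsub>A \<beta>\<^esub> b)"
    using b by (simp add: C.eval_form_pure C.lact_one)
  also have "\<dots> = tensor_lift M (\<lambda>a x. lact M a (omega x)) (sw (AT \<beta> \<one>) \<beta> \<one> (\<lambda>u x. pt \<beta> \<one> (\<one>\<^bsub>A \<beta>\<^esub> \<otimes>\<^bsub>A \<beta>\<^esub> u) x) b)"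
    using b by (simp add: eval_form_r r_pure)
  also have "\<dots> = sw M \<beta> \<one> (\<lambda>u x. tensor_lift M (\<lambda>a x. lact M a (omega x)) (pt \<beta> \<one> (\<one>\<^bsub>A \<beta>\<^esub> \<otimes>\<^bsub>A \<beta>\<^esub> u) x)) b"
    using b by (intro linear_sw[OF _ _ _ _ tensor_lift_linear[OF _ _ _ act_omega_bilinear]] lin; simp)
  also have "\<dots> = sw M \<beta> \<one> (\<lambda>u x. lact M u (omega x)) b"
    using b by (intro sw_cong; simp add: tensor_lift_pure[OF _ _ _ act_omega_bilinear])
  finally show ?thesis .
qed

text \<open>\<open>omega(1) = S(1) d(1)\<close>, and \<open>d(1) = 0\<close> whatever
  \<open>S(1)\<close> is.\<close>

lemma omega_one: "omega \<one>\<^bsub>A \<one>\<^esub> = \<zero>\<^bsub>M\<^esub>"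
proof -
  have b: "(\<lambda>s t. pt \<beta> \<beta> (\<one>\<^bsub>A \<beta>\<^esub> \<otimes>\<^bsub>A \<beta>\<^esub> S (inv \<beta>) s) t) \<in> bilinear_maps k (A (inv \<beta>)) (A \<beta>) (AT \<beta> \<beta>)"
    by (intro lin; simp)
  have "omega \<one>\<^bsub>A \<one>\<^esub> = C.eval_form (pt \<beta> \<beta> (S (inv \<beta>) \<one>\<^bsub>A (inv \<beta>)\<^esub>) \<one>\<^bsub>A \<beta>\<^esub>)"
    using sw_one[OF _ _ _ b] by (simp add: omega_def r_inv_pure)
  also have "\<dots> = \<zero>\<^bsub>M\<^esub>" by (simp add: C.eval_form_pure C.d_one C.lact_zero)
  finally show ?thesis .
qed

abbreviation AM where "AM \<alpha> \<equiv> tensor_module k (A \<alpha>) M"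

lemma AM_module [simp]: "\<alpha> \<in> carrier \<pi> \<Longrightarrow> module k (AM \<alpha>)"
  by (intro tensor_module_module) auto

text \<open>
  The map \<open>u \<otimes> x \<mapsto> u\<^sub>1 \<otimes> u\<^sub>2 omega(x)\<close> is the coaction \<open>a db \<mapsto> \<Delta>(a) (id \<otimes> d) \<Delta>(b)\<close> read through \<open>r\<close>. Stated
  in this form it does not need the compatibility of the antipode with the comultiplication.
\<close>

definition coact where
  "coact \<alpha> = tensor_lift (AM \<alpha>) (\<lambda>u x. sw (AM \<alpha>) \<alpha> \<beta> (\<lambda>a b. pure_tensor k (A \<alpha>) M a (lact M b (omega x))) u)"

lemma coact_bilinear:
  "\<alpha> \<in> carrier \<pi> \<Longrightarrow> (\<lambda>u x. sw (AM \<alpha>) \<alpha> \<beta> (\<lambda>a b. pure_tensor k (A \<alpha>) M a (lact M b (omega x))) u)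
    \<in> bilinear_maps k (A (\<alpha> \<otimes> \<beta>)) (A \<one>) (AM \<alpha>)"
  by (intro lin' linear_maps_comp[OF omega_linear]; simp)

lemma coact_linear: "\<alpha> \<in> carrier \<pi> \<Longrightarrow> coact \<alpha> \<in> linear_maps k (AT (\<alpha> \<otimes> \<beta>) \<one>) (AM \<alpha>)"
  unfolding coact_def by (intro tensor_lift_linear coact_bilinear) auto

lemma coact_pure: "\<lbrakk>\<alpha> \<in> carrier \<pi>; u \<in> carrier (A (\<alpha> \<otimes> \<beta>)); x \<in> carrier (A \<one>)\<rbrakk>
    \<Longrightarrow> coact \<alpha> (pt (\<alpha> \<otimes> \<beta>) \<one> u x)
      = sw (AM \<alpha>) \<alpha> \<beta> (\<lambda>a b. pure_tensor k (A \<alpha>) M a (lact M b (omega x))) u"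
  unfolding coact_def by (simp add: tensor_lift_pure[OF _ _ _ coact_bilinear])

text \<open>\<open>a\<^sub>1 b\<^sub>1 \<otimes> a\<^sub>2 d(b\<^sub>2) = a\<^sub>1 b\<^sub>1
  \<otimes> a\<^sub>2 b\<^sub>2 omega(b\<^sub>3) = (a b\<^sub>1)\<^sub>1 \<otimes> (a
  b\<^sub>1)\<^sub>2 omega(b\<^sub>2)\<close>: \<open>d\<close> is expressed by
  \<open>omega\<close>, coassociativity groups the first two legs of \<open>b\<close>, and
  multiplicativity of \<open>\<Delta>\<close> merges them with the legs of \<open>a\<close>.\<close>

lemma coaction_eq:
  assumes \<alpha> [simp]: "\<alpha> \<in> carrier \<pi>" and a: "a \<in> carrier (A (\<alpha> \<otimes> \<beta>))" and b: "b \<in> carrier (A (\<alpha> \<otimes> \<beta>))"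
  shows "tensor_bimap k (A \<alpha>) M (monoid.mult (A \<alpha>)) (lact M) (\<Delta> \<alpha> \<beta> a)
      (tensor_map k (A \<alpha>) M id d (\<Delta> \<alpha> \<beta> b))
    = coact \<alpha> (r (\<alpha> \<otimes> \<beta>) (pt (\<alpha> \<otimes> \<beta>) (\<alpha> \<otimes> \<beta>) a b))"
proof -
  let ?T = "AM \<alpha>" and ?p = "pure_tensor k (A \<alpha>) M"
  have ab [simp]: "\<alpha> \<otimes> \<beta> \<in> carrier \<pi>" by simp
  note om = linear_maps_comp[OF omega_linear]
  let ?t = "sw ?T \<alpha> \<beta> (\<lambda>v w. ?p v (d w)) b"
  let ?\<phi> = "\<lambda>a1 a2 u1 u2 x. ?p (a1 \<otimes>\<^bsub>A \<alpha>\<^esub> u1) (lact M (a2 \<otimes>\<^bsub>A \<beta>\<^esub> u2) (omega x))"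
  have "tensor_bimap k (A \<alpha>) M (monoid.mult (A \<alpha>)) (lact M) (\<Delta> \<alpha> \<beta> a) (tensor_map k (A \<alpha>) M id d (\<Delta> \<alpha> \<beta> b))
    = sw ?T \<alpha> \<beta> (\<lambda>a1 a2. tensor_lift ?T (\<lambda>v w. ?p (a1 \<otimes>\<^bsub>A \<alpha>\<^esub> v) (lact M a2 w)) ?t) a"
    by (simp add: tensor_bimap_def tensor_map_def)
  also have "\<dots> = sw ?T \<alpha> \<beta> (\<lambda>a1 a2. sw ?T (\<alpha> \<otimes> \<beta>) \<one> (\<lambda>u x. sw ?T \<alpha> \<beta> (\<lambda>u1 u2. ?\<phi> a1 a2 u1 u2 x) u) b) a"
  proof (rule sw_cong)
    fix a1 a2 assume a12: "a1 \<in> carrier (A \<alpha>)" "a2 \<in> carrier (A \<beta>)"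
    show "sw ?T (\<alpha> \<otimes> \<beta>) \<one> (\<lambda>u x. sw ?T \<alpha> \<beta> (\<lambda>u1 u2. ?\<phi> a1 a2 u1 u2 x) u) b \<in> carrier ?T"
      using a12 b by (intro lin' om; simp)
    have bl: "(\<lambda>v w. ?p (a1 \<otimes>\<^bsub>A \<alpha>\<^esub> v) (lact M a2 w)) \<in> bilinear_maps k (A \<alpha>) M ?T"
      using a12 by (intro lin'; simp)
    have "tensor_lift ?T (\<lambda>v w. ?p (a1 \<otimes>\<^bsub>A \<alpha>\<^esub> v) (lact M a2 w)) ?t
      = sw ?T \<alpha> \<beta> (\<lambda>v w. tensor_lift ?T (\<lambda>v w. ?p (a1 \<otimes>\<^bsub>A \<alpha>\<^esub> v) (lact M a2 w)) (?p v (d w))) b"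
      using b by (intro linear_sw[OF _ _ _ _ tensor_lift_linear[OF _ _ _ bl]] lin'; simp)
    also have "\<dots> = sw ?T \<alpha> \<beta> (\<lambda>u1 v. sw ?T \<beta> \<one> (\<lambda>u2 x. ?\<phi> a1 a2 u1 u2 x) v) b"
    proof (rule sw_cong)
      fix v w assume vw: "v \<in> carrier (A \<alpha>)" "w \<in> carrier (A \<beta>)"
      show "sw ?T \<beta> \<one> (\<lambda>u2 x. ?\<phi> a1 a2 v u2 x) w \<in> carrier ?T"
        using a12 vw by (intro lin' om; simp)
      have f: "(\<lambda>m. ?p (a1 \<otimes>\<^bsub>A \<alpha>\<^esub> v) (lact M a2 m)) \<in> linear_maps k M ?T"
        using a12 vw by (intro lin'; simp)
      have "tensor_lift ?T (\<lambda>v w. ?p (a1 \<otimes>\<^bsub>A \<alpha>\<^esub> v) (lact M a2 w)) (?p v (d w)) = ?p (a1 \<otimes>\<^bsub>A \<alpha>\<^esub> v) (lact M a2 (d w))"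
        using vw by (simp add: tensor_lift_pure[OF _ _ _ bl])
      also have "\<dots> = ?p (a1 \<otimes>\<^bsub>A \<alpha>\<^esub> v) (lact M a2 (sw M \<beta> \<one> (\<lambda>u x. lact M u (omega x)) w))"
        by (simp only: d_eq_sw[OF vw(2)])
      also have "\<dots> = sw ?T \<beta> \<one> (\<lambda>u x. ?p (a1 \<otimes>\<^bsub>A \<alpha>\<^esub> v) (lact M a2 (lact M u (omega x)))) w"
        using vw by (intro linear_sw[OF _ _ _ _ f act_omega_bilinear]; simp)
      also have "\<dots> = sw ?T \<beta> \<one> (\<lambda>u2 x. ?\<phi> a1 a2 v u2 x) w"
        using a12 vw by (intro sw_cong; simp add: C.lact_assoc)
      finally show "tensor_lift ?T (\<lambda>v w. ?p (a1 \<otimes>\<^bsub>A \<alpha>\<^esub> v) (lact M a2 w)) (?p v (d w)) = sw ?T \<beta> \<one> (\<lambda>u2 x. ?\<phi> a1 a2 v u2 x) w" .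
    qed (use b in auto)
    also have "\<dots> = sw ?T (\<alpha> \<otimes> \<beta>) \<one> (\<lambda>u x. sw ?T \<alpha> \<beta> (\<lambda>u1 u2. ?\<phi> a1 a2 u1 u2 x) u) b"
      using a12 b by (intro sw_coassoc_one[symmetric] lin' om; simp)
    finally show "tensor_lift ?T (\<lambda>v w. ?p (a1 \<otimes>\<^bsub>A \<alpha>\<^esub> v) (lact M a2 w)) ?t
      = sw ?T (\<alpha> \<otimes> \<beta>) \<one> (\<lambda>u x. sw ?T \<alpha> \<beta> (\<lambda>u1 u2. ?\<phi> a1 a2 u1 u2 x) u) b" .
  qed (use a in auto)
  \<comment> \<open>The outer sums over \<open>\<Delta>(a)\<close> and \<open>\<Delta>(b)\<close>
    are interchanged, which brings the legs of \<open>a\<close> next to those of \<open>u\<close> so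
    that they combine to \<open>\<Delta>(a u)\<close>.\<close>
  also have "\<dots> = sw ?T (\<alpha> \<otimes> \<beta>) \<one> (\<lambda>u x. sw ?T \<alpha> \<beta> (\<lambda>a1 a2. sw ?T \<alpha> \<beta> (\<lambda>u1 u2. ?\<phi> a1 a2 u1 u2 x) u) a) b"
    using a b
    by (intro tensor_lift_swap[where k = k and V = "A \<alpha>" and W = "A \<beta>" and P = "A (\<alpha> \<otimes> \<beta>)" and Q = "A \<one>"] comult_closed lin' om; simp)
  also have "\<dots> = sw ?T (\<alpha> \<otimes> \<beta>) \<one> (\<lambda>u x. coact \<alpha> (pt (\<alpha> \<otimes> \<beta>) \<one> (a \<otimes>\<^bsub>A (\<alpha> \<otimes> \<beta>)\<^esub> u) x)) b"
  proof (rule sw_cong)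
    fix u x assume ux: "u \<in> carrier (A (\<alpha> \<otimes> \<beta>))" "x \<in> carrier (A \<one>)"
    show "coact \<alpha> (pt (\<alpha> \<otimes> \<beta>) \<one> (a \<otimes>\<^bsub>A (\<alpha> \<otimes> \<beta>)\<^esub> u) x) \<in> carrier ?T"
      using a ux by (intro linear_maps_closed[OF coact_linear]) auto
    have bl: "(\<lambda>a b. ?p a (lact M b (omega x))) \<in> bilinear_maps k (A \<alpha>) (A \<beta>) ?T"
      using ux by (intro lin'; simp)
    show "sw ?T \<alpha> \<beta> (\<lambda>a1 a2. sw ?T \<alpha> \<beta> (\<lambda>u1 u2. ?\<phi> a1 a2 u1 u2 x) u) a
      = coact \<alpha> (pt (\<alpha> \<otimes> \<beta>) \<one> (a \<otimes>\<^bsub>A (\<alpha> \<otimes> \<beta>)\<^esub> u) x)"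
      using sw_mult[OF _ \<alpha> \<beta> a ux(1) bl] a ux by (simp add: coact_pure)
  qed (use b in auto)
  also have "\<dots> = coact \<alpha> (r (\<alpha> \<otimes> \<beta>) (pt (\<alpha> \<otimes> \<beta>) (\<alpha> \<otimes> \<beta>) a b))"
    using a b by (simp add: r_pure) (intro linear_sw[OF _ _ _ _ coact_linear, symmetric] lin; simp)
  finally show ?thesis .
qed

end

text \<open>On \<open>a \<otimes> b\<close> both sides are the class of
  \<open>a D(b) = a \<otimes> b - ab \<otimes> 1\<close>.\<close>

lemma (in assoc_algebra) quotient_eval_form:
  assumes "sub_bimodule k A U N" and q: "q \<in> carrier T"
  shows "fodc.eval_form (quotient_bimod U N) (\<lambda>b. N +>\<^bsub>U\<^esub> universal_d k A b) q
    = N +>\<^bsub>U\<^esub> (q \<ominus>\<^bsub>T\<^esub> tens (mult_map A q) \<one>\<^bsub>A\<^esub>)"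
proof -
  interpret S: sub_bimodule k A U N by fact
  interpret Q: fodc k A S.Q "\<lambda>b. S.proj (universal_d k A b)"
    by (rule S.Q_fodc[OF universal_fodc])
  show ?thesis
  proof (rule tensor_ext[OF Q.eval_form_linear linear_maps_comp[OF S.proj_linear universal_part_linear] _ q])
    fix a b assume ab: "a \<in> carrier A" "b \<in> carrier A"
    have "lact U a (universal_d k A b) = tens a b \<ominus>\<^bsub>T\<^esub> tens (a \<otimes>\<^bsub>A\<^esub> b) \<one>\<^bsub>A\<^esub>"
      using ab unfolding universal_d_def
      by (subst linear_maps_minus[OF lact_linear AA.T_module AA.T_module]) (auto simp: lact_pure AA.pure_closed)
    then show "Q.eval_form (tens a b)
      = S.proj (tens a b \<ominus>\<^bsub>T\<^esub> tens (mult_map A (tens a b)) \<one>\<^bsub>A\<^esub>)"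
      using ab by (simp add: Q.eval_form_pure S.proj_lact universal_d_closed mult_map_pure)
  qed
qed

context hopf_fodc
begin

lemma coact_vanish:
  assumes "\<alpha> \<in> carrier \<pi>" "u \<in> carrier (A (\<alpha> \<otimes> \<beta>))" "x \<in> carrier (A \<one>)" "omega x = \<zero>\<^bsub>M\<^esub>"
  shows "coact \<alpha> (pt (\<alpha> \<otimes> \<beta>) \<one> u x) = \<zero>\<^bsub>AM \<alpha>\<^esub>"
proof -
  interpret T: module k "AM \<alpha>" using assms by simp
  have f: "(\<lambda>u. \<zero>\<^bsub>AM \<alpha>\<^esub>) \<in> linear_maps k V (AM \<alpha>)" for V :: "('k, 'a) module"
    by (rule linear_mapsI) auto
  have z: "pure_tensor k (A \<alpha>) M a \<zero>\<^bsub>M\<^esub> = \<zero>\<^bsub>AM \<alpha>\<^esub>" if "a \<in> carrier (A \<alpha>)" for a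
    by (rule linear_maps_zero[OF bilinear_maps_right[OF pure_tensor_bilinear that]]) (use assms in auto)
  have c0: "(\<lambda>a b. \<zero>\<^bsub>AM \<alpha>\<^esub>) \<in> bilinear_maps k (A \<alpha>) (A \<beta>) (AM \<alpha>)" by (intro bilinear_mapsI f)
  have "coact \<alpha> (pt (\<alpha> \<otimes> \<beta>) \<one> u x) = sw (AM \<alpha>) \<alpha> \<beta> (\<lambda>a b. \<zero>\<^bsub>AM \<alpha>\<^esub>) u"
    using assms by (simp add: coact_pure) (intro sw_cong; simp add: z C.lact_zero)
  \<comment> \<open>The lift of the zero map is recognised as zero by pulling the scalar 0 out of
    it.\<close>
  also have "\<dots> = sw (AM \<alpha>) \<alpha> \<beta> (\<lambda>a b. \<zero>\<^bsub>k\<^esub> \<odot>\<^bsub>AM \<alpha>\<^esub> \<zero>\<^bsub>AM \<alpha>\<^esub>) u" by simp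
  also have "\<dots> = \<zero>\<^bsub>k\<^esub> \<odot>\<^bsub>AM \<alpha>\<^esub> sw (AM \<alpha>) \<alpha> \<beta> (\<lambda>a b. \<zero>\<^bsub>AM \<alpha>\<^esub>) u"
    using assms
    by (intro linear_sw[symmetric, OF _ _ _ _ _ c0] linear_maps_smult_right linear_maps_id) auto
  also have "\<dots> = \<zero>\<^bsub>AM \<alpha>\<^esub>"
    using sw_closed[OF _ assms(1) \<beta> c0 assms(2)] assms(1) by simp
  finally show ?thesis .
qed

text \<open>The sum in the conclusion of \<open>left_covariant\<close> is a linear function of the
  tensor \<open>\<Sum> a\<^sub>j \<otimes> b\<^sub>j\<close>; the sum in its premise is
  \<open>eval_form\<close> of the analogous tensor. Covariance thus compares two kernels.\<close>

lemma sum_coaction: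
  assumes \<alpha> [simp]: "\<alpha> \<in> carrier \<pi>"
    and a: "a \<in> {..<n::nat} \<rightarrow> carrier (A (\<alpha> \<otimes> \<beta>))" and b: "b \<in> {..<n} \<rightarrow> carrier (A (\<alpha> \<otimes> \<beta>))"
  shows "(\<Oplus>\<^bsub>AM \<alpha>\<^esub>j\<in>{..<n}. tensor_bimap k (A \<alpha>) M (monoid.mult (A \<alpha>)) (lact M) (\<Delta> \<alpha> \<beta> (a j))
      (tensor_map k (A \<alpha>) M id d (\<Delta> \<alpha> \<beta> (b j))))
    = coact \<alpha> (r (\<alpha> \<otimes> \<beta>) (\<Oplus>\<^bsub>AT (\<alpha> \<otimes> \<beta>) (\<alpha> \<otimes> \<beta>)\<^esub>j\<in>{..<n}.
        pt (\<alpha> \<otimes> \<beta>) (\<alpha> \<otimes> \<beta>) (a j) (b j)))"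
proof -
  have ab [simp]: "\<alpha> \<otimes> \<beta> \<in> carrier \<pi>" by simp
  interpret T: module k "AM \<alpha>" by simp
  note f = linear_maps_comp[OF coact_linear[OF \<alpha>] r_linear[OF ab]]
  have p: "pt (\<alpha> \<otimes> \<beta>) (\<alpha> \<otimes> \<beta>) (a j) (b j) \<in> carrier (AT (\<alpha> \<otimes> \<beta>) (\<alpha> \<otimes> \<beta>))" if "j < n" for j
    using a b that by (auto simp: Pi_iff)
  have "coact \<alpha> (r (\<alpha> \<otimes> \<beta>) (\<Oplus>\<^bsub>AT (\<alpha> \<otimes> \<beta>) (\<alpha> \<otimes> \<beta>)\<^esub>j\<in>{..<n}.
        pt (\<alpha> \<otimes> \<beta>) (\<alpha> \<otimes> \<beta>) (a j) (b j)))
    = (\<Oplus>\<^bsub>AM \<alpha>\<^esub>j\<in>{..<n}. coact \<alpha> (r (\<alpha> \<otimes> \<beta>) (pt (\<alpha> \<otimes> \<beta>) (\<alpha> \<otimes> \<beta>) (a j) (b j))))"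
    using p by (intro linear_maps_finsum[OF f]) auto
  also have "\<dots> = (\<Oplus>\<^bsub>AM \<alpha>\<^esub>j\<in>{..<n}. tensor_bimap k (A \<alpha>) M (monoid.mult (A \<alpha>)) (lact M) (\<Delta> \<alpha> \<beta> (a j))
      (tensor_map k (A \<alpha>) M id d (\<Delta> \<alpha> \<beta> (b j))))"
    using a b p linear_maps_closed[OF f]
    by (intro T.finsum_cong'[OF refl]) (auto simp: coaction_eq Pi_iff)
  finally show ?thesis ..
qed

text \<open>
  Here \<open>coact\<close> gives \<open>1 \<otimes> omega x\<close>. Applying \<open>a \<otimes> m \<mapsto> S(a) m\<close> recovers \<open>omega x\<close>, even if some of the
  algebras are zero.
\<close>

lemma coact_unit:
  assumes x: "x \<in> carrier (A \<one>)" and z: "coact (inv \<beta>) (pt \<one> \<one> \<one>\<^bsub>A \<one>\<^esub> x) = \<zero>\<^bsub>AM (inv \<beta>)\<^esub>"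
  shows "omega x = \<zero>\<^bsub>M\<^esub>"
proof -
  have bl: "(\<lambda>a b. pure_tensor k (A (inv \<beta>)) M a (lact M b (omega x))) \<in> bilinear_maps k (A (inv \<beta>)) (A \<beta>) (AM (inv \<beta>))"
    using x by (intro lin'; simp)
  have p: "pure_tensor k (A (inv \<beta>)) M \<one>\<^bsub>A (inv \<beta>)\<^esub> (omega x) = \<zero>\<^bsub>AM (inv \<beta>)\<^esub>"
    using z coact_pure[of "inv \<beta>" "\<one>\<^bsub>A \<one>\<^esub>" x] sw_one[OF _ _ _ bl] x by (simp add: C.lact_one)
  have s: "(\<lambda>a m. lact M (S (inv \<beta>) a) m) \<in> bilinear_maps k (A (inv \<beta>)) M M"
    by (intro lin'; simp)
  have s1: "(\<lambda>a b. S (inv \<beta>) a \<otimes>\<^bsub>A \<beta>\<^esub> b) \<in> bilinear_maps k (A (inv \<beta>)) (A \<beta>) (A \<beta>)"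
    by (intro lin'; simp)
  interpret B: module k "A \<beta>" by simp
  \<comment> \<open>The antipode axiom at 1, with \<open>\<Delta>(1) = 1 \<otimes> 1\<close>, reads
    \<open>S(1) 1 = \<epsilon>(1) 1\<close>.\<close>
  have "S (inv \<beta>) \<one>\<^bsub>A (inv \<beta>)\<^esub> = \<one>\<^bsub>A \<beta>\<^esub>"
    using sw_antipode_left[OF _ \<beta> linear_maps_id[OF refl], of "\<one>\<^bsub>A \<one>\<^esub>"] sw_one[OF _ _ _ s1]
    by (simp add: counit_one)
  then have "omega x = tensor_lift M (\<lambda>a m. lact M (S (inv \<beta>) a) m) (pure_tensor k (A (inv \<beta>)) M \<one>\<^bsub>A (inv \<beta>)\<^esub> (omega x))"
    using x by (simp add: tensor_lift_pure[OF _ _ _ s] C.lact_one)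
  also have "\<dots> = \<zero>\<^bsub>M\<^esub>"
    unfolding p by (rule linear_maps_zero[OF tensor_lift_linear[OF _ _ _ s]]) auto
  finally show ?thesis .
qed

end

section \<open>Cancelling the coaction with values in degree one\<close>

lemma (in hopf_group_coalgebra) antipode_one_linear: "S \<one> \<in> linear_maps k (A \<one>) (A \<one>)"
  using antipode_inv_linear[of \<one>] by simp

text \<open>For \<open>\<beta> = \<one>\<close> the coaction takes \<open>u\<close> from
  \<open>A \<alpha>\<close> and leaves a leg in \<open>A \<alpha>\<close>, which
  \<open>\<Delta> \<alpha> \<one>\<close> can split again; then the antipode of
  \<open>A \<one>\<close> can cancel the action on \<open>M\<close>.\<close>

locale hopf_fodc_one = hopf_fodc k \<pi> A \<Delta> \<epsilon> S "\<one>\<^bsub>\<pi>\<^esub>" M d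
  for k :: "'k ring" and \<pi> :: "'g monoid" (structure) and A :: "'g \<Rightarrow> ('k, 'a) module" and \<Delta> \<epsilon> S
    and M :: "('k, 'a, 'm) bimod" and d
begin

text \<open>The map \<open>u \<otimes> m \<mapsto> u\<^sub>1 \<otimes> S(u\<^sub>2) m\<close> is inverse to \<open>u \<otimes> m \<mapsto> u\<^sub>1 \<otimes> u\<^sub>2 m\<close>.\<close>

definition cut where
  "cut \<alpha> = tensor_lift (AM \<alpha>) (\<lambda>u m. sw (AM \<alpha>) \<alpha> \<one> (\<lambda>s t. pure_tensor k (A \<alpha>) M s (lact M (S \<one> t) m)) u)"

lemma antipode_one_closed [simp]: "x \<in> carrier (A \<one>) \<Longrightarrow> S \<one> x \<in> carrier (A \<one>)"
  by (rule linear_maps_closed[OF antipode_one_linear])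

lemmas lin1 = lin' linear_maps_comp[OF antipode_one_linear] linear_maps_comp[OF omega_linear]

lemma cut_bilinear: "\<alpha> \<in> carrier \<pi> \<Longrightarrow> (\<lambda>u m. sw (AM \<alpha>) \<alpha> \<one> (\<lambda>s t. pure_tensor k (A \<alpha>) M s (lact M (S \<one> t) m)) u)
    \<in> bilinear_maps k (A \<alpha>) M (AM \<alpha>)"
  by (intro lin1; simp)

lemma id_omega_bilinear: "\<alpha> \<in> carrier \<pi> \<Longrightarrow> (\<lambda>a x. pure_tensor k (A \<alpha>) M a (omega x)) \<in> bilinear_maps k (A \<alpha>) (A \<one>) (AM \<alpha>)"
  by (intro lin1; simp)

text \<open>\<open>a\<^sub>1 \<otimes> S(a\<^sub>2) a\<^sub>3 omega(x) = a\<^sub>1 \<otimes>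
  \<epsilon>(a\<^sub>2) omega(x) = a \<otimes> omega(x)\<close>, using coassociativity, the antipode
  and the counit in turn.\<close>

lemma cut_coact_pure:
  assumes \<alpha> [simp]: "\<alpha> \<in> carrier \<pi>" and a: "a \<in> carrier (A \<alpha>)" and x: "x \<in> carrier (A \<one>)"
  shows "cut \<alpha> (coact \<alpha> (pt \<alpha> \<one> a x)) = pure_tensor k (A \<alpha>) M a (omega x)"
proof -
  let ?T = "AM \<alpha>" and ?p = "pure_tensor k (A \<alpha>) M"
  have T: "module k ?T" by simp
  have cl: "cut \<alpha> \<in> linear_maps k ?T ?T"
    unfolding cut_def by (intro tensor_lift_linear cut_bilinear) auto
  have "cut \<alpha> (coact \<alpha> (pt \<alpha> \<one> a x)) = cut \<alpha> (sw ?T \<alpha> \<one> (\<lambda>a b. ?p a (lact M b (omega x))) a)"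
    using coact_pure[of \<alpha> a x] a x by simp
  also have "\<dots> = sw ?T \<alpha> \<one> (\<lambda>u v. cut \<alpha> (?p u (lact M v (omega x)))) a"
    using a x by (intro linear_sw[OF _ _ _ _ cl] lin1; simp)
  also have "\<dots> = sw ?T \<alpha> \<one> (\<lambda>u v. sw ?T \<alpha> \<one> (\<lambda>s t. ?p s (lact M (S \<one> t \<otimes>\<^bsub>A \<one>\<^esub> v) (omega x))) u) a"
  proof (rule sw_cong)
    fix u v assume uv: "u \<in> carrier (A \<alpha>)" "v \<in> carrier (A \<one>)"
    show "sw ?T \<alpha> \<one> (\<lambda>s t. ?p s (lact M (S \<one> t \<otimes>\<^bsub>A \<one>\<^esub> v) (omega x))) u \<in> carrier ?T"
      using uv x by (intro lin1; simp)
    show "cut \<alpha> (?p u (lact M v (omega x))) = sw ?T \<alpha> \<one> (\<lambda>s t. ?p s (lact M (S \<one> t \<otimes>\<^bsub>A \<one>\<^esub> v) (omega x))) u"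
      using uv x unfolding cut_def
      by (simp add: tensor_lift_pure[OF _ _ _ cut_bilinear]) (intro sw_cong; simp add: C.lact_assoc)
  qed (use a in auto)
  also have "\<dots> = sw ?T (\<alpha> \<otimes> \<one>) \<one> (\<lambda>u v. sw ?T \<alpha> \<one> (\<lambda>s t. ?p s (lact M (S \<one> t \<otimes>\<^bsub>A \<one>\<^esub> v) (omega x))) u) a"
    by simp
  also have "\<dots> = sw ?T \<alpha> \<one> (\<lambda>s y. sw ?T \<one> \<one> (\<lambda>t v. ?p s (lact M (S \<one> t \<otimes>\<^bsub>A \<one>\<^esub> v) (omega x))) y) a"
    using a x by (intro sw_coassoc_one lin1; simp)
  also have "\<dots> = sw ?T \<alpha> \<one> (\<lambda>s y. \<epsilon> y \<odot>\<^bsub>?T\<^esub> ?p s (omega x)) a"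
  proof (rule sw_cong)
    interpret T: module k ?T by simp
    fix s y assume sy: "s \<in> carrier (A \<alpha>)" "y \<in> carrier (A \<one>)"
    have "(\<lambda>b. ?p s (lact M b (omega x))) \<in> linear_maps k (A \<one>) ?T" using sy x by (intro lin1; simp)
    from sw_antipode_left[OF T one_closed this sy(2)]
    show "sw ?T \<one> \<one> (\<lambda>t v. ?p s (lact M (S \<one> t \<otimes>\<^bsub>A \<one>\<^esub> v) (omega x))) y = \<epsilon> y \<odot>\<^bsub>?T\<^esub> ?p s (omega x)"
      using x by (simp add: C.lact_one)
    show "\<epsilon> y \<odot>\<^bsub>?T\<^esub> ?p s (omega x) \<in> carrier ?T" using sy x by simp
  qed (use a in auto)
  also have "\<dots> = ?p a (omega x)"
    using a x by (intro sw_counit_right lin1; simp)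
  finally show ?thesis .
qed

text \<open>The counit condition is imposed separately because \<open>omega(1) = 0\<close> although
  \<open>\<epsilon>(1) = 1\<close>.\<close>

definition R where "R = {x \<in> carrier (A \<one>). omega x = \<zero>\<^bsub>M\<^esub> \<and> \<epsilon> x = \<zero>\<^bsub>k\<^esub>}"

text \<open>Cancelling with \<open>cut\<close> gives \<open>(id \<otimes> omega) z = 0\<close>,
  hence \<open>z\<close> lies in \<open>A \<otimes> ker omega\<close> by exactness. The counit
  hypothesis then has to improve \<open>ker omega\<close> to its intersection with
  \<open>ker \<epsilon>\<close>.\<close>

lemma coact_kernel:
  assumes \<alpha> [simp]: "\<alpha> \<in> carrier \<pi>" and z: "z \<in> carrier (AT \<alpha> \<one>)"
    and "coact \<alpha> z = \<zero>\<^bsub>AM \<alpha>\<^esub>" and e: "id_counit \<alpha> z = \<zero>\<^bsub>A \<alpha>\<^esub>"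
  shows "z \<in> tensor_subspace k (A \<alpha>) (A \<one>) R"
proof -
  interpret B: module k "A \<alpha>" by simp
  interpret B1: module k "A \<one>" by simp
  interpret P: two_modules k "A \<alpha>" "A \<one>" by (rule two_modulesI) auto
  have cl: "cut \<alpha> \<in> linear_maps k (AM \<alpha>) (AM \<alpha>)"
    unfolding cut_def by (intro tensor_lift_linear cut_bilinear) auto
  have "tensor_lift (AM \<alpha>) (\<lambda>a x. pure_tensor k (A \<alpha>) M a (omega x)) z = cut \<alpha> (coact \<alpha> z)"
  proof (rule linear_maps_tensor_eqI[OF _ _ tensor_lift_linear[OF _ _ _ id_omega_bilinear]
          linear_maps_comp[OF cl] _ z])
    show "coact \<alpha> \<in> linear_maps k (AT \<alpha> \<one>) (AM \<alpha>)" using coact_linear[OF \<alpha>] by simp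
  qed (auto simp: tensor_lift_pure[OF _ _ _ id_omega_bilinear] cut_coact_pure)
  also have "\<dots> = \<zero>\<^bsub>AM \<alpha>\<^esub>"
    unfolding assms(3) by (rule linear_maps_zero[OF cl]) auto
  finally have K: "z \<in> tensor_subspace k (A \<alpha>) (A \<one>) {x \<in> carrier (A \<one>). omega x = \<zero>\<^bsub>M\<^esub>}"
    using z by (intro tensor_kernel_exact[OF field_axioms _ _ _ omega_linear]) auto
  \<comment> \<open>\<open>p\<close> sends \<open>a \<otimes> x\<close> to
    \<open>a \<otimes> (x - \<epsilon>(x) 1)\<close>. As \<open>omega(1) = 0\<close>, this maps
    \<open>A \<otimes> ker omega\<close> into \<open>A \<otimes> R\<close>, while \<open>p\<close>
    fixes \<open>z\<close> because \<open>(id \<otimes> \<epsilon>) z = 0\<close>.\<close>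
  define p where "p z = z \<ominus>\<^bsub>AT \<alpha> \<one>\<^esub> pt \<alpha> \<one> (id_counit \<alpha> z) \<one>\<^bsub>A \<one>\<^esub>" for z
  have p: "p \<in> linear_maps k (AT \<alpha> \<one>) (AT \<alpha> \<one>)"
    unfolding p_def[abs_def] by (intro linear_maps_minus_fun lin id_counit_linear) auto
  have R: "R \<subseteq> carrier (A \<one>)" by (auto simp: R_def)
  have "p z \<in> tensor_subspace k (A \<alpha>) (A \<one>) R"
  proof (rule linear_maps_tensor_subspace[OF _ _ _ _ p _ _ K])
    show "subgroup (tensor_subspace k (A \<alpha>) (A \<one>) R) (add_monoid (AT \<alpha> \<one>))"
      using R by (intro tensor_subspace_subgroup) auto
    fix a x assume a: "a \<in> carrier (A \<alpha>)" and "x \<in> {x \<in> carrier (A \<one>). omega x = \<zero>\<^bsub>M\<^esub>}"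
    then have x: "x \<in> carrier (A \<one>)" "omega x = \<zero>\<^bsub>M\<^esub>" by auto
    define y where "y = x \<oplus>\<^bsub>A \<one>\<^esub> (\<ominus>\<^bsub>k\<^esub> \<epsilon> x) \<odot>\<^bsub>A \<one>\<^esub> \<one>\<^bsub>A \<one>\<^esub>"
    have "omega y = \<zero>\<^bsub>M\<^esub>"
      using x by (simp add: y_def linear_maps_add[OF omega_linear] linear_maps_smult[OF omega_linear] omega_one
          C.Bim.smult_r_null)
    moreover have "\<epsilon> y = \<zero>\<^bsub>k\<^esub>"
      using x by (simp add: y_def counit_add counit_linear counit_one r_neg)
    ultimately have y: "y \<in> R" using x by (simp add: R_def y_def)
    have "p (pt \<alpha> \<one> a x) = pt \<alpha> \<one> a y"
      using a x
      by (simp add: p_def y_def id_counit_pure P.pure_add_right P.pure_balanced[symmetric] B.smult_l_minus P.pure_neg a_minus_def)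
    then show "p (pt \<alpha> \<one> a x) \<in> tensor_subspace k (A \<alpha>) (A \<one>) R"
      using pure_in_tensor_subspace[OF a y] by simp
  qed auto
  moreover have "p z = z"
    using z e by (simp add: p_def P.pure_zero P.T.minus_zero_right)
  ultimately show ?thesis by simp
qed

end

section \<open>Right ideals and left covariant calculi\<close>

locale hopf_right_ideal = hopf_group_coalgebra k \<pi> A \<Delta> \<epsilon> S
  for k :: "'k ring" and \<pi> :: "'g monoid" (structure) and A :: "'g \<Rightarrow> ('k, 'a) module" and \<Delta> \<epsilon> S +
  fixes R
  assumes R_ideal: "right_ideal R (A \<one>\<^bsub>\<pi>\<^esub>)" and R_kernel: "R \<subseteq> a_kernel (A \<one>\<^bsub>\<pi>\<^esub>) k \<epsilon>"
begin

abbreviation N where "N \<alpha> \<equiv> N_of k \<pi> A \<Delta> R \<alpha>"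
abbreviation AR where "AR \<alpha> \<equiv> tensor_subspace k (A \<alpha>) (A \<one>) R"

lemma R_subset: "R \<subseteq> carrier (A \<one>)" and R_counit: "x \<in> R \<Longrightarrow> \<epsilon> x = \<zero>\<^bsub>k\<^esub>"
  using R_kernel by (auto simp: a_kernel_def')

lemma AR_subgroup: "\<alpha> \<in> carrier \<pi> \<Longrightarrow> subgroup (AR \<alpha>) (add_monoid (AT \<alpha> \<one>))"
  by (intro tensor_subspace_subgroup R_subset) auto

lemma N_mem: "q \<in> N \<alpha> \<longleftrightarrow> q \<in> carrier (AT \<alpha> \<alpha>) \<and> r \<alpha> q \<in> AR \<alpha>"
  by (simp add: N_of_def)

text \<open>\<open>N_of\<close> is a preimage in all of \<open>A \<otimes> A\<close>, so product
  zero is not built in. It holds because id \<otimes> \<epsilon> kills \<open>A \<otimes> R\<close>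
  and is the multiplication when read through \<open>r\<close>.\<close>

lemma N_universal:
  assumes \<alpha>: "\<alpha> \<in> carrier \<pi>" and q: "q \<in> N \<alpha>"
  shows "q \<in> carrier (universal_bimod k (A \<alpha>))"
proof -
  interpret B: assoc_algebra k "A \<alpha>" by (rule algebras[OF \<alpha>])
  have "id_counit \<alpha> (r \<alpha> q) = \<zero>\<^bsub>A \<alpha>\<^esub>"
  proof (rule linear_maps_tensor_subspace_zero[OF _ _ _ R_subset id_counit_linear])
    show "r \<alpha> q \<in> AR \<alpha>" using q by (simp add: N_mem)
    fix a x assume "a \<in> carrier (A \<alpha>)" "x \<in> R"
    then show "id_counit \<alpha> (pt \<alpha> \<one> a x) = \<zero>\<^bsub>A \<alpha>\<^esub>"
      using \<alpha> subsetD[OF R_subset] by (simp add: id_counit_pure R_counit)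
  qed (use \<alpha> in auto)
  then show ?thesis using q \<alpha> by (simp add: N_mem B.carrier_U id_counit_r)
qed

text \<open>Through \<open>r\<close> the left action of \<open>c\<close> is
  \<open>v \<otimes> s \<mapsto> cv \<otimes> s\<close>, and the right action is
  \<open>v \<otimes> s \<mapsto> v c\<^sub>1 \<otimes> s c\<^sub>2\<close>, where
  \<open>s c\<^sub>2\<close> stays in the right ideal \<open>R\<close>.\<close>

lemma N_sub_bimodule:
  assumes \<alpha> [simp]: "\<alpha> \<in> carrier \<pi>"
  shows "sub_bimodule k (A \<alpha>) (universal_bimod k (A \<alpha>)) (N \<alpha>)"
proof -
  interpret B: assoc_algebra k "A \<alpha>" by (rule algebras[OF \<alpha>])
  interpret AR: subgroup "AR \<alpha>" "add_monoid (AT \<alpha> \<one>)" by (rule AR_subgroup[OF \<alpha>])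
  show ?thesis
  proof (intro sub_bimodule.intro B.U_bimodule additive_subgroup.intro sub_bimodule_axioms.intro subgroup.intro)
    show "N \<alpha> \<subseteq> carrier (add_monoid B.U)" using N_universal by auto
    show "\<one>\<^bsub>add_monoid B.U\<^esub> \<in> N \<alpha>"
      using linear_maps_zero[OF r_linear[OF \<alpha>]] AR.one_closed by (simp add: N_mem)
  next
    fix x y assume "x \<in> N \<alpha>" "y \<in> N \<alpha>"
    then show "x \<otimes>\<^bsub>add_monoid B.U\<^esub> y \<in> N \<alpha>"
      using AR.m_closed by (simp add: N_mem linear_maps_add[OF r_linear[OF \<alpha>]])
  next
    fix x assume x: "x \<in> N \<alpha>"
    then have xT: "x \<in> carrier (AT \<alpha> \<alpha>)" "r \<alpha> x \<in> AR \<alpha>" by (auto simp: N_mem)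
    have "inv\<^bsub>add_monoid B.U\<^esub> x = \<ominus>\<^bsub>AT \<alpha> \<alpha>\<^esub> x"
      using linear_maps_a_inv[OF B.U_subset B.U_module B.AA.T_module N_universal[OF \<alpha> x]] by (simp add: a_inv_def)
    moreover have "r \<alpha> (\<ominus>\<^bsub>AT \<alpha> \<alpha>\<^esub> x) = \<ominus>\<^bsub>AT \<alpha> \<one>\<^esub> r \<alpha> x"
      using linear_maps_a_inv[OF r_linear[OF \<alpha>] _ _ xT(1)] by simp
    moreover have "\<ominus>\<^bsub>AT \<alpha> \<one>\<^esub> r \<alpha> x \<in> AR \<alpha>"
      using AR.m_inv_closed[OF xT(2)] by (simp add: a_inv_def)
    ultimately show "inv\<^bsub>add_monoid B.U\<^esub> x \<in> N \<alpha>" using xT(1) by (simp add: N_mem)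
  next
    fix c x assume c: "c \<in> carrier (A \<alpha>)" and "x \<in> N \<alpha>"
    then have x: "x \<in> carrier (AT \<alpha> \<alpha>)" "r \<alpha> x \<in> AR \<alpha>" by (auto simp: N_mem)
    have bl: "(\<lambda>a x. pt \<alpha> \<one> (c \<otimes>\<^bsub>A \<alpha>\<^esub> a) x) \<in> bilinear_maps k (A \<alpha>) (A \<one>) (AT \<alpha> \<one>)"
      using c by (intro lin; simp)
    have "r \<alpha> (lact B.U c x) \<in> AR \<alpha>"
      unfolding r_lact[OF \<alpha> x(1) c]
    proof (rule linear_maps_tensor_subspace[OF _ _ _ R_subset tensor_lift_linear[OF _ _ _ bl] AR_subgroup[OF \<alpha>] _ x(2)])
      fix v s assume "v \<in> carrier (A \<alpha>)" "s \<in> R"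
      then show "tensor_lift (AT \<alpha> \<one>) (\<lambda>a x. pt \<alpha> \<one> (c \<otimes>\<^bsub>A \<alpha>\<^esub> a) x) (pt \<alpha> \<one> v s) \<in> AR \<alpha>"
        using c R_subset by (subst tensor_lift_pure[OF _ _ _ bl]) (auto intro!: pure_in_tensor_subspace)
    qed auto
    then show "lact B.U c x \<in> N \<alpha>" using x c B.lact_T_closed by (simp add: N_mem)
    let ?\<phi> = "\<lambda>a x. sw (AT \<alpha> \<one>) \<alpha> \<one> (\<lambda>u v. pt \<alpha> \<one> (a \<otimes>\<^bsub>A \<alpha>\<^esub> u) (x \<otimes>\<^bsub>A \<one>\<^esub> v)) c"
    have bl: "?\<phi> \<in> bilinear_maps k (A \<alpha>) (A \<one>) (AT \<alpha> \<one>)"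
      using c by (intro lin; simp)
    have "r \<alpha> (ract B.U x c) \<in> AR \<alpha>"
      unfolding r_ract[OF \<alpha> x(1) c]
    proof (rule linear_maps_tensor_subspace[OF _ _ _ R_subset tensor_lift_linear[OF _ _ _ bl] AR_subgroup[OF \<alpha>] _ x(2)])
      fix v s assume v: "v \<in> carrier (A \<alpha>)" and s: "s \<in> R"
      then have s': "s \<in> carrier (A \<one>)" using R_subset by blast
      have "?\<phi> v s \<in> AR \<alpha>"
      proof (rule tensor_lift_in_subgroup[OF _ _ _ AR_subgroup[OF \<alpha>]])
        show "\<Delta> \<alpha> \<one> c \<in> carrier (AT \<alpha> \<one>)" using comult_closed[of \<alpha> \<one> c] c by simp
        show "(\<lambda>u w. pt \<alpha> \<one> (v \<otimes>\<^bsub>A \<alpha>\<^esub> u) (s \<otimes>\<^bsub>A \<one>\<^esub> w)) \<in> bilinear_maps k (A \<alpha>) (A \<one>) (AT \<alpha> \<one>)"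
          using v s' by (intro lin; simp)
        fix u w assume "u \<in> carrier (A \<alpha>)" "w \<in> carrier (A \<one>)"
        then show "pt \<alpha> \<one> (v \<otimes>\<^bsub>A \<alpha>\<^esub> u) (s \<otimes>\<^bsub>A \<one>\<^esub> w) \<in> AR \<alpha>"
          using v s R_ideal by (intro pure_in_tensor_subspace) (auto simp: right_ideal_def)
      qed auto
      then show "tensor_lift (AT \<alpha> \<one>) ?\<phi> (pt \<alpha> \<one> v s) \<in> AR \<alpha>"
        using v s' by (subst tensor_lift_pure[OF _ _ _ bl]) auto
    qed auto
    then show "ract B.U x c \<in> N \<alpha>" using x c B.ract_T_closed by (simp add: N_mem)
  qed
qed

lemma Gamma_fodc:
  assumes "\<alpha> \<in> carrier \<pi>"
  shows "fodc k (A \<alpha>) (Gamma_of k \<pi> A \<Delta> R \<alpha>) (d_of k \<pi> A \<Delta> R \<alpha>)"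
  using sub_bimodule.Q_fodc[OF N_sub_bimodule[OF assms] assoc_algebra.universal_fodc[OF algebras[OF assms]]]
  by (simp add: Gamma_of_def d_of_def[abs_def])

lemma Gamma_eval_form:
  assumes "\<alpha> \<in> carrier \<pi>" "q \<in> carrier (AT \<alpha> \<alpha>)"
  shows "fodc.eval_form (Gamma_of k \<pi> A \<Delta> R \<alpha>) (d_of k \<pi> A \<Delta> R \<alpha>) q = N \<alpha> +>\<^bsub>universal_bimod k (A \<alpha>)\<^esub>
    (q \<ominus>\<^bsub>AT \<alpha> \<alpha>\<^esub> pt \<alpha> \<alpha> (mult_map (A \<alpha>) q) \<one>\<^bsub>A \<alpha>\<^esub>)"
  using assoc_algebra.quotient_eval_form[OF algebras[OF assms(1)] N_sub_bimodule[OF assms(1)] assms(2)]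
  by (simp add: Gamma_of_def d_of_def[abs_def])

lemma Gamma_eval_form_zero:
  assumes \<alpha>: "\<alpha> \<in> carrier \<pi>" and q: "q \<in> carrier (AT \<alpha> \<alpha>)"
  shows "fodc.eval_form (Gamma_of k \<pi> A \<Delta> R \<alpha>) (d_of k \<pi> A \<Delta> R \<alpha>) q = N \<alpha>
    \<longleftrightarrow> q \<ominus>\<^bsub>AT \<alpha> \<alpha>\<^esub> pt \<alpha> \<alpha> (mult_map (A \<alpha>) q) \<one>\<^bsub>A \<alpha>\<^esub> \<in> N \<alpha>"
proof -
  interpret B: assoc_algebra k "A \<alpha>" by (rule algebras[OF \<alpha>])
  interpret S: sub_bimodule k "A \<alpha>" B.U "N \<alpha>" by (rule N_sub_bimodule[OF \<alpha>])
  show ?thesis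
    unfolding Gamma_eval_form[OF \<alpha> q]
    by (rule S.proj_zero_iff[OF linear_maps_closed[OF B.universal_part_linear q]])
qed

lemma Gamma_zero: "\<zero>\<^bsub>Gamma_of k \<pi> A \<Delta> R \<alpha>\<^esub> = N \<alpha>"
  by (simp add: Gamma_of_def quotient_bimod_def)

lemma Gamma_left_covariant: "left_covariant k \<pi> A \<Delta> (Gamma_of k \<pi> A \<Delta> R) (d_of k \<pi> A \<Delta> R)"
  unfolding left_covariant_def
proof (intro ballI allI impI)
  fix \<alpha> \<beta> and n :: nat and a b
  assume \<alpha> [simp]: "\<alpha> \<in> carrier \<pi>" and \<beta> [simp]: "\<beta> \<in> carrier \<pi>"
  let ?\<gamma> = "\<alpha> \<otimes> \<beta>" and ?G = "Gamma_of k \<pi> A \<Delta> R" and ?d = "d_of k \<pi> A \<Delta> R"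
  assume a: "a \<in> {..<n} \<rightarrow> carrier (A ?\<gamma>)" and b: "b \<in> {..<n} \<rightarrow> carrier (A ?\<gamma>)"
    and z: "(\<Oplus>\<^bsub>?G ?\<gamma>\<^esub>j\<in>{..<n}. lact (?G ?\<gamma>) (a j) (?d ?\<gamma> (b j))) = \<zero>\<^bsub>?G ?\<gamma>\<^esub>"
  have \<gamma> [simp]: "?\<gamma> \<in> carrier \<pi>" by simp
  interpret B: hopf_fodc k \<pi> A \<Delta> \<epsilon> S \<beta> "?G \<beta>" "?d \<beta>"
    by (intro hopf_fodc.intro hopf_group_coalgebra_axioms hopf_fodc_axioms.intro Gamma_fodc) auto
  interpret G: fodc k "A ?\<gamma>" "?G ?\<gamma>" "?d ?\<gamma>" by (rule Gamma_fodc[OF \<gamma>])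
  interpret T: module k "B.AM \<alpha>" by simp
  let ?q = "\<Oplus>\<^bsub>AT ?\<gamma> ?\<gamma>\<^esub>j\<in>{..<n}. pt ?\<gamma> ?\<gamma> (a j) (b j)"
  let ?p = "pt ?\<gamma> ?\<gamma> (mult_map (A ?\<gamma>) ?q) \<one>\<^bsub>A ?\<gamma>\<^esub>"
  have q: "?q \<in> carrier (AT ?\<gamma> ?\<gamma>)" using a b by (intro G.AA.T.finsum_closed) (auto simp: Pi_iff)
  have m: "mult_map (A ?\<gamma>) ?q \<in> carrier (A ?\<gamma>)" by (rule G.mult_map_closed[OF q])
  \<comment> \<open>For \<open>x\<close> in \<open>R\<close> the tensor
    \<open>r\<^sup>-\<^sup>1(1 \<otimes> x)\<close> lies in \<open>N \<beta>\<close>. It has product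
    zero, so it is its own projection and its class in the quotient vanishes.\<close>
  have omega: "B.omega x = \<zero>\<^bsub>?G \<beta>\<^esub>" if "x \<in> R" for x
  proof -
    have x: "x \<in> carrier (A \<one>)" using R_subset that by blast
    let ?s = "r_inv \<beta> (pt \<beta> \<one> \<one>\<^bsub>A \<beta>\<^esub> x)"
    have s: "?s \<in> carrier (AT \<beta> \<beta>)" using x by (intro linear_maps_closed[OF r_inv_linear]) auto
    have N: "?s \<in> N \<beta>"
      using s x that by (simp add: N_mem r_r_inv pure_in_tensor_subspace)
    have "mult_map (A \<beta>) ?s = \<zero>\<^bsub>A \<beta>\<^esub>" using N_universal[OF \<beta> N] by (simp add: B.C.carrier_U)
    then have "?s \<ominus>\<^bsub>AT \<beta> \<beta>\<^esub> pt \<beta> \<beta> (mult_map (A \<beta>) ?s) \<one>\<^bsub>A \<beta>\<^esub> = ?s"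
      using s by (simp add: B.C.AA.pure_zero B.C.AA.T.minus_zero_right)
    then show ?thesis using N Gamma_eval_form_zero[OF \<beta> s] by (simp add: B.omega_def Gamma_zero)
  qed
  \<comment> \<open>The given relation says that the part of \<open>?q\<close> with product zero is
    trivial in the quotient; the remaining part \<open>m(?q) \<otimes> 1\<close> is treated
    below.\<close>
  have N: "?q \<ominus>\<^bsub>AT ?\<gamma> ?\<gamma>\<^esub> ?p \<in> N ?\<gamma>"
    using Gamma_eval_form_zero[OF \<gamma> q] z G.eval_form_finsum[OF a b] by (simp add: Gamma_zero)
  have "B.coact \<alpha> (r ?\<gamma> (?q \<ominus>\<^bsub>AT ?\<gamma> ?\<gamma>\<^esub> ?p)) = \<zero>\<^bsub>B.AM \<alpha>\<^esub>"
  proof (rule linear_maps_tensor_subspace_zero[OF _ _ _ R_subset B.coact_linear])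
    show "r ?\<gamma> (?q \<ominus>\<^bsub>AT ?\<gamma> ?\<gamma>\<^esub> ?p) \<in> AR ?\<gamma>" using N by (simp add: N_mem)
    show "B.coact \<alpha> (pt ?\<gamma> \<one> v x) = \<zero>\<^bsub>B.AM \<alpha>\<^esub>" if "v \<in> carrier (A ?\<gamma>)" "x \<in> R" for v x
      using that subsetD[OF R_subset] omega by (intro B.coact_vanish) auto
  qed auto
  \<comment> \<open>\<open>r\<close> sends \<open>m(?q) \<otimes> 1\<close> to
    \<open>m(?q) \<otimes> 1\<close>, now with the unit of \<open>A \<one>\<close>, and
    \<open>omega(1) = 0\<close>.\<close>
  moreover have "B.coact \<alpha> (r ?\<gamma> ?p) = \<zero>\<^bsub>B.AM \<alpha>\<^esub>"
  proof -
    have bl: "(\<lambda>u x. pt ?\<gamma> \<one> (mult_map (A ?\<gamma>) ?q \<otimes>\<^bsub>A ?\<gamma>\<^esub> u) x) \<in> bilinear_maps k (A ?\<gamma>) (A \<one>) (AT ?\<gamma> \<one>)"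
      using m by (intro lin; simp)
    have "r ?\<gamma> ?p = pt ?\<gamma> \<one> (mult_map (A ?\<gamma>) ?q) \<one>\<^bsub>A \<one>\<^esub>"
      using sw_one[OF _ \<gamma> one_closed bl] m by (simp add: r_pure)
    then show ?thesis using m by (simp add: B.coact_vanish B.omega_one)
  qed
  moreover have "B.coact \<alpha> (r ?\<gamma> (?q \<ominus>\<^bsub>AT ?\<gamma> ?\<gamma>\<^esub> ?p)) = B.coact \<alpha> (r ?\<gamma> ?q) \<ominus>\<^bsub>B.AM \<alpha>\<^esub> B.coact \<alpha> (r ?\<gamma> ?p)"
    using q m by (intro linear_maps_minus[OF linear_maps_comp[OF B.coact_linear r_linear]]) auto
  moreover have "B.coact \<alpha> (r ?\<gamma> ?q) \<in> carrier (B.AM \<alpha>)"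
    using q by (intro linear_maps_closed[OF linear_maps_comp[OF B.coact_linear r_linear]]) auto
  ultimately have "B.coact \<alpha> (r ?\<gamma> ?q) = \<zero>\<^bsub>B.AM \<alpha>\<^esub>" by (simp add: T.minus_zero_right)
  then show "(\<Oplus>\<^bsub>tensor_module k (A \<alpha>) (?G \<beta>)\<^esub>j\<in>{..<n}.
      tensor_bimap k (A \<alpha>) (?G \<beta>) (monoid.mult (A \<alpha>)) (lact (?G \<beta>)) (\<Delta> \<alpha> \<beta> (a j))
        (tensor_map k (A \<alpha>) (?G \<beta>) id (?d \<beta>) (\<Delta> \<alpha> \<beta> (b j)))) = \<zero>\<^bsub>tensor_module k (A \<alpha>) (?G \<beta>)\<^esub>"
    using B.sum_coaction[OF \<alpha> a b] by simp
qed

end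

section \<open>The right ideal of a left covariant calculus\<close>

locale hopf_covariant_fodc = hopf_group_coalgebra k \<pi> A \<Delta> \<epsilon> S
  for k :: "'k ring" and \<pi> :: "'g monoid" (structure) and A :: "'g \<Rightarrow> ('k, 'a) module" and \<Delta> \<epsilon> S +
  fixes \<Gamma> :: "'g \<Rightarrow> ('k, 'a, 'm) bimod" and d
  assumes graded: "graded_fodc k \<pi> A \<Gamma> d" and covariant: "left_covariant k \<pi> A \<Delta> \<Gamma> d"
begin

lemma hopf_fodc: "\<beta> \<in> carrier \<pi> \<Longrightarrow> hopf_fodc k \<pi> A \<Delta> \<epsilon> S \<beta> (\<Gamma> \<beta>) (d \<beta>)"
  using graded by (intro hopf_fodc.intro hopf_group_coalgebra_axioms hopf_fodc_axioms.intro) (auto simp: graded_fodc_def)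

sublocale one: hopf_fodc_one k \<pi> A \<Delta> \<epsilon> S "\<Gamma> \<one>\<^bsub>\<pi>\<^esub>" "d \<one>\<^bsub>\<pi>\<^esub>"
  using hopf_fodc[OF one_closed] by (simp add: hopf_fodc_one_def)

abbreviation ev where "ev \<alpha> \<equiv> fodc.eval_form (\<Gamma> \<alpha>) (d \<alpha>)"
abbreviation om where "om \<beta> \<equiv> hopf_fodc.omega k \<pi> A \<Delta> S \<beta> (\<Gamma> \<beta>) (d \<beta>)"

text \<open>Left covariance for arbitrary tensors: every \<open>q\<close> is a finite sum of pure
  tensors, and for such a sum premise and conclusion of \<open>left_covariant\<close> are
  \<open>ev\<close> and the coaction.\<close>

lemma coact_zero:
  assumes \<alpha> [simp]: "\<alpha> \<in> carrier \<pi>" and \<beta> [simp]: "\<beta> \<in> carrier \<pi>"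
    and q: "q \<in> carrier (AT (\<alpha> \<otimes> \<beta>) (\<alpha> \<otimes> \<beta>))" and z: "ev (\<alpha> \<otimes> \<beta>) q = \<zero>\<^bsub>\<Gamma> (\<alpha> \<otimes> \<beta>)\<^esub>"
  shows "hopf_fodc.coact k \<pi> A \<Delta> S \<beta> (\<Gamma> \<beta>) (d \<beta>) \<alpha> (r (\<alpha> \<otimes> \<beta>) q) = \<zero>\<^bsub>tensor_module k (A \<alpha>) (\<Gamma> \<beta>)\<^esub>"
proof -
  have \<gamma>: "\<alpha> \<otimes> \<beta> \<in> carrier \<pi>" by simp
  interpret B: hopf_fodc k \<pi> A \<Delta> \<epsilon> S \<beta> "\<Gamma> \<beta>" "d \<beta>" by (rule hopf_fodc[OF \<beta>])
  interpret G: fodc k "A (\<alpha> \<otimes> \<beta>)" "\<Gamma> (\<alpha> \<otimes> \<beta>)" "d (\<alpha> \<otimes> \<beta>)" using graded \<gamma> by (simp add: graded_fodc_def)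
  obtain n :: nat and a b where ab: "a \<in> {..<n} \<rightarrow> carrier (A (\<alpha> \<otimes> \<beta>))" "b \<in> {..<n} \<rightarrow> carrier (A (\<alpha> \<otimes> \<beta>))"
    and q': "q = (\<Oplus>\<^bsub>AT (\<alpha> \<otimes> \<beta>) (\<alpha> \<otimes> \<beta>)\<^esub>j\<in>{..<n}. pt (\<alpha> \<otimes> \<beta>) (\<alpha> \<otimes> \<beta>) (a j) (b j))"
    using tensor_finite_sum[OF alg_module[OF \<gamma>] alg_module[OF \<gamma>] q] by blast
  have "(\<Oplus>\<^bsub>\<Gamma> (\<alpha> \<otimes> \<beta>)\<^esub>j\<in>{..<n}. lact (\<Gamma> (\<alpha> \<otimes> \<beta>)) (a j) (d (\<alpha> \<otimes> \<beta>) (b j))) = \<zero>\<^bsub>\<Gamma> (\<alpha> \<otimes> \<beta>)\<^esub>"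
    using G.eval_form_finsum[OF ab] z q' by simp
  then show ?thesis
    unfolding q' B.sum_coaction[OF \<alpha> ab, symmetric]
    using covariant[unfolded left_covariant_def] ab \<alpha> \<beta> by blast
qed

text \<open>Covariance for (\<open>inv \<beta>\<close>, \<open>\<beta>\<close>), whose product is
  the identity, applies to \<open>r\<^sup>-\<^sup>1(1 \<otimes> x)\<close>. This tensor is a
  relation in degree 1, and its coaction \<open>1 \<otimes> omega(x)\<close> in degree
  \<open>\<beta>\<close> must vanish.\<close>

lemma omega_zero:
  assumes \<beta> [simp]: "\<beta> \<in> carrier \<pi>" and x: "x \<in> carrier (A \<one>)" and z: "one.omega x = \<zero>\<^bsub>\<Gamma> \<one>\<^esub>"
  shows "om \<beta> x = \<zero>\<^bsub>\<Gamma> \<beta>\<^esub>"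
proof -
  interpret B: hopf_fodc k \<pi> A \<Delta> \<epsilon> S \<beta> "\<Gamma> \<beta>" "d \<beta>" by (rule hopf_fodc[OF \<beta>])
  let ?q = "r_inv \<one> (pt \<one> \<one> \<one>\<^bsub>A \<one>\<^esub> x)"
  have q: "?q \<in> carrier (AT \<one> \<one>)" using x by (intro linear_maps_closed[OF r_inv_linear]) auto
  have "B.coact (inv \<beta>) (r \<one> ?q) = \<zero>\<^bsub>B.AM (inv \<beta>)\<^esub>"
    using coact_zero[of "inv \<beta>" \<beta> ?q] q z by (simp add: one.omega_def)
  then show ?thesis using x by (intro B.coact_unit) (auto simp: r_r_inv)
qed

text \<open>Covariance for (\<open>\<alpha>\<close>, \<open>\<one>\<close>) carries the relation
  into \<open>A \<alpha> \<otimes> \<Gamma> \<one>\<close>, where \<open>coact_kernel\<close>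
  applies; product zero supplies its counit hypothesis.\<close>

lemma kernel_in_subspace:
  assumes \<alpha> [simp]: "\<alpha> \<in> carrier \<pi>" and q: "q \<in> carrier (AT \<alpha> \<alpha>)"
    and m: "mult_map (A \<alpha>) q = \<zero>\<^bsub>A \<alpha>\<^esub>" and z: "ev \<alpha> q = \<zero>\<^bsub>\<Gamma> \<alpha>\<^esub>"
  shows "r \<alpha> q \<in> tensor_subspace k (A \<alpha>) (A \<one>) one.R"
proof (rule one.coact_kernel[OF \<alpha>])
  show "r \<alpha> q \<in> carrier (AT \<alpha> \<one>)" by (rule linear_maps_closed[OF r_linear[OF \<alpha>] q])
  show "one.coact \<alpha> (r \<alpha> q) = \<zero>\<^bsub>one.AM \<alpha>\<^esub>" using coact_zero[of \<alpha> \<one> q] q z by simp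
  show "id_counit \<alpha> (r \<alpha> q) = \<zero>\<^bsub>A \<alpha>\<^esub>" using id_counit_r[OF \<alpha> q] m by simp
qed

text \<open>The evaluation is \<open>a \<otimes> x \<mapsto> a omega(x)\<close> with
  \<open>omega\<close> of degree \<open>\<alpha>\<close>, while the ideal is defined in degree 1;
  \<open>omega_zero\<close> closes the gap.\<close>

lemma subspace_in_kernel:
  assumes \<alpha> [simp]: "\<alpha> \<in> carrier \<pi>" and q: "q \<in> carrier (AT \<alpha> \<alpha>)"
    and rq: "r \<alpha> q \<in> tensor_subspace k (A \<alpha>) (A \<one>) one.R"
  shows "ev \<alpha> q = \<zero>\<^bsub>\<Gamma> \<alpha>\<^esub>"
proof -
  interpret B: hopf_fodc k \<pi> A \<Delta> \<epsilon> S \<alpha> "\<Gamma> \<alpha>" "d \<alpha>" by (rule hopf_fodc[OF \<alpha>])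
  show ?thesis
    unfolding B.eval_form_r[OF q]
    by (rule linear_maps_tensor_subspace_zero[OF _ _ _ _ tensor_lift_linear[OF _ _ _ B.act_omega_bilinear] _ rq])
       (auto simp: one.R_def tensor_lift_pure[OF _ _ _ B.act_omega_bilinear] omega_zero B.C.lact_zero)
qed

lemma counit_zero: "\<epsilon> \<zero>\<^bsub>A \<one>\<^esub> = \<zero>\<^bsub>k\<^esub>" and counit_neg: "x \<in> carrier (A \<one>) \<Longrightarrow> \<epsilon> (\<ominus>\<^bsub>A \<one>\<^esub> x) = \<ominus>\<^bsub>k\<^esub> \<epsilon> x"
proof -
  interpret B: module k "A \<one>" by simp
  show "\<epsilon> \<zero>\<^bsub>A \<one>\<^esub> = \<zero>\<^bsub>k\<^esub>" using counit_linear[of "\<zero>\<^bsub>k\<^esub>" "\<zero>\<^bsub>A \<one>\<^esub>"] by simp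
  show "\<epsilon> (\<ominus>\<^bsub>A \<one>\<^esub> x) = \<ominus>\<^bsub>k\<^esub> \<epsilon> x" if "x \<in> carrier (A \<one>)"
    using counit_linear[of "\<ominus>\<^bsub>k\<^esub> \<one>\<^bsub>k\<^esub>" x] that by (simp add: module.smult_l_minus[OF alg_module[OF one_closed]] l_minus)
qed

lemma R_subgroup: "subgroup one.R (add_monoid (A \<one>))"
proof -
  interpret B: module k "A \<one>" by simp
  note om = one.omega_linear
  show ?thesis
  proof (intro subgroup.intro)
    fix x assume x: "x \<in> one.R"
    then have "\<ominus>\<^bsub>A \<one>\<^esub> x \<in> one.R"
      by (simp add: one.R_def counit_neg linear_maps_a_inv[OF om])
    then show "inv\<^bsub>add_monoid (A \<one>)\<^esub> x \<in> one.R" by (simp add: a_inv_def)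
  qed (auto simp: one.R_def counit_zero counit_add linear_maps_add[OF om] linear_maps_zero[OF om])
qed

text \<open>
  The kernel of \<open>eval_form\<close> in the universal calculus is a right module, so it contains
  \<open>r\<^sup>-\<^sup>1(1 \<otimes> x) a\<close>, whose image under \<open>r\<close> is \<open>a\<^sub>1 \<otimes> x a\<^sub>2\<close>; applying \<open>\<epsilon> \<otimes> id\<close> yields \<open>x a\<close>.
\<close>

lemma R_right_ideal: "right_ideal one.R (A \<one>)"
  unfolding right_ideal_def
proof (intro conjI ballI additive_subgroup.intro R_subgroup)
  fix x a assume "x \<in> one.R" and a: "a \<in> carrier (A \<one>)"
  then have x: "x \<in> carrier (A \<one>)" "one.omega x = \<zero>\<^bsub>\<Gamma> \<one>\<^esub>" "\<epsilon> x = \<zero>\<^bsub>k\<^esub>" by (auto simp: one.R_def)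
  let ?T = "AT \<one> \<one>" and ?p = "pt \<one> \<one>"
  let ?q = "r_inv \<one> (?p \<one>\<^bsub>A \<one>\<^esub> x)"
  have q: "?q \<in> carrier ?T" using x by (intro linear_maps_closed[OF r_inv_linear]) auto
  have m: "mult_map (A \<one>) ?q = \<zero>\<^bsub>A \<one>\<^esub>"
    using id_counit_r[OF one_closed q] x by (simp add: r_r_inv id_counit_pure)
  have qa: "ract one.C.U ?q a \<in> carrier ?T" by (rule one.C.ract_T_closed[OF a q])
  \<comment> \<open>\<open>omega x\<close> is \<open>ev \<one> ?q\<close> by definition, and the
    Leibniz defect carries the factor \<open>m(?q) = \<epsilon>(x) 1 = 0\<close>.\<close>
  have "ev \<one> (ract one.C.U ?q a) = ract (\<Gamma> \<one>) (one.omega x) a \<oplus>\<^bsub>\<Gamma> \<one>\<^esub> lact (\<Gamma> \<one>) \<zero>\<^bsub>A \<one>\<^esub> (d \<one> a)"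
    using one.C.eval_form_ract[OF a q] m by (simp add: one.omega_def)
  also have "\<dots> = \<zero>\<^bsub>\<Gamma> \<one>\<^esub>"
    using linear_maps_zero[OF one.C.ract_map_linear[OF a]] linear_maps_zero[OF one.C.lact_arg_linear[OF one.C.d_closed[OF a]]] x(2)
    by simp
  finally have ev: "ev \<one> (ract one.C.U ?q a) = \<zero>\<^bsub>\<Gamma> \<one>\<^esub>" .
  have "mult_map (A \<one>) (ract one.C.U ?q a) = \<zero>\<^bsub>A \<one>\<^esub>" using a q m by (simp add: one.C.mult_map_ract)
  then have rq: "r \<one> (ract one.C.U ?q a) \<in> tensor_subspace k (A \<one>) (A \<one>) one.R"
    using kernel_in_subspace[OF one_closed qa] ev by simp
  have bl: "(\<lambda>s x. sw ?T \<one> \<one> (\<lambda>u v. ?p (s \<otimes>\<^bsub>A \<one>\<^esub> u) (x \<otimes>\<^bsub>A \<one>\<^esub> v)) a) \<in> bilinear_maps k (A \<one>) (A \<one>) ?T"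
    using a by (intro lin; simp)
  have rq_eq: "r \<one> (ract one.C.U ?q a) = sw ?T \<one> \<one> (\<lambda>u v. ?p (\<one>\<^bsub>A \<one>\<^esub> \<otimes>\<^bsub>A \<one>\<^esub> u) (x \<otimes>\<^bsub>A \<one>\<^esub> v)) a"
    using x q a by (simp add: r_ract r_r_inv tensor_lift_pure[OF _ _ _ bl])
  have be: "(\<lambda>s t. \<epsilon> s \<odot>\<^bsub>A \<one>\<^esub> t) \<in> bilinear_maps k (A \<one>) (A \<one>) (A \<one>)" by (intro lin; simp)
  let ?e = "tensor_lift (A \<one>) (\<lambda>s t. \<epsilon> s \<odot>\<^bsub>A \<one>\<^esub> t)"
  have le: "?e \<in> linear_maps k ?T (A \<one>)" by (intro tensor_lift_linear be) auto
  \<comment> \<open>\<open>R\<close> is closed under scalars, so \<epsilon> \<otimes> id maps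
    \<open>A \<otimes> R\<close> into \<open>R\<close>.\<close>
  have "?e (r \<one> (ract one.C.U ?q a)) \<in> one.R"
    by (rule linear_maps_tensor_subspace[OF _ _ _ _ le R_subgroup _ rq])
       (auto simp: tensor_lift_pure[OF _ _ _ be] one.R_def linear_maps_smult[OF one.omega_linear] counit_linear
         one.C.Bim.smult_r_null)
  also have "?e (r \<one> (ract one.C.U ?q a)) = sw (A \<one>) \<one> \<one> (\<lambda>u v. ?e (?p (\<one>\<^bsub>A \<one>\<^esub> \<otimes>\<^bsub>A \<one>\<^esub> u) (x \<otimes>\<^bsub>A \<one>\<^esub> v))) a"
    unfolding rq_eq using x a by (intro linear_sw[OF _ _ _ _ le] lin; simp)
  also have "\<dots> = sw (A \<one>) \<one> \<one> (\<lambda>u v. \<epsilon> u \<odot>\<^bsub>A \<one>\<^esub> (x \<otimes>\<^bsub>A \<one>\<^esub> v)) a"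
    using x a by (intro sw_cong; simp add: tensor_lift_pure[OF _ _ _ be])
  also have "\<dots> = x \<otimes>\<^bsub>A \<one>\<^esub> a"
    using x a by (intro sw_counit_left lin; simp)
  finally show "x \<otimes>\<^bsub>A \<one>\<^esub> a \<in> one.R" .
qed

lemma R_kernel: "one.R \<subseteq> a_kernel (A \<one>) k \<epsilon>"
  by (auto simp: a_kernel_def' one.R_def)

text \<open>The two kernel lemmas identify \<open>N\<close> for this ideal with the kernel of
  \<open>ev \<alpha>\<close> on tensors of product zero. Each \<open>\<Gamma> \<alpha>\<close> is
  then the corresponding quotient, and the isomorphisms of all degrees are collected by
  choice.\<close>

lemma isomorphic_Gamma: "isomorphic_fodc \<pi> A \<Gamma> d (Gamma_of k \<pi> A \<Delta> one.R) (d_of k \<pi> A \<Delta> one.R)"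
proof -
  interpret I: hopf_right_ideal k \<pi> A \<Delta> \<epsilon> S one.R
    by (intro hopf_right_ideal.intro hopf_group_coalgebra_axioms hopf_right_ideal_axioms.intro R_right_ideal R_kernel)
  have "\<exists>i \<in> bimodule_isos (A \<alpha>) (\<Gamma> \<alpha>) (Gamma_of k \<pi> A \<Delta> one.R \<alpha>).
      \<forall>b\<in>carrier (A \<alpha>). i (d \<alpha> b) = d_of k \<pi> A \<Delta> one.R \<alpha> b" if \<alpha>: "\<alpha> \<in> carrier \<pi>" for \<alpha>
  proof -
    interpret G: fodc k "A \<alpha>" "\<Gamma> \<alpha>" "d \<alpha>" using graded \<alpha> by (simp add: graded_fodc_def)
    show ?thesis
      unfolding Gamma_of_def d_of_def
    proof (rule G.isomorphic_quotient[OF I.N_sub_bimodule[OF \<alpha>]])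
      fix q assume "q \<in> carrier G.U"
      then show "q \<in> I.N \<alpha> \<longleftrightarrow> G.eval_form q = \<zero>\<^bsub>\<Gamma> \<alpha>\<^esub>"
        using kernel_in_subspace[OF \<alpha>] subspace_in_kernel[OF \<alpha>] by (auto simp: G.carrier_U I.N_mem)
    qed
  qed
  then have "\<exists>i. \<forall>\<alpha>\<in>carrier \<pi>. i \<alpha> \<in> bimodule_isos (A \<alpha>) (\<Gamma> \<alpha>) (Gamma_of k \<pi> A \<Delta> one.R \<alpha>) \<and>
      (\<forall>b\<in>carrier (A \<alpha>). i \<alpha> (d \<alpha> b) = d_of k \<pi> A \<Delta> one.R \<alpha> b)"
    by (intro bchoice) blast
  then show ?thesis by (simp add: isomorphic_fodc_def)
qed

end

theorem theorem4p3:
  fixes k :: "'k ring" and \<pi> :: "'g monoid"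
    and A :: "'g \<Rightarrow> ('k, 'a) module"
    and \<Delta> :: "'g \<Rightarrow> 'g \<Rightarrow> 'a \<Rightarrow> ('a, 'a) tensor"
    and \<epsilon> :: "'a \<Rightarrow> 'k" and S :: "'g \<Rightarrow> 'a \<Rightarrow> 'a"
  assumes "hopf_group_coalgebra k \<pi> A \<Delta> \<epsilon> S"
  shows
    "(\<forall>R. right_ideal R (A \<one>\<^bsub>\<pi>\<^esub>) \<and> R \<subseteq> a_kernel (A \<one>\<^bsub>\<pi>\<^esub>) k \<epsilon> \<longrightarrow>
        (\<forall>\<alpha>\<in>carrier \<pi>.
           sub_bimodule k (A \<alpha>) (universal_bimod k (A \<alpha>)) (N_of k \<pi> A \<Delta> R \<alpha>)) \<and>
        graded_fodc k \<pi> A (Gamma_of k \<pi> A \<Delta> R) (d_of k \<pi> A \<Delta> R) \<and>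
        left_covariant k \<pi> A \<Delta> (Gamma_of k \<pi> A \<Delta> R) (d_of k \<pi> A \<Delta> R)) \<and>
     (\<forall>(\<Gamma> :: 'g \<Rightarrow> ('k, 'a, 'm) bimod) d.
        graded_fodc k \<pi> A \<Gamma> d \<and> left_covariant k \<pi> A \<Delta> \<Gamma> d \<longrightarrow>
        (\<exists>R. right_ideal R (A \<one>\<^bsub>\<pi>\<^esub>) \<and> R \<subseteq> a_kernel (A \<one>\<^bsub>\<pi>\<^esub>) k \<epsilon> \<and>
           isomorphic_fodc \<pi> A \<Gamma> d (Gamma_of k \<pi> A \<Delta> R) (d_of k \<pi> A \<Delta> R)))"
proof (intro conjI allI impI; elim conjE)
  fix R assume R: "right_ideal R (A \<one>\<^bsub>\<pi>\<^esub>)" "R \<subseteq> a_kernel (A \<one>\<^bsub>\<pi>\<^esub>) k \<epsilon>"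
  interpret hopf_right_ideal k \<pi> A \<Delta> \<epsilon> S R
    using assms R by (simp add: hopf_right_ideal_def hopf_right_ideal_axioms_def)
  show "\<forall>\<alpha>\<in>carrier \<pi>. sub_bimodule k (A \<alpha>) (universal_bimod k (A \<alpha>)) (N_of k \<pi> A \<Delta> R \<alpha>)"
    using N_sub_bimodule by blast
  show "graded_fodc k \<pi> A (Gamma_of k \<pi> A \<Delta> R) (d_of k \<pi> A \<Delta> R)"
    using Gamma_fodc by (simp add: graded_fodc_def)
  show "left_covariant k \<pi> A \<Delta> (Gamma_of k \<pi> A \<Delta> R) (d_of k \<pi> A \<Delta> R)"
    by (rule Gamma_left_covariant)
next
  fix \<Gamma> :: "'g \<Rightarrow> ('k, 'a, 'm) bimod" and d
  assume "graded_fodc k \<pi> A \<Gamma> d" "left_covariant k \<pi> A \<Delta> \<Gamma> d"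
  then interpret hopf_covariant_fodc k \<pi> A \<Delta> \<epsilon> S \<Gamma> d
    using assms by (simp add: hopf_covariant_fodc_def hopf_covariant_fodc_axioms_def)
  show "\<exists>R. right_ideal R (A \<one>\<^bsub>\<pi>\<^esub>) \<and> R \<subseteq> a_kernel (A \<one>\<^bsub>\<pi>\<^esub>) k \<epsilon> \<and>
      isomorphic_fodc \<pi> A \<Gamma> d (Gamma_of k \<pi> A \<Delta> R) (d_of k \<pi> A \<Delta> R)"
    using R_right_ideal R_kernel isomorphic_Gamma by blast
qed

end
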